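(* Consider the interactive fixed effects model $Y_{jt}^N=\lambda_j'F_t+X_{jt}'\beta+u_{jt}$, $1\le j\le N$, $1\le t\le T$, with observed covariates $X_{jt}\in\mathbb R^{k_x}$, unobserved $k$-dimensional factors $F_t$ and loadings $\lambda_j$ ($k,k_x$ fixed), and $E(u_{jt})=0$. Suppose there is a constant $D_1>0$ such that: (1) $\max_{i,t}E\|X_{it}\|_2^4\le D_1$, $\max_tE\|F_t\|_2^4\le D_1$, $\max_iE\|\lambda_i\|_2^4\le D_1$, $\max_{i,t}E|u_{it}|^8\le D_1$; (2) $N^{-1}\sum_{i=1}^N\sum_{j=1}^N\max_{t,s}|E(u_{it}u_{js})|\le D_1$ and $T^{-1}\sum_{s=1}^T\sum_{t=1}^T\max_{i,j}|E(u_{it}u_{js})|\le D_1$; (3) $(NT)^{-1}\sum_{i=1}^N\sum_{j=1}^N\sum_{s=1}^T\sum_{t=1}^T|E(u_{it}u_{js})|\le D_1$; (4) $\max_{t,s}E|N^{-1/2}\sum_{i=1}^N[u_{is}u_{it}-E(u_{is}u_{it})]|^4\le D_1$; (5) $T^{-2}N^{-1}\sum_{t,s,q,v}\sum_{i,j}|\mathrm{cov}(u_{it}u_{is},u_{jq}u_{jv})|\le D_1$; (6) $T^{-1}N^{-2}\sum_{t,s}\sum_{i,j,k,q}|\mathrm{cov}(u_{it}u_{jt},u_{ks}u_{qs})|\le D_1$; (7) the largest eigenvalue of $E(u_iu_i')$ is bounded by $D_1$, where $u_i=(u_{i1},\dots,u_{iT})'$; and moreover: (8) $u=(u_1,\dots,u_N)$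 is independent of $(X,F,\Lambda)$; (9) $F'F/T=\Sigma_F+o_P(1)$ and $\Lambda'\Lambda/N=\Sigma_\Lambda+o_P(1)$ for some positive definite matrices $\Sigma_F,\Sigma_\Lambda$; (10) $N/T$ is bounded away from zero and infinity; (11) with $X_i=(X_{i1},\dots,X_{iT})'\in\mathbb R^{T\times k_x}$ and $M_G=I_T-G(G'G)^{-1}G'$, $$\inf_{G\in\mathbb R^{T\times k}:\,G'G/T=I_k}\left\{\frac1{NT}\sum_{i=1}^NX_i'M_GX_i-\frac1T\left[\frac1{N^2}\sum_{i=1}^N\sum_{j=1}^NX_i'M_GX_j\,\lambda_i'(\Lambda'\Lambda/N)^{-1}\lambda_j\right]\right\}>0$$ (in the positive definite sense). Let $P_t^N=\lambda_1'F_t+X_{1t}'\beta$ and $\hat P_t^N=\hat\lambda_1'\hat F_t+X_{1t}'\hat\beta$, where $(\hat F,\hat\Lambda,\hat\beta)$ is the least squares estimator. Then, for any $1\le t\le T$, $$\hat P_t^N-P_t^N=O_P(1/\sqrt T+1/\sqrt N)\quad\text{and}\quad\frac1T\sum_{t=1}^T(\hat P_t^N-P_t^N)^2=O_P(1/T+1/N).$$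
   Context: $F=(F_1,\dots,F_T)'\in\mathbb R^{T\times k}$, $\Lambda=(\lambda_1,\dots,\lambda_N)'\in\mathbb R^{N\times k}$, and $X$ collects all covariates. Asymptotics are as $N,T\to\infty$. The estimator is $$(\hat F,\hat\Lambda,\hat\beta)\in\arg\min_{F,\Lambda,\beta}\sum_{t=1}^T\sum_{j=1}^N(Y_{jt}^N-X_{jt}'\beta-F_t'\lambda_j)^2\quad\text{s.t. }F'F/T=I_k,\ \Lambda'\Lambda\text{ diagonal},$$ where all $Y_{jt}^N$ are observed since the null hypothesis is imposed; $\hat F_t'$ and $\hat\lambda_j'$ are the $t$-th and $j$-th rows of $\hat F$ and $\hat\Lambda$.
   Formalization: Condition (11) is taken as the infimum being bounded away from zero in probability as N,T→∞; mere positivity for each N,T is not enough (e.g. k=k_x=1, X_11=X_22=1 and all other X_jt=0 violates the first rate at t=1). *)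

theory Defs
  imports "Jordan_Normal_Form.Char_Poly" "HOL-Probability.Probability"
begin

(* Jordan_Normal_Form is used only for eigenvalues of matrices whose size is a natural number. *)
no_notation vec_index (infixl \<open>$\<close> 100)
no_notation scalar_prod (infix \<open>\<bullet>\<close> 70)
hide_const (open) Matrix.mat

text \<open>A real matrix with \<open>m\<close> rows and \<open>k\<close> columns, \<open>m\<close> varying, is represented by the family of its
  rows \<open>A 1, \<dots>, A m\<close> in \<open>real ^ 'k\<close>; values of \<open>A\<close> outside \<open>{1..m}\<close> are irrelevant.\<close>

definition outer :: "real ^ 'a \<Rightarrow> real ^ 'b \<Rightarrow> real ^ 'b ^ 'a" where
  "outer x y = (\<chi> a b. x $ a * y $ b)"

text \<open>The product \<open>A'B\<close> of the transpose of \<open>A\<close> with \<open>B\<close>.\<close>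

definition tmul :: "nat \<Rightarrow> (nat \<Rightarrow> real ^ 'a) \<Rightarrow> (nat \<Rightarrow> real ^ 'b) \<Rightarrow> real ^ 'b ^ 'a" where
  "tmul m A B = (\<Sum>i=1..m. outer (A i) (B i))"

definition posdef :: "real ^ 'a ^ 'a \<Rightarrow> bool" where
  "posdef A \<longleftrightarrow> transpose A = A \<and> (\<forall>v. v \<noteq> 0 \<longrightarrow> 0 < v \<bullet> (A *v v))"

text \<open>The \<open>(t, s)\<close> entry of \<open>M\<^sub>G = I - G(G'G)\<^sup>-\<^sup>1G'\<close>.\<close>

definition annihilator :: "nat \<Rightarrow> (nat \<Rightarrow> real ^ 'k) \<Rightarrow> nat \<Rightarrow> nat \<Rightarrow> real" where
  "annihilator T G t s = (if t = s then 1 else 0) - G t \<bullet> (matrix_inv (tmul T G G) *v G s)"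

text \<open>The product \<open>Z'M\<^sub>GW\<close>.\<close>

definition annihilated_tmul ::
  "nat \<Rightarrow> (nat \<Rightarrow> real ^ 'k) \<Rightarrow> (nat \<Rightarrow> real ^ 'p) \<Rightarrow> (nat \<Rightarrow> real ^ 'p) \<Rightarrow> real ^ 'p ^ 'p" where
  "annihilated_tmul T G Z W =
     (\<Sum>t=1..T. \<Sum>s=1..T. annihilator T G t s *\<^sub>R outer (Z t) (W s))"

definition design_matrix ::
  "nat \<Rightarrow> nat \<Rightarrow> (nat \<Rightarrow> nat \<Rightarrow> real ^ 'p) \<Rightarrow> (nat \<Rightarrow> real ^ 'k) \<Rightarrow> (nat \<Rightarrow> real ^ 'k) \<Rightarrow> real ^ 'p ^ 'p"
where
  "design_matrix N T X \<Lambda> G =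
     (1 / (real N * real T)) *\<^sub>R (\<Sum>i=1..N. annihilated_tmul T G (X i) (X i))
     - (1 / real T) *\<^sub>R ((1 / (real N)\<^sup>2) *\<^sub>R (\<Sum>i=1..N. \<Sum>j=1..N.
         (\<Lambda> i \<bullet> (matrix_inv ((1 / real N) *\<^sub>R tmul N \<Lambda> \<Lambda>) *v \<Lambda> j)) *\<^sub>R
           annihilated_tmul T G (X i) (X j)))"

text \<open>The constraint \<open>F'F/T = I\<close>.\<close>

definition normalized :: "nat \<Rightarrow> (nat \<Rightarrow> real ^ 'k) \<Rightarrow> bool" where
  "normalized T F \<longleftrightarrow> (1 / real T) *\<^sub>R tmul T F F = mat 1"

definition diagonal_matrix :: "real ^ 'k ^ 'k \<Rightarrow> bool" where
  "diagonal_matrix A \<longleftrightarrow> (\<forall>a b. a \<noteq> b \<longrightarrow> A $ a $ b = 0)"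

definition ife_mean :: "real ^ 'k \<Rightarrow> real ^ 'k \<Rightarrow> real ^ 'p \<Rightarrow> real ^ 'p \<Rightarrow> real" where
  "ife_mean l f x b = l \<bullet> f + x \<bullet> b"

definition is_least_squares ::
  "nat \<Rightarrow> nat \<Rightarrow> (nat \<Rightarrow> nat \<Rightarrow> real) \<Rightarrow> (nat \<Rightarrow> nat \<Rightarrow> real ^ 'p) \<Rightarrow>
   (nat \<Rightarrow> real ^ 'k) \<Rightarrow> (nat \<Rightarrow> real ^ 'k) \<Rightarrow> real ^ 'p \<Rightarrow> bool" where
  "is_least_squares N T Y X Fh Lh bh \<longleftrightarrow>
     is_arg_min
       (\<lambda>(F, \<Lambda>, b). \<Sum>t=1..T. \<Sum>j=1..N. (Y j t - ife_mean (\<Lambda> j) (F t) (X j t) b)\<^sup>2)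
       (\<lambda>(F, \<Lambda>, b). normalized T F \<and> diagonal_matrix (tmul N \<Lambda> \<Lambda>))
       (Fh, Lh, bh)"

definition cov :: "'w measure \<Rightarrow> ('w \<Rightarrow> real) \<Rightarrow> ('w \<Rightarrow> real) \<Rightarrow> real" where
  "cov M f g = (\<integral>\<omega>. (f \<omega> - (\<integral>\<omega>'. f \<omega>' \<partial>M)) * (g \<omega> - (\<integral>\<omega>'. g \<omega>' \<partial>M)) \<partial>M)"

text \<open>Independence of two random elements; \<open>prob_space.indep_var\<close> would force their ranges to
  have the same type.\<close>

definition indep_rv ::
  "'w measure \<Rightarrow> 'a measure \<Rightarrow> ('w \<Rightarrow> 'a) \<Rightarrow> 'b measure \<Rightarrow> ('w \<Rightarrow> 'b) \<Rightarrow> bool" where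
  "indep_rv M S U R V \<longleftrightarrow> U \<in> measurable M S \<and> V \<in> measurable M R \<and>
     prob_space.indep_set M {U -` A \<inter> space M | A. A \<in> sets S}
       {V -` B \<inter> space M | B. B \<in> sets R}"

text \<open>\<open>Z n = O\<^sub>P(r n)\<close>, \<open>Z n = z + o\<^sub>P(1)\<close>; the probability space may vary with \<open>n\<close>.\<close>

definition big_OP :: "(nat \<Rightarrow> 'w measure) \<Rightarrow> (nat \<Rightarrow> 'w \<Rightarrow> real) \<Rightarrow> (nat \<Rightarrow> real) \<Rightarrow> bool" where
  "big_OP M Z r \<longleftrightarrow> (\<forall>\<epsilon>>0. \<exists>C. \<forall>\<^sub>F n in sequentially.
     measure (M n) {\<omega> \<in> space (M n). \<bar>Z n \<omega>\<bar> > C * r n} \<le> \<epsilon>)"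

definition conv_in_prob ::
  "(nat \<Rightarrow> 'w measure) \<Rightarrow> (nat \<Rightarrow> 'w \<Rightarrow> 'b::real_normed_vector) \<Rightarrow> 'b \<Rightarrow> bool" where
  "conv_in_prob M Z z \<longleftrightarrow> (\<forall>\<epsilon>>0.
     (\<lambda>n. measure (M n) {\<omega> \<in> space (M n). norm (Z n \<omega> - z) > \<epsilon>}) \<longlonglongrightarrow> 0)"

text \<open>\<open>inf\<^sub>G D(G) > 0\<close> in the positive definite sense, the infimum being over all normalized \<open>G\<close>.
  Since \<open>D\<close> is random and changes with \<open>n\<close>, the infimum is required to be bounded away from zero in
  probability. Mere positivity for each \<open>n\<close> would let it vanish in the limit, and then the slope
  coefficient need not be estimated consistently.\<close>

definition inf_design_positive ::
  "(nat \<Rightarrow> 'w measure) \<Rightarrow> (nat \<Rightarrow> nat) \<Rightarrow> (nat \<Rightarrow> nat) \<Rightarrow>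
   (nat \<Rightarrow> nat \<Rightarrow> nat \<Rightarrow> 'w \<Rightarrow> real ^ 'p) \<Rightarrow> (nat \<Rightarrow> nat \<Rightarrow> 'w \<Rightarrow> real ^ 'k) \<Rightarrow> bool" where
  "inf_design_positive M N T X \<Lambda> \<longleftrightarrow> (\<forall>\<delta>>0. \<exists>c>0. \<forall>\<^sub>F n in sequentially.
     measure (M n) {\<omega> \<in> space (M n). \<forall>G :: nat \<Rightarrow> real ^ 'k. normalized (T n) G \<longrightarrow>
         posdef (design_matrix (N n) (T n) (\<lambda>i t. X n i t \<omega>) (\<lambda>i. \<Lambda> n i \<omega>) G - c *\<^sub>R mat 1)}
       \<ge> 1 - \<delta>)"

end

theory Submission
  imports Defs
begin

text \<open>Let \<open>\<delta>\<close> be the estimation error of the slope, \<open>d\<close> the Hilbert-Schmidt distance between the projections onto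
  the estimated and the true factors, and \<open>r = T\<^sup>-\<^sup>1\<^sup>/\<^sup>2 + N\<^sup>-\<^sup>1\<^sup>/\<^sup>2\<close>. All second moments are bounded with the right
  powers of \<open>r\<close>; in particular \<open>UU'/(NT) = O\<^sub>P(r)\<close> in Hilbert-Schmidt norm, although the operator norm of \<open>U\<close>
  is only controlled up to \<open>(NT)\<^sup>1\<^sup>/\<^sup>2r\<^sup>1\<^sup>/\<^sup>2\<close>. No expansion of the estimator is needed to get the rates of \<open>d\<close> and
  \<open>\<delta>\<close>: comparing the minimum with the true factors at the estimated slope gives \<open>d = O(r + |\<delta>|)\<close>,
  because the signal is quadratic in \<open>d\<close> and the noise linear; comparing it with the true factors at the
  true slope gives \<open>c|\<delta>|\<^sup>2 = O(dr + |\<delta>|r + d|\<delta>|r\<^sup>1\<^sup>/\<^sup>2)\<close> by the design condition. Hence \<open>\<delta>\<close> and \<open>d\<close> are \<open>O(r)\<close>,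
  which yields the mean square statement. For a single period \<open>\<tau>\<close>, the first order condition for the row \<open>\<tau>\<close> of the
  estimated factors is a linear equation for row \<open>\<tau>\<close> of the true factors projected off the estimated ones;
  its right-hand side is \<open>O(r)\<close>, where the eigenvalue condition bounds the row \<open>\<tau>\<close> of \<open>E(UU')\<close>.\<close>

section \<open>Averages and root mean squares\<close>

text \<open>Averages over periods and units in place of sums keep every constant independent of the
  sample size. A deterministic part derives the error bounds from finitely many inequalities for one
  realization; probability enters only to show that these hold off an event of small probability. At
  the estimated factors, the design quadratic form of the slope error is at most the mean squared
  residual of common component minus covariate effect, whatever the true factors are, so the second
  comparison needs no prior consistency. Inserting d = O(r + |\<delta>|) there leaves a term
  |\<delta>|^2 sqrt r, which the left side absorbs once r is small. The true factors need not
  satisfy the constraints: a change of basis whitens them, and a rotation deals with diagonality.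
  For a single period the obstacle is that the normalization bounds only the mean of |H t|^2, so row
  \<tau> of the estimated factors is first bounded from its own normal equation. The errors in the
  fitted loadings are only O(sqrt r) in root mean square; this suffices because they occur squared,
  as a perturbation of an invertible matrix, or paired with an error row, where the rate is
  r.\<close>

definition avg :: "'i set \<Rightarrow> ('i \<Rightarrow> 'a::real_vector) \<Rightarrow> 'a" where
  "avg I f = (1 / real (card I)) *\<^sub>R sum f I"

definition rms :: "'i set \<Rightarrow> ('i \<Rightarrow> 'a::real_normed_vector) \<Rightarrow> real" where
  "rms I f = sqrt (avg I (\<lambda>i. (norm (f i))\<^sup>2))"

lemma avg_cong: "(\<And>i. i \<in> I \<Longrightarrow> f i = g i) \<Longrightarrow> avg I f = avg I g"
  by (simp add: avg_def)

lemma avg_0 [simp]: "avg I (\<lambda>i. 0) = 0"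
  by (simp add: avg_def)

lemma avg_const: "finite I \<Longrightarrow> I \<noteq> {} \<Longrightarrow> avg I (\<lambda>i. c) = (c::real)"
  by (simp add: avg_def)

lemma avg_add: "avg I (\<lambda>i. f i + g i) = avg I f + avg I g"
  by (simp add: avg_def sum.distrib scaleR_right_distrib)

lemma avg_diff: "avg I (\<lambda>i. f i - g i) = avg I f - avg I g"
  by (simp add: avg_def sum_subtractf scaleR_diff_right)

lemma avg_minus: "avg I (\<lambda>i. - f i) = - avg I f"
  by (simp add: avg_def sum_negf)

lemma avg_mult_left: "avg I (\<lambda>i. c * f i) = c * avg I f" for c :: real
  by (simp add: avg_def sum_distrib_left[symmetric])

lemma avg_mult_right: "avg I (\<lambda>i. f i * c) = avg I f * c" for c :: real
  by (simp add: avg_def sum_distrib_right[symmetric])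

lemma avg_divide: "avg I (\<lambda>i. f i / c) = avg I f / c" for c :: real
  by (simp add: avg_def sum_divide_distrib[symmetric])

lemma avg_scaleR_left: "avg I (\<lambda>i. f i *\<^sub>R v) = avg I f *\<^sub>R v"
  by (simp add: avg_def scaleR_left.sum[symmetric])

lemma avg_scaleR_right: "avg I (\<lambda>i. c *\<^sub>R f i) = c *\<^sub>R avg I f"
  by (simp add: avg_def scaleR_right.sum[symmetric])

lemma avg_inner_left: "avg I (\<lambda>i. f i \<bullet> v) = avg I f \<bullet> v"
  by (simp add: avg_def inner_sum_left)

lemma avg_inner_right: "avg I (\<lambda>i. v \<bullet> f i) = v \<bullet> avg I f"
  by (simp add: avg_def inner_sum_right)

lemmas avg_linear = avg_add avg_diff avg_minus avg_mult_left avg_mult_right avg_divide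
  avg_scaleR_left avg_scaleR_right avg_inner_left avg_inner_right

lemma avg_swap: "avg I (\<lambda>i. avg J (\<lambda>j. f i j)) = avg J (\<lambda>j. avg I (\<lambda>i. f i j))"
  unfolding avg_def
  by (simp add: scaleR_right.sum[symmetric] sum.swap[of _ J I] mult.commute)

lemma avg_mono: "(\<And>i. i \<in> I \<Longrightarrow> f i \<le> (g i :: real)) \<Longrightarrow> avg I f \<le> avg I g"
  by (simp add: avg_def sum_mono divide_right_mono)

lemma avg_nonneg: "(\<And>i. i \<in> I \<Longrightarrow> 0 \<le> (f i :: real)) \<Longrightarrow> 0 \<le> avg I f"
  by (simp add: avg_def sum_nonneg)

lemma avg_le_const:
  "finite I \<Longrightarrow> I \<noteq> {} \<Longrightarrow> (\<And>i. i \<in> I \<Longrightarrow> f i \<le> (c :: real)) \<Longrightarrow> avg I f \<le> c"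
  using avg_mono[of I f "\<lambda>i. c"] by (simp add: avg_const)

lemma avg_sum: "avg I (\<lambda>i. \<Sum>b\<in>B. f i b) = (\<Sum>b\<in>B. avg I (\<lambda>i. f i b))"
  unfolding avg_def by (subst sum.swap) (simp add: scaleR_right.sum)

lemma abs_avg_le: "\<bar>avg I f\<bar> \<le> avg I (\<lambda>i. \<bar>f i :: real\<bar>)"
  by (simp add: avg_def abs_mult divide_right_mono)

lemma rms_nonneg [simp]: "0 \<le> rms I f"
  by (simp add: rms_def avg_nonneg)

lemma rms_power2: "(rms I f)\<^sup>2 = avg I (\<lambda>i. (norm (f i))\<^sup>2)"
  by (simp add: rms_def avg_nonneg)

lemma rms_cong: "(\<And>i. i \<in> I \<Longrightarrow> norm (f i) = norm (g i)) \<Longrightarrow> rms I f = rms I g"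
  unfolding rms_def by (metis (mono_tags, lifting) avg_cong)

lemma rms_L2_set: "rms I f = L2_set (\<lambda>i. norm (f i)) I / sqrt (real (card I))"
  by (simp add: rms_def avg_def L2_set_def real_sqrt_divide)

lemma rms_le_power2: "0 \<le> c \<Longrightarrow> (rms I f)\<^sup>2 \<le> c\<^sup>2 \<Longrightarrow> rms I f \<le> c"
  by (rule power2_le_imp_le)

lemma rms_mono: "(\<And>i. i \<in> I \<Longrightarrow> norm (f i) \<le> norm (g i)) \<Longrightarrow> rms I f \<le> rms I g"
  unfolding rms_def by (intro real_sqrt_le_mono avg_mono power_mono) auto

lemma rms_triangle: "rms I (\<lambda>i. f i + g i) \<le> rms I f + rms I g"
proof -
  have "L2_set (\<lambda>i. norm (f i + g i)) I \<le> L2_set (\<lambda>i. norm (f i) + norm (g i)) I"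
    by (intro L2_set_mono norm_triangle_ineq) auto
  also have "\<dots> \<le> L2_set (\<lambda>i. norm (f i)) I + L2_set (\<lambda>i. norm (g i)) I"
    by (rule L2_set_triangle_ineq)
  finally show ?thesis
    by (simp add: rms_L2_set add_divide_distrib[symmetric] divide_right_mono)
qed

lemma rms_minus: "rms I (\<lambda>i. - f i) = rms I f"
  by (simp add: rms_def)

lemma rms_triangle_diff: "rms I (\<lambda>i. f i - g i) \<le> rms I f + rms I g"
  using rms_triangle[of I f "\<lambda>i. - g i"] by (simp add: rms_minus)

lemma rms_triangle_diff2: "rms I f - rms I g \<le> rms I (\<lambda>i. f i - g i)"
  using rms_triangle[of I "\<lambda>i. f i - g i" g] by simp

lemma rms_mult_left: "rms I (\<lambda>i. c * f i) = \<bar>c\<bar> * rms I f" for c :: real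
  by (simp add: rms_def power_mult_distrib avg_mult_left real_sqrt_mult abs_mult)

lemma rms_mult_right: "rms I (\<lambda>i. f i * c) = rms I f * \<bar>c\<bar>" for c :: real
  using rms_mult_left[of I c f] by (simp add: mult.commute)

text \<open>Over finite nonempty index sets the iterated \<open>rms\<close> is the Hilbert-Schmidt
  norm divided by the square root of the number of entries, so the order of the indices is
  immaterial. Hilbert-Schmidt norms appear in this form throughout.\<close>

lemma rms_rms_swap: "rms I (\<lambda>i. rms J (\<lambda>j. f i j)) = rms J (\<lambda>j. rms I (\<lambda>i. f i j))"
proof -
  have "(rms I (\<lambda>i. rms J (\<lambda>j. f i j)))\<^sup>2 = (rms J (\<lambda>j. rms I (\<lambda>i. f i j)))\<^sup>2"
    unfolding rms_power2 by (simp add: rms_power2, rule avg_swap)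
  then show ?thesis by (simp add: power2_eq_iff_nonneg)
qed

text \<open>Cauchy-Schwarz. An empty or infinite \<open>I\<close> is treated apart: there division
  by zero makes both sides 0.\<close>

lemma avg_norm_mult_le: "avg I (\<lambda>i. norm (f i) * norm (g i)) \<le> rms I f * rms I g"
proof (cases "card I = 0")
  case True
  then show ?thesis by (simp add: avg_def rms_def)
next
  case False
  have "(\<Sum>i\<in>I. norm (f i) * norm (g i)) \<le> L2_set (\<lambda>i. norm (f i)) I * L2_set (\<lambda>i. norm (g i)) I"
    using L2_set_mult_ineq[of "\<lambda>i. norm (f i)" "\<lambda>i. norm (g i)" I] by simp
  moreover have "sqrt (real (card I)) * sqrt (real (card I)) = real (card I)" by simp
  ultimately show ?thesis
    using False by (simp add: avg_def rms_L2_set divide_right_mono)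
qed

lemma norm_avg_le: "norm (avg I f) \<le> avg I (\<lambda>i. norm (f i))"
  unfolding avg_def by (simp add: divide_right_mono norm_sum)

lemma norm_avg_scaleR_le: "norm (avg I (\<lambda>i. a i *\<^sub>R f i)) \<le> rms I a * rms I f"
  using norm_avg_le[of I "\<lambda>i. a i *\<^sub>R f i"] avg_norm_mult_le[of I a f] by simp

lemma abs_avg_mult_le: "\<bar>avg I (\<lambda>i. a i * b i)\<bar> \<le> rms I a * rms I b" for a :: "_ \<Rightarrow> real"
  using norm_avg_scaleR_le[of I a b] by simp

lemma abs_avg_inner_le: "\<bar>avg I (\<lambda>i. f i \<bullet> g i)\<bar> \<le> rms I f * rms I g"
proof -
  have "\<bar>avg I (\<lambda>i. f i \<bullet> g i)\<bar> \<le> avg I (\<lambda>i. \<bar>f i \<bullet> g i\<bar>)" by (rule abs_avg_le)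
  also have "\<dots> \<le> avg I (\<lambda>i. norm (f i) * norm (g i))"
    by (intro avg_mono Cauchy_Schwarz_ineq2)
  also have "\<dots> \<le> rms I f * rms I g" by (rule avg_norm_mult_le)
  finally show ?thesis .
qed

text \<open>The Hilbert-Schmidt norm dominates the operator norm: the left side is the matrix
  \<open>f\<close> acting on the vector \<open>a\<close>, and Cauchy-Schwarz in \<open>j\<close> is
  applied for each \<open>l\<close>.\<close>

lemma rms_avg_le:
  "rms L (\<lambda>l. avg J (\<lambda>j. a j *\<^sub>R f j l)) \<le> rms J a * rms J (\<lambda>j. rms L (\<lambda>l. f j l))"
proof -
  have "rms L (\<lambda>l. avg J (\<lambda>j. a j *\<^sub>R f j l)) \<le> rms L (\<lambda>l. rms J a * rms J (\<lambda>j. f j l))"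
    by (intro rms_mono) (simp add: norm_avg_scaleR_le)
  also have "\<dots> = rms J a * rms L (\<lambda>l. rms J (\<lambda>j. f j l))"
    by (simp add: rms_mult_left)
  finally show ?thesis by (simp add: rms_rms_swap[of L J])
qed

lemma rms_inner_le: "rms I (\<lambda>i. f i \<bullet> v) \<le> rms I f * norm v"
proof -
  have "rms I (\<lambda>i. f i \<bullet> v) \<le> rms I (\<lambda>i. norm (f i) * norm v)"
    by (intro rms_mono) (simp add: Cauchy_Schwarz_ineq2)
  then show ?thesis by (simp add: rms_mult_right rms_def)
qed

lemma rms_norm [simp]: "rms I (\<lambda>i. norm (f i)) = rms I f"
  by (simp add: rms_def)

text \<open>Cauchy-Schwarz for the Hilbert-Schmidt inner product of two matrices, first in
  \<open>j\<close> and then in \<open>i\<close>.\<close>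

lemma abs_avg_avg_mult_le:
  "\<bar>avg I (\<lambda>i. avg J (\<lambda>j. a i j * b i j))\<bar>
     \<le> rms I (\<lambda>i. rms J (a i)) * rms I (\<lambda>i. rms J (b i))" for a :: "_ \<Rightarrow> _ \<Rightarrow> real"
proof -
  have "\<bar>avg I (\<lambda>i. avg J (\<lambda>j. a i j * b i j))\<bar> \<le> avg I (\<lambda>i. rms J (a i) * rms J (b i))"
    using abs_avg_le[of I "\<lambda>i. avg J (\<lambda>j. a i j * b i j)"]
      avg_mono[of I "\<lambda>i. \<bar>avg J (\<lambda>j. a i j * b i j)\<bar>" "\<lambda>i. rms J (a i) * rms J (b i)"]
      abs_avg_mult_le by fastforce
  also have "\<dots> \<le> rms I (\<lambda>i. rms J (a i)) * rms I (\<lambda>i. rms J (b i))"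
    using abs_avg_mult_le[of I "\<lambda>i. rms J (a i)" "\<lambda>i. rms J (b i)"] by simp
  finally show ?thesis .
qed

section \<open>Second moments\<close>

lemma avg_measurable:
  fixes f :: "'i \<Rightarrow> 'w \<Rightarrow> 'b::euclidean_space"
  shows "(\<And>i. i \<in> I \<Longrightarrow> f i \<in> borel_measurable M) \<Longrightarrow> (\<lambda>\<omega>. avg I (\<lambda>i. f i \<omega>)) \<in> borel_measurable M"
  unfolding avg_def by (intro borel_measurable_scaleR borel_measurable_sum borel_measurable_const)

lemma rms_measurable:
  fixes f :: "'i \<Rightarrow> 'w \<Rightarrow> 'b::euclidean_space"
  shows "(\<And>i. i \<in> I \<Longrightarrow> f i \<in> borel_measurable M) \<Longrightarrow> (\<lambda>\<omega>. rms I (\<lambda>i. f i \<omega>)) \<in> borel_measurable M"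
  unfolding rms_def
  by (rule measurable_compose[OF _ borel_measurable_sqrt], rule avg_measurable) measurable

lemma nn_integral_avg_le:
  fixes f :: "'i \<Rightarrow> 'w \<Rightarrow> real"
  assumes "\<And>i. i \<in> I \<Longrightarrow> f i \<in> borel_measurable M" "\<And>i \<omega>. i \<in> I \<Longrightarrow> 0 \<le> f i \<omega>"
    and le: "\<And>i. i \<in> I \<Longrightarrow> (\<integral>\<^sup>+\<omega>. ennreal (f i \<omega>) \<partial>M) \<le> ennreal (b i)"
    and b: "\<And>i. i \<in> I \<Longrightarrow> 0 \<le> b i"
  shows "(\<integral>\<^sup>+\<omega>. ennreal (avg I (\<lambda>i. f i \<omega>)) \<partial>M) \<le> ennreal (avg I b)"
proof -
  have "(\<integral>\<^sup>+\<omega>. ennreal (avg I (\<lambda>i. f i \<omega>)) \<partial>M)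
      = (\<integral>\<^sup>+\<omega>. ennreal (1 / real (card I)) * (\<Sum>i\<in>I. ennreal (f i \<omega>)) \<partial>M)"
    using assms(2) by (simp add: avg_def ennreal_mult[symmetric] sum_nonneg sum_ennreal)
  also have "\<dots> = ennreal (1 / real (card I)) * (\<Sum>i\<in>I. \<integral>\<^sup>+\<omega>. ennreal (f i \<omega>) \<partial>M)"
    using assms(1) by (subst nn_integral_cmult) (auto simp: nn_integral_sum)
  also have "\<dots> \<le> ennreal (1 / real (card I)) * (\<Sum>i\<in>I. ennreal (b i))"
    by (intro mult_left_mono sum_mono le) auto
  also have "\<dots> = ennreal (avg I b)"
    using b by (simp add: avg_def ennreal_mult[symmetric] sum_nonneg sum_ennreal)
  finally show ?thesis .
qed

lemma nn_integral_rms_le: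
  fixes f :: "'i \<Rightarrow> 'w \<Rightarrow> 'b::euclidean_space"
  assumes "\<And>i. i \<in> I \<Longrightarrow> f i \<in> borel_measurable M"
    and "\<And>i. i \<in> I \<Longrightarrow> (\<integral>\<^sup>+\<omega>. ennreal ((norm (f i \<omega>))\<^sup>2) \<partial>M) \<le> ennreal (b i)"
    and "\<And>i. i \<in> I \<Longrightarrow> 0 \<le> b i"
  shows "(\<integral>\<^sup>+\<omega>. ennreal ((rms I (\<lambda>i. f i \<omega>))\<^sup>2) \<partial>M) \<le> ennreal (avg I b)"
  unfolding rms_power2 by (rule nn_integral_avg_le) (use assms in auto)

text \<open>Reduces the assumed moments of order 4 and 8 to second moments; the summand 1 covers
  small \<open>a\<close>.\<close>

lemma power2_le_1_plus: "2 \<le> m \<Longrightarrow> a\<^sup>2 \<le> 1 + a ^ m" if "0 \<le> a" for a :: real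
proof (cases "a \<le> 1")
  case True
  then have "a\<^sup>2 \<le> 1" using that by (simp add: power_le_one)
  then show ?thesis using that by (simp add: add_increasing2)
next
  case False
  assume "2 \<le> m"
  then have "a\<^sup>2 \<le> a ^ m" using False by (intro power_increasing) auto
  then show ?thesis by simp
qed

context prob_space
begin

lemma second_moment_le:
  fixes f :: "'a \<Rightarrow> 'b::euclidean_space"
  assumes "f \<in> borel_measurable M" and le: "(\<integral>\<^sup>+\<omega>. ennreal (norm (f \<omega>) ^ m) \<partial>M) \<le> ennreal D" and "2 \<le> m" "0 \<le> D"
  shows "(\<integral>\<^sup>+\<omega>. ennreal ((norm (f \<omega>))\<^sup>2) \<partial>M) \<le> ennreal (1 + D)"
proof -
  have "(\<integral>\<^sup>+\<omega>. ennreal ((norm (f \<omega>))\<^sup>2) \<partial>M) \<le> (\<integral>\<^sup>+\<omega>. 1 + ennreal (norm (f \<omega>) ^ m) \<partial>M)"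
    using power2_le_1_plus[OF norm_ge_zero] \<open>2 \<le> m\<close>
    by (intro nn_integral_mono) (simp add: ennreal_1[symmetric] ennreal_plus[symmetric] del: ennreal_1 ennreal_plus)
  also have "\<dots> = 1 + (\<integral>\<^sup>+\<omega>. ennreal (norm (f \<omega>) ^ m) \<partial>M)"
    using assms(1) by (subst nn_integral_add) (auto simp: emeasure_space_1)
  also have "\<dots> \<le> 1 + ennreal D" using le by (rule add_left_mono)
  finally show ?thesis using \<open>0 \<le> D\<close> by simp
qed

lemma square_integrableI:
  fixes f :: "'a \<Rightarrow> 'b::euclidean_space"
  assumes "f \<in> borel_measurable M" and le: "(\<integral>\<^sup>+\<omega>. ennreal ((norm (f \<omega>))\<^sup>2) \<partial>M) \<le> ennreal D" and "0 \<le> D"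
  shows "integrable M (\<lambda>\<omega>. (norm (f \<omega>))\<^sup>2)" and "(\<integral>\<omega>. (norm (f \<omega>))\<^sup>2 \<partial>M) \<le> D"
proof -
  have "(\<integral>\<^sup>+\<omega>. ennreal ((norm (f \<omega>))\<^sup>2) \<partial>M) < \<infinity>" using le by (simp add: le_less_trans)
  then show int: "integrable M (\<lambda>\<omega>. (norm (f \<omega>))\<^sup>2)"
    using assms(1) by (intro integrableI_nonneg) auto
  show "(\<integral>\<omega>. (norm (f \<omega>))\<^sup>2 \<partial>M) \<le> D"
    using le \<open>0 \<le> D\<close> nn_integral_eq_integral[OF int] by simp
qed

lemma square_integrable_inner:
  fixes f g :: "'a \<Rightarrow> 'b::euclidean_space"
  assumes meas: "f \<in> borel_measurable M" "g \<in> borel_measurable M"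
    and f: "(\<integral>\<^sup>+\<omega>. ennreal ((norm (f \<omega>))\<^sup>2) \<partial>M) \<le> ennreal D"
    and g: "(\<integral>\<^sup>+\<omega>. ennreal ((norm (g \<omega>))\<^sup>2) \<partial>M) \<le> ennreal D" and D: "0 \<le> D"
  shows "integrable M (\<lambda>\<omega>. f \<omega> \<bullet> g \<omega>)" and "\<bar>\<integral>\<omega>. f \<omega> \<bullet> g \<omega> \<partial>M\<bar> \<le> D"
proof -
  note If = square_integrableI[OF meas(1) f D] and Ig = square_integrableI[OF meas(2) g D]
  have int: "integrable M (\<lambda>\<omega>. ((norm (f \<omega>))\<^sup>2 + (norm (g \<omega>))\<^sup>2) / 2)" using If(1) Ig(1) by auto
  have le: "norm (f \<omega> \<bullet> g \<omega>) \<le> ((norm (f \<omega>))\<^sup>2 + (norm (g \<omega>))\<^sup>2) / 2" for \<omega>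
    using Cauchy_Schwarz_ineq2[of "f \<omega>" "g \<omega>"] sum_squares_bound[of "norm (f \<omega>)" "norm (g \<omega>)"] by simp
  show "integrable M (\<lambda>\<omega>. f \<omega> \<bullet> g \<omega>)"
    by (rule Bochner_Integration.integrable_bound[OF int]) (use meas le in auto)
  have "\<bar>\<integral>\<omega>. f \<omega> \<bullet> g \<omega> \<partial>M\<bar> \<le> (\<integral>\<omega>. ((norm (f \<omega>))\<^sup>2 + (norm (g \<omega>))\<^sup>2) / 2 \<partial>M)"
    using \<open>integrable M (\<lambda>\<omega>. f \<omega> \<bullet> g \<omega>)\<close> int le
    by (intro order_trans[OF integral_abs_bound] integral_mono) auto
  also have "\<dots> \<le> D" using If Ig by simp
  finally show "\<bar>\<integral>\<omega>. f \<omega> \<bullet> g \<omega> \<partial>M\<bar> \<le> D" .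
qed

text \<open>When the square is expanded, \<open>indep\<close> factors each cross term into
  \<open>E(v i * v j)\<close> times \<open>E(\<xi> i \<bullet> \<xi> j)\<close>, and the latter is
  at most \<open>D\<close> by Cauchy-Schwarz. What remains is weak dependence of the
  \<open>v i\<close> alone; the \<open>\<xi> i\<close> may depend on each other arbitrarily.\<close>

lemma second_moment_weighted_sum_le:
  fixes v :: "'i \<Rightarrow> 'a \<Rightarrow> real" and \<xi> :: "'i \<Rightarrow> 'a \<Rightarrow> 'b::euclidean_space"
  assumes v: "\<And>i. i \<in> A \<Longrightarrow> v i \<in> borel_measurable M" and \<xi>: "\<And>i. i \<in> A \<Longrightarrow> \<xi> i \<in> borel_measurable M"
    and \<xi>2: "\<And>i. i \<in> A \<Longrightarrow> (\<integral>\<^sup>+\<omega>. ennreal ((norm (\<xi> i \<omega>))\<^sup>2) \<partial>M) \<le> ennreal D" and D: "0 \<le> D"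
    and indep: "\<And>i j. i \<in> A \<Longrightarrow> j \<in> A \<Longrightarrow> integrable M (\<lambda>\<omega>. (v i \<omega> * v j \<omega>) * (\<xi> i \<omega> \<bullet> \<xi> j \<omega>)) \<and>
      (\<integral>\<omega>. (v i \<omega> * v j \<omega>) * (\<xi> i \<omega> \<bullet> \<xi> j \<omega>) \<partial>M) = (\<integral>\<omega>. v i \<omega> * v j \<omega> \<partial>M) * (\<integral>\<omega>. \<xi> i \<omega> \<bullet> \<xi> j \<omega> \<partial>M)"
  shows "(\<integral>\<^sup>+\<omega>. ennreal ((norm (\<Sum>i\<in>A. v i \<omega> *\<^sub>R \<xi> i \<omega>))\<^sup>2) \<partial>M)
    \<le> ennreal (D * (\<Sum>i\<in>A. \<Sum>j\<in>A. \<bar>\<integral>\<omega>. v i \<omega> * v j \<omega> \<partial>M\<bar>))"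
proof -
  have eq: "(norm (\<Sum>i\<in>A. v i \<omega> *\<^sub>R \<xi> i \<omega>))\<^sup>2 = (\<Sum>i\<in>A. \<Sum>j\<in>A. (v i \<omega> * v j \<omega>) * (\<xi> i \<omega> \<bullet> \<xi> j \<omega>))" for \<omega>
    by (simp add: power2_norm_eq_inner inner_sum_left inner_sum_right sum_distrib_left mult_ac inner_commute)
  have int: "integrable M (\<lambda>\<omega>. (norm (\<Sum>i\<in>A. v i \<omega> *\<^sub>R \<xi> i \<omega>))\<^sup>2)"
    unfolding eq using indep by (intro Bochner_Integration.integrable_sum) auto
  have "(\<integral>\<omega>. (norm (\<Sum>i\<in>A. v i \<omega> *\<^sub>R \<xi> i \<omega>))\<^sup>2 \<partial>M)
      = (\<Sum>i\<in>A. \<Sum>j\<in>A. (\<integral>\<omega>. v i \<omega> * v j \<omega> \<partial>M) * (\<integral>\<omega>. \<xi> i \<omega> \<bullet> \<xi> j \<omega> \<partial>M))"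
    unfolding eq using indep
    by (subst Bochner_Integration.integral_sum, force, intro sum.cong refl)
      (subst Bochner_Integration.integral_sum, auto)
  also have "\<dots> \<le> (\<Sum>i\<in>A. \<Sum>j\<in>A. \<bar>\<integral>\<omega>. v i \<omega> * v j \<omega> \<partial>M\<bar> * D)"
  proof (intro sum_mono)
    fix i j assume ij: "i \<in> A" "j \<in> A"
    have "\<bar>\<integral>\<omega>. \<xi> i \<omega> \<bullet> \<xi> j \<omega> \<partial>M\<bar> \<le> D"
      by (rule square_integrable_inner(2)) (use ij \<xi> \<xi>2 D in auto)
    then have "\<bar>(\<integral>\<omega>. v i \<omega> * v j \<omega> \<partial>M) * (\<integral>\<omega>. \<xi> i \<omega> \<bullet> \<xi> j \<omega> \<partial>M)\<bar> \<le> \<bar>\<integral>\<omega>. v i \<omega> * v j \<omega> \<partial>M\<bar> * D"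
      unfolding abs_mult by (intro mult_left_mono) auto
    then show "(\<integral>\<omega>. v i \<omega> * v j \<omega> \<partial>M) * (\<integral>\<omega>. \<xi> i \<omega> \<bullet> \<xi> j \<omega> \<partial>M) \<le> \<bar>\<integral>\<omega>. v i \<omega> * v j \<omega> \<partial>M\<bar> * D"
      by linarith
  qed
  also have "\<dots> = D * (\<Sum>i\<in>A. \<Sum>j\<in>A. \<bar>\<integral>\<omega>. v i \<omega> * v j \<omega> \<partial>M\<bar>)"
    by (simp add: sum_distrib_left mult.commute)
  finally show ?thesis
    using nn_integral_eq_integral[OF int] by (simp add: ennreal_leI)
qed

lemma indep_rv_integral_mult:
  fixes f :: "'b \<Rightarrow> real" and g :: "'c \<Rightarrow> real"
  assumes UV: "indep_rv M S U R V" and f: "f \<in> borel_measurable S" and g: "g \<in> borel_measurable R"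
    and int: "integrable M (\<lambda>\<omega>. f (U \<omega>))" "integrable M (\<lambda>\<omega>. g (V \<omega>))"
  shows "integrable M (\<lambda>\<omega>. f (U \<omega>) * g (V \<omega>))"
    and "(\<integral>\<omega>. f (U \<omega>) * g (V \<omega>) \<partial>M) = (\<integral>\<omega>. f (U \<omega>) \<partial>M) * (\<integral>\<omega>. g (V \<omega>) \<partial>M)"
proof -
  have U: "U \<in> measurable M S" and V: "V \<in> measurable M R"
    and ind: "indep_set {U -` A \<inter> space M |A. A \<in> sets S} {V -` B \<inter> space M |B. B \<in> sets R}"
    using UV by (auto simp: indep_rv_def)
  \<comment> \<open>The sigma-algebra generated by \<open>h\<close> composed with \<open>W\<close>
    lies in the pullback of \<open>Q\<close> along \<open>W\<close>, so independence of the two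
    large families passes to real functions of them.\<close>
  have sub: "sigma_sets (space M) {(\<lambda>\<omega>. h (W \<omega>)) -` A \<inter> space M |A. A \<in> sets borel}
      \<subseteq> {W -` A \<inter> space M |A. A \<in> sets Q}"
    if W: "W \<in> measurable M Q" and h: "h \<in> borel_measurable Q" for W :: "'a \<Rightarrow> 'd" and Q and h :: "'d \<Rightarrow> real"
  proof -
    have W': "W \<in> space M \<rightarrow> space Q" using W by (rule measurable_space[THEN funcsetI])
    have V: "{W -` A \<inter> space M |A. A \<in> sets Q} = sets (vimage_algebra (space M) W Q)"
      by (rule sets_vimage_algebra2[OF W', symmetric])
    have "sigma_sets (space (vimage_algebra (space M) W Q)) {(\<lambda>\<omega>. h (W \<omega>)) -` A \<inter> space M |A. A \<in> sets borel}
        \<subseteq> sets (vimage_algebra (space M) W Q)"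
    proof (rule sets.sigma_sets_subset, safe)
      fix A :: "real set" assume "A \<in> sets borel"
      then have "h -` A \<inter> space Q \<in> sets Q" using h by (rule measurable_sets[rotated])
      moreover have "(\<lambda>\<omega>. h (W \<omega>)) -` A \<inter> space M = W -` (h -` A \<inter> space Q) \<inter> space M"
        using W' by auto
      ultimately show "(\<lambda>\<omega>. h (W \<omega>)) -` A \<inter> space M \<in> sets (vimage_algebra (space M) W Q)"
        unfolding V[symmetric] by blast
    qed
    then show ?thesis by (simp add: V)
  qed
  have "indep_set (sigma_sets (space M) {(\<lambda>\<omega>. f (U \<omega>)) -` A \<inter> space M |A. A \<in> sets borel})
      (sigma_sets (space M) {(\<lambda>\<omega>. g (V \<omega>)) -` A \<inter> space M |A. A \<in> sets borel})"
    using sub[OF U f] sub[OF V g] indep_setD_ev1[OF ind] indep_setD_ev2[OF ind]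
    by (intro indep_setI indep_setD[OF ind]) auto
  moreover have "(\<lambda>\<omega>. f (U \<omega>)) \<in> borel_measurable M" "(\<lambda>\<omega>. g (V \<omega>)) \<in> borel_measurable M"
    using U V f g by auto
  ultimately have "indep_var borel (\<lambda>\<omega>. f (U \<omega>)) borel (\<lambda>\<omega>. g (V \<omega>))"
    by (simp add: indep_var_eq)
  then show "integrable M (\<lambda>\<omega>. f (U \<omega>) * g (V \<omega>))"
    and "(\<integral>\<omega>. f (U \<omega>) * g (V \<omega>) \<partial>M) = (\<integral>\<omega>. f (U \<omega>) \<partial>M) * (\<integral>\<omega>. g (V \<omega>) \<partial>M)"
    using int by (simp_all add: indep_var_integrable indep_var_lebesgue_integral)
qed

end

text \<open>A derivative test without derivatives: near 0 the linear term dominates. It is applied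
  at two maxima, to moving one coordinate and to rotating in a plane.\<close>

lemma quadratic_nonpos_imp_zero:
  fixes p q :: real
  assumes "\<And>s. p * s\<^sup>2 + 2 * q * s \<le> 0"
  shows "q = 0"
proof (rule ccontr)
  assume "q \<noteq> 0"
  \<comment> \<open>At \<open>s = q / D\<close> the expression equals
    \<open>(q / D)^2 * (p + 2 * D)\<close>, and \<open>2 * D\<close> exceeds
    \<open>\<bar>p\<bar>\<close>.\<close>
  define D where "D = 1 + \<bar>p\<bar>"
  have D: "0 < D" by (simp add: D_def)
  have "0 < p + 2 * D" by (simp add: D_def abs_if)
  then have "0 < (q / D)\<^sup>2 * (p + 2 * D)" using D \<open>q \<noteq> 0\<close> by simp
  also have "\<dots> = p * (q / D)\<^sup>2 + 2 * q * (q / D)"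
    using D by (simp add: field_simps power2_eq_square)
  finally show False using assms[of "q / D"] by simp
qed

text \<open>A quadratic form on the unit sphere attains its maximum at an eigenvector.\<close>

lemma quadratic_form_le_eigenvalue_bound:
  fixes a :: "nat \<Rightarrow> nat \<Rightarrow> real" and y :: "nat \<Rightarrow> real"
  assumes sym: "\<And>t s. a t s = a s t"
    and eigen: "\<And>e. eigenvalue (Matrix.mat n n (\<lambda>(t, s). a t s)) e \<Longrightarrow> e \<le> D"
  shows "(\<Sum>t<n. \<Sum>s<n. a t s * y t * y s) \<le> D * (\<Sum>t<n. (y t)\<^sup>2)"
proof (cases "\<forall>t<n. y t = 0")
  case True
  then show ?thesis by simp
next
  case False
  define q where "q = (\<lambda>x :: nat \<Rightarrow> real. \<Sum>t<n. \<Sum>s<n. a t s * x t * x s)"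
  define nn where "nn = (\<lambda>x :: nat \<Rightarrow> real. \<Sum>t<n. (x t)\<^sup>2)"
  \<comment> \<open>The dimension \<open>n\<close> is not a type, so vectors are functions on all of
    \<open>nat\<close>. Fixing the coordinates from \<open>n\<close> on at 0 puts the unit sphere
    into a product of compact sets, which is compact by Tychonoff.\<close>
  define S where "S = {x. nn x = 1} \<inter> (Pi\<^sub>E UNIV (\<lambda>i. if i < n then {-1..1} else {0 :: real}))"
  have cont_nn: "continuous_on A nn" for A
    unfolding nn_def by (intro continuous_intros continuous_on_subset[OF continuous_on_product_coordinates]) auto
  have cont_q: "continuous_on A q" for A
    unfolding q_def by (intro continuous_intros continuous_on_subset[OF continuous_on_product_coordinates]) auto
  have "compactin (product_topology (\<lambda>i. euclidean) UNIV) (Pi\<^sub>E UNIV (\<lambda>i. if i < n then {-1..1} else {0 :: real}))"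
    by (subst compactin_PiE) (auto simp: compactin_euclidean_iff)
  then have "compact (Pi\<^sub>E UNIV (\<lambda>i :: nat. if i < n then {-1..1} else {0 :: real}))"
    by (simp add: euclidean_product_topology compactin_euclidean_iff)
  moreover have "closed {x. nn x = 1}"
    by (intro closed_Collect_eq cont_nn continuous_on_const)
  ultimately have compact: "compact S" unfolding S_def by (intro closed_Int_compact)
  have nn_pos: "0 < nn x" if "t < n" "x t \<noteq> 0" for x t
    unfolding nn_def using that by (intro sum_pos2[of _ t]) auto
  have hom: "q (\<lambda>t. c * x t) = c\<^sup>2 * q x" "nn (\<lambda>t. c * x t) = c\<^sup>2 * nn x" for c x
    by (simp_all add: q_def nn_def sum_distrib_left power2_eq_square mult_ac)
  have normalize: "(\<lambda>t. if t < n then x t / sqrt (nn x) else 0) \<in> S" if "0 < nn x" for x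
  proof -
    have le: "- sqrt (nn x) \<le> x t \<and> x t \<le> sqrt (nn x)" if "t < n" for t
    proof -
      have "(x t)\<^sup>2 \<le> nn x" unfolding nn_def using that by (intro member_le_sum) auto
      then have "\<bar>x t\<bar> \<le> sqrt (nn x)" by (simp add: real_le_rsqrt)
      then show ?thesis by linarith
    qed
    have "nn (\<lambda>t. if t < n then x t / sqrt m else 0) = nn x / m" if "0 < m" for m
      using that by (simp add: nn_def power_divide sum_divide_distrib)
    from this[OF that] show ?thesis
      using that le unfolding S_def by (auto simp: divide_le_eq le_divide_eq)
  qed
  from False obtain t where t: "t < n" "y t \<noteq> 0" by blast
  then have "0 < nn y" by (rule nn_pos)
  then have "S \<noteq> {}" using normalize by blast
  then obtain z where z: "z \<in> S" and max: "\<And>x. x \<in> S \<Longrightarrow> q x \<le> q z"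
    using continuous_attains_sup[OF compact _ cont_q] by blast
  define e where "e = q z"
  have nz: "nn z = 1" using z by (simp add: S_def)
  have le_e: "q x \<le> e * nn x" for x
  proof (cases "\<forall>t<n. x t = 0")
    case True
    then show ?thesis by (simp add: q_def nn_def)
  next
    case False
    then have pos: "0 < nn x" using nn_pos by blast
    have "q (\<lambda>t. if t < n then x t / sqrt (nn x) else 0) = q (\<lambda>t. (1 / sqrt (nn x)) * x t)"
      by (simp add: q_def)
    also have "\<dots> = q x / nn x" using pos by (simp only: hom) (simp add: power_divide)
    finally show ?thesis using max[OF normalize[OF pos]] pos by (simp add: e_def divide_le_eq)
  qed
  have eig: "(\<Sum>s<n. a t s * z s) = e * z t" if t: "t < n" for t
  proof -
    define g where "g = (\<Sum>s<n. a t s * z s) - e * z t"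
    \<comment> \<open>Only coordinate \<open>t\<close> of the maximizer is moved, by
      \<open>h\<close>. Then \<open>q x \<le> e * nn x\<close> becomes a quadratic inequality in
      \<open>h\<close> without constant term, and its linear coefficient is the defect
      \<open>g\<close> in the eigenvector equation.\<close>
    have "(a t t - e) * h\<^sup>2 + 2 * g * h \<le> 0" for h
    proof -
      define x where "x = z(t := z t + h)"
      have x: "x s = z s + (if s = t then h else 0)" for s by (simp add: x_def)
      have d: "(\<Sum>s<n. f s * (if s = t then h else 0)) = f t * h" for f :: "nat \<Rightarrow> real"
        using t by (simp add: if_distrib[of "\<lambda>x. _ * x"] sum.delta cong: if_cong)
      have "q x = (\<Sum>t'<n. \<Sum>s<n. a t' s * z t' * z s) + (\<Sum>t'<n. \<Sum>s<n. (a t' s * z t') * (if s = t then h else 0))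
          + (\<Sum>t'<n. (\<Sum>s<n. a t' s * z s) * (if t' = t then h else 0))
          + (\<Sum>t'<n. (\<Sum>s<n. a t' s * (if s = t then h else 0)) * (if t' = t then h else 0))"
        unfolding q_def x by (simp add: algebra_simps sum.distrib sum_distrib_left sum_distrib_right)
      also have "\<dots> = q z + 2 * ((\<Sum>s<n. a t s * z s) * h) + a t t * h * h"
      proof -
        have "(\<Sum>t'<n. a t' t * z t' * h) = (\<Sum>s<n. a t s * z s) * h"
          unfolding sum_distrib_right by (intro sum.cong refl) (subst sym, rule refl)
        then show ?thesis unfolding d by (simp add: q_def)
      qed
      finally have qx: "q x = q z + 2 * ((\<Sum>s<n. a t s * z s) * h) + a t t * h * h" .
      have "nn x = (\<Sum>s<n. (z s)\<^sup>2) + (\<Sum>s<n. (2 * z s) * (if s = t then h else 0))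
          + (\<Sum>s<n. (if s = t then h else 0) * (if s = t then h else 0))"
        unfolding nn_def x by (simp add: power2_eq_square algebra_simps sum.distrib)
      also have "\<dots> = nn z + 2 * z t * h + h * h"
        unfolding d using t by (simp add: nn_def)
      finally have "nn x = 1 + 2 * z t * h + h * h" using nz by simp
      then have "q x \<le> e * (1 + 2 * z t * h + h * h)" using le_e[of x] by simp
      then show ?thesis using qx by (simp add: e_def[symmetric] g_def power2_eq_square algebra_simps)
    qed
    then have "g = 0" by (rule quadratic_nonpos_imp_zero)
    then show ?thesis by (simp add: g_def)
  qed
  define A where "A = Matrix.mat n n (\<lambda>(t, s). a t s)"
  have "eigenvector A (Matrix.vec n z) e"
    unfolding eigenvector_def
  proof (intro conjI)
    have "\<exists>t<n. z t \<noteq> 0" using nz by (auto simp: nn_def intro: ccontr)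
    then show "Matrix.vec n z \<noteq> 0\<^sub>v (dim_row A)" by (auto simp: A_def vec_eq_iff Matrix.vec_eq_iff)
    show "A *\<^sub>v Matrix.vec n z = e \<cdot>\<^sub>v Matrix.vec n z"
      by (rule eq_vecI) (auto simp: A_def Matrix.scalar_prod_def eig[symmetric] lessThan_atLeast0)
  qed (simp add: A_def)
  then have "e \<le> D" using eigen by (auto simp: A_def eigenvalue_def)
  moreover have "0 \<le> nn y" using \<open>0 < nn y\<close> by simp
  ultimately show ?thesis using le_e[of y] mult_right_mono[of e D "nn y"] by (simp add: q_def nn_def)
qed

section \<open>Moment bounds at one sample size\<close>

lemma avg_Times:
  assumes "finite A" "finite B"
  shows "avg A (\<lambda>i. avg B (\<lambda>j. f i j)) = avg (A \<times> B) (\<lambda>(i, j). f i j)"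
  using assms by (simp add: avg_def sum.cartesian_product card_cartesian_product scaleR_right.sum[symmetric])

lemma Max_Max_ge:
  fixes f :: "nat \<Rightarrow> nat \<Rightarrow> real"
  assumes "i \<in> A" "j \<in> B" "finite A" "finite B"
  shows "f i j \<le> (MAX i\<in>A. MAX j\<in>B. f i j)"
proof -
  have "f i j \<le> (MAX j\<in>B. f i j)" using assms by (intro Max_ge) auto
  also have "\<dots> \<le> (MAX i\<in>A. MAX j\<in>B. f i j)" using assms by (intro Max_ge) auto
  finally show ?thesis .
qed

text \<open>The probabilistic setting at a single sample size. The bounds derived here involve only
  \<open>D1\<close>, \<open>N\<close> and \<open>T\<close>, which makes them uniform along the
  sequence of samples.\<close>

locale ife_sample = prob_space M for M :: "'w measure" +
  fixes N T :: nat
    and F :: "nat \<Rightarrow> 'w \<Rightarrow> real ^ 'k" and \<Lambda> :: "nat \<Rightarrow> 'w \<Rightarrow> real ^ 'k"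
    and X :: "nat \<Rightarrow> nat \<Rightarrow> 'w \<Rightarrow> real ^ 'p" and u :: "nat \<Rightarrow> nat \<Rightarrow> 'w \<Rightarrow> real" and D1 :: real
  assumes N: "1 \<le> N" and T: "1 \<le> T" and D1_pos: "0 < D1"
    and rv_F: "\<And>t. t \<in> {1..T} \<Longrightarrow> F t \<in> borel_measurable M"
    and rv_\<Lambda>: "\<And>j. j \<in> {1..N} \<Longrightarrow> \<Lambda> j \<in> borel_measurable M"
    and rv_X: "\<And>j t. j \<in> {1..N} \<Longrightarrow> t \<in> {1..T} \<Longrightarrow> X j t \<in> borel_measurable M"
    and rv_u: "\<And>j t. j \<in> {1..N} \<Longrightarrow> t \<in> {1..T} \<Longrightarrow> u j t \<in> borel_measurable M"
    and moment_X: "\<And>i t. i \<in> {1..N} \<Longrightarrow> t \<in> {1..T} \<Longrightarrow>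
      (\<integral>\<^sup>+\<omega>. ennreal (norm (X i t \<omega>) ^ 4) \<partial>M) \<le> ennreal D1"
    and moment_F: "\<And>t. t \<in> {1..T} \<Longrightarrow> (\<integral>\<^sup>+\<omega>. ennreal (norm (F t \<omega>) ^ 4) \<partial>M) \<le> ennreal D1"
    and moment_\<Lambda>: "\<And>i. i \<in> {1..N} \<Longrightarrow> (\<integral>\<^sup>+\<omega>. ennreal (norm (\<Lambda> i \<omega>) ^ 4) \<partial>M) \<le> ennreal D1"
    and moment_u: "\<And>i t. i \<in> {1..N} \<Longrightarrow> t \<in> {1..T} \<Longrightarrow>
      (\<integral>\<^sup>+\<omega>. ennreal (\<bar>u i t \<omega>\<bar> ^ 8) \<partial>M) \<le> ennreal D1"
    and dep_units: "(1 / real N) * (\<Sum>i=1..N. \<Sum>j=1..N.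
      (MAX t\<in>{1..T}. MAX s\<in>{1..T}. \<bar>\<integral>\<omega>. u i t \<omega> * u j s \<omega> \<partial>M\<bar>)) \<le> D1"
    and dep_times: "(1 / real T) * (\<Sum>s=1..T. \<Sum>t=1..T.
      (MAX i\<in>{1..N}. MAX j\<in>{1..N}. \<bar>\<integral>\<omega>. u i t \<omega> * u j s \<omega> \<partial>M\<bar>)) \<le> D1"
    and dep_all: "(1 / (real N * real T)) * (\<Sum>i=1..N. \<Sum>j=1..N. \<Sum>s=1..T. \<Sum>t=1..T.
        \<bar>\<integral>\<omega>. u i t \<omega> * u j s \<omega> \<partial>M\<bar>) \<le> D1"
    and fourth_moment: "\<And>t s. t \<in> {1..T} \<Longrightarrow> s \<in> {1..T} \<Longrightarrow>
      (\<integral>\<^sup>+\<omega>. ennreal (\<bar>(1 / sqrt (real N)) * (\<Sum>i=1..N.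
          u i s \<omega> * u i t \<omega> - (\<integral>\<omega>'. u i s \<omega>' * u i t \<omega>' \<partial>M))\<bar> ^ 4) \<partial>M) \<le> ennreal D1"
    and largest_eigenvalue: "\<And>i e. i \<in> {1..N} \<Longrightarrow>
      eigenvalue (Matrix.mat T T (\<lambda>(t, s). \<integral>\<omega>. u i (Suc t) \<omega> * u i (Suc s) \<omega> \<partial>M)) e \<Longrightarrow> e \<le> D1"
    and indep: "indep_rv M
      (Pi\<^sub>M ({1..N} \<times> {1..T}) (\<lambda>_. borel)) (\<lambda>\<omega>. \<lambda>(j, t)\<in>{1..N} \<times> {1..T}. u j t \<omega>)
      (Pi\<^sub>M ({1..N} \<times> {1..T}) (\<lambda>_. borel) \<Otimes>\<^sub>M (Pi\<^sub>M {1..T} (\<lambda>_. borel) \<Otimes>\<^sub>M Pi\<^sub>M {1..N} (\<lambda>_. borel)))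
      (\<lambda>\<omega>. (\<lambda>(j, t)\<in>{1..N} \<times> {1..T}. X j t \<omega>, \<lambda>t\<in>{1..T}. F t \<omega>, \<lambda>j\<in>{1..N}. \<Lambda> j \<omega>))"
begin

text \<open>The bound that \<open>second_moment_le\<close> yields. Being at least 1, it satisfies
  \<open>D \<le> D\<^sup>2\<close>, so that later bounds can share the constant
  \<open>D\<^sup>2\<close>.\<close>

definition D :: real where "D = 1 + D1"

definition \<gamma> :: "nat \<Rightarrow> nat \<Rightarrow> nat \<Rightarrow> nat \<Rightarrow> real" where
  "\<gamma> i t j s = (\<integral>\<omega>. u i t \<omega> * u j s \<omega> \<partial>M)"

lemma D: "0 \<le> D" "1 \<le> D" "D1 \<le> D" "D \<le> D\<^sup>2" "D * D1 \<le> D\<^sup>2"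
  using D1_pos by (auto simp: D_def power2_eq_square algebra_simps)

lemma second_moment_X: "i \<in> {1..N} \<Longrightarrow> t \<in> {1..T} \<Longrightarrow> (\<integral>\<^sup>+\<omega>. ennreal ((norm (X i t \<omega>))\<^sup>2) \<partial>M) \<le> ennreal D"
  unfolding D_def using D1_pos by (intro second_moment_le[OF rv_X moment_X]) simp_all

lemma second_moment_F: "t \<in> {1..T} \<Longrightarrow> (\<integral>\<^sup>+\<omega>. ennreal ((norm (F t \<omega>))\<^sup>2) \<partial>M) \<le> ennreal D"
  unfolding D_def using D1_pos by (intro second_moment_le[OF rv_F moment_F]) simp_all

lemma second_moment_\<Lambda>: "i \<in> {1..N} \<Longrightarrow> (\<integral>\<^sup>+\<omega>. ennreal ((norm (\<Lambda> i \<omega>))\<^sup>2) \<partial>M) \<le> ennreal D"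
  unfolding D_def using D1_pos by (intro second_moment_le[OF rv_\<Lambda> moment_\<Lambda>]) simp_all

lemma second_moment_u: "i \<in> {1..N} \<Longrightarrow> t \<in> {1..T} \<Longrightarrow> (\<integral>\<^sup>+\<omega>. ennreal ((norm (u i t \<omega>))\<^sup>2) \<partial>M) \<le> ennreal D"
  unfolding D_def using D1_pos moment_u[of i t] by (intro second_moment_le[OF rv_u, where m = 8]) simp_all

lemma integrable_uu:
  assumes "i \<in> {1..N}" "t \<in> {1..T}" "j \<in> {1..N}" "s \<in> {1..T}"
  shows "integrable M (\<lambda>\<omega>. u i t \<omega> * u j s \<omega>)" and "\<bar>\<gamma> i t j s\<bar> \<le> D"
  using square_integrable_inner[OF rv_u rv_u second_moment_u second_moment_u D(1), OF assms(1,2,3,4,1,2,3,4)]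
  by (simp_all add: \<gamma>_def)

text \<open>\<open>h\<close> stands for an inner product of covariates, of factors or of loadings,
  written as a function \<open>g\<close> of the whole triple. These are the factors that accompany
  \<open>u i t * u j s\<close> when the square of a weighted sum is expanded.\<close>

lemma indep_factor:
  assumes "i \<in> {1..N}" "t \<in> {1..T}" "j \<in> {1..N}" "s \<in> {1..T}"
    and g: "g \<in> borel_measurable (Pi\<^sub>M ({1..N} \<times> {1..T}) (\<lambda>_. borel) \<Otimes>\<^sub>M
        (Pi\<^sub>M {1..T} (\<lambda>_. borel) \<Otimes>\<^sub>M Pi\<^sub>M {1..N} (\<lambda>_. borel)))"
    and eq: "\<And>\<omega>. h \<omega> = g (\<lambda>(j, t)\<in>{1..N} \<times> {1..T}. X j t \<omega>, \<lambda>t\<in>{1..T}. F t \<omega>, \<lambda>j\<in>{1..N}. \<Lambda> j \<omega>)"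
    and h: "integrable M h"
  shows "integrable M (\<lambda>\<omega>. (u i t \<omega> * u j s \<omega>) * h \<omega>) \<and>
    (\<integral>\<omega>. (u i t \<omega> * u j s \<omega>) * h \<omega> \<partial>M) = (\<integral>\<omega>. u i t \<omega> * u j s \<omega> \<partial>M) * (\<integral>\<omega>. h \<omega> \<partial>M)"
proof -
  have f: "(\<lambda>x :: nat \<times> nat \<Rightarrow> real. x (i, t) * x (j, s)) \<in> borel_measurable (Pi\<^sub>M ({1..N} \<times> {1..T}) (\<lambda>_. borel))"
    using assms(1-4) by (intro borel_measurable_times measurable_component_singleton) auto
  have u: "(\<lambda>(j, t)\<in>{1..N} \<times> {1..T}. u j t \<omega>) (i, t) * (\<lambda>(j, t)\<in>{1..N} \<times> {1..T}. u j t \<omega>) (j, s)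
      = u i t \<omega> * u j s \<omega>" for \<omega>
    using assms(1-4) by simp
  show ?thesis
    using indep_rv_integral_mult[OF indep f g, unfolded u eq[symmetric]] integrable_uu(1)[OF assms(1-4)] h by auto
qed

lemma indep_X:
  assumes "i \<in> {1..N}" "t \<in> {1..T}" "j \<in> {1..N}" "s \<in> {1..T}"
  shows "integrable M (\<lambda>\<omega>. (u i t \<omega> * u j s \<omega>) * (X i t \<omega> \<bullet> X j s \<omega>)) \<and>
    (\<integral>\<omega>. (u i t \<omega> * u j s \<omega>) * (X i t \<omega> \<bullet> X j s \<omega>) \<partial>M)
      = (\<integral>\<omega>. u i t \<omega> * u j s \<omega> \<partial>M) * (\<integral>\<omega>. X i t \<omega> \<bullet> X j s \<omega> \<partial>M)"
  by (rule indep_factor[OF assms, where g = "\<lambda>v. fst v (i, t) \<bullet> fst v (j, s)"])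
    (use assms square_integrable_inner(1)[OF rv_X rv_X second_moment_X second_moment_X D(1)] in
      \<open>auto intro!: borel_measurable_inner measurable_compose[OF measurable_fst measurable_component_singleton]\<close>)

lemma indep_F:
  assumes "i \<in> {1..N}" "t \<in> {1..T}" "s \<in> {1..T}"
  shows "integrable M (\<lambda>\<omega>. (u i t \<omega> * u i s \<omega>) * (F t \<omega> \<bullet> F s \<omega>)) \<and>
    (\<integral>\<omega>. (u i t \<omega> * u i s \<omega>) * (F t \<omega> \<bullet> F s \<omega>) \<partial>M)
      = (\<integral>\<omega>. u i t \<omega> * u i s \<omega> \<partial>M) * (\<integral>\<omega>. F t \<omega> \<bullet> F s \<omega> \<partial>M)"
  by (rule indep_factor[OF assms(1,2,1,3), where g = "\<lambda>v. fst (snd v) t \<bullet> fst (snd v) s"])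
    (use assms square_integrable_inner(1)[OF rv_F rv_F second_moment_F second_moment_F D(1)] in
      \<open>auto intro!: borel_measurable_inner measurable_compose[OF measurable_snd
        measurable_compose[OF measurable_fst measurable_component_singleton]]\<close>)

lemma indep_\<Lambda>:
  assumes "i \<in> {1..N}" "j \<in> {1..N}" "t \<in> {1..T}"
  shows "integrable M (\<lambda>\<omega>. (u i t \<omega> * u j t \<omega>) * (\<Lambda> i \<omega> \<bullet> \<Lambda> j \<omega>)) \<and>
    (\<integral>\<omega>. (u i t \<omega> * u j t \<omega>) * (\<Lambda> i \<omega> \<bullet> \<Lambda> j \<omega>) \<partial>M)
      = (\<integral>\<omega>. u i t \<omega> * u j t \<omega> \<partial>M) * (\<integral>\<omega>. \<Lambda> i \<omega> \<bullet> \<Lambda> j \<omega> \<partial>M)"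
  by (rule indep_factor[OF assms(1,3,2,3), where g = "\<lambda>v. snd (snd v) i \<bullet> snd (snd v) j"])
    (use assms square_integrable_inner(1)[OF rv_\<Lambda> rv_\<Lambda> second_moment_\<Lambda> second_moment_\<Lambda> D(1)] in
      \<open>auto intro!: borel_measurable_inner measurable_compose[OF measurable_snd
        measurable_compose[OF measurable_snd measurable_component_singleton]]\<close>)

lemma units_sum_le:
  assumes t: "t \<in> {1..T}"
  shows "(\<Sum>i\<in>{1..N}. \<Sum>j\<in>{1..N}. \<bar>\<gamma> i t j t\<bar>) \<le> real N * D1"
proof -
  have "(\<Sum>i\<in>{1..N}. \<Sum>j\<in>{1..N}. \<bar>\<gamma> i t j t\<bar>)
      \<le> (\<Sum>i=1..N. \<Sum>j=1..N. (MAX t\<in>{1..T}. MAX s\<in>{1..T}. \<bar>\<gamma> i t j s\<bar>))"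
    using t by (intro sum_mono Max_Max_ge) auto
  also have "\<dots> \<le> real N * D1" using dep_units N by (simp add: \<gamma>_def divide_le_eq mult.commute)
  finally show ?thesis .
qed

text \<open>The summand is left open so as to serve for one unit and for the average over units,
  both dominated by the maximum over pairs of units.\<close>

lemma times_sum_le:
  assumes "\<And>t s. t \<in> {1..T} \<Longrightarrow> s \<in> {1..T} \<Longrightarrow> f t s \<le> (MAX i\<in>{1..N}. MAX j\<in>{1..N}. \<bar>\<gamma> i t j s\<bar>)"
  shows "(\<Sum>t\<in>{1..T}. \<Sum>s\<in>{1..T}. f t s) \<le> real T * D1"
proof -
  have "(\<Sum>t\<in>{1..T}. \<Sum>s\<in>{1..T}. f t s)
      \<le> (\<Sum>t=1..T. \<Sum>s=1..T. (MAX i\<in>{1..N}. MAX j\<in>{1..N}. \<bar>\<gamma> i t j s\<bar>))"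
    using assms by (intro sum_mono) auto
  also have "\<dots> = (\<Sum>s=1..T. \<Sum>t=1..T. (MAX i\<in>{1..N}. MAX j\<in>{1..N}. \<bar>\<gamma> i t j s\<bar>))"
    by (rule sum.swap)
  also have "\<dots> \<le> real T * D1" using dep_times T by (simp add: \<gamma>_def divide_le_eq mult.commute)
  finally show ?thesis .
qed

text \<open>\<open>B\<close> stands for the sum of the absolute correlations, which is of order
  \<open>card A\<close>; dividing by the square of \<open>card A\<close> leaves one inverse power.
  This is the source of the rates 1/N, 1/T and 1/(NT) in the next three lemmas.\<close>

lemma nn_integral_avg_sum:
  fixes f :: "'i \<Rightarrow> 'w \<Rightarrow> 'b::euclidean_space"
  assumes le: "(\<integral>\<^sup>+\<omega>. ennreal ((norm (\<Sum>i\<in>A. f i \<omega>))\<^sup>2) \<partial>M) \<le> ennreal (D * B)" and A: "0 < real (card A)"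
    and meas: "\<And>i. i \<in> A \<Longrightarrow> f i \<in> borel_measurable M" and B: "B \<le> real (card A) * D1"
  shows "(\<integral>\<^sup>+\<omega>. ennreal ((norm (avg A (\<lambda>i. f i \<omega>)))\<^sup>2) \<partial>M) \<le> ennreal (D\<^sup>2 / real (card A))"
proof -
  have "(\<integral>\<^sup>+\<omega>. ennreal ((norm (avg A (\<lambda>i. f i \<omega>)))\<^sup>2) \<partial>M)
      = (\<integral>\<^sup>+\<omega>. ennreal ((1 / real (card A))\<^sup>2) * ennreal ((norm (\<Sum>i\<in>A. f i \<omega>))\<^sup>2) \<partial>M)"
    by (simp add: avg_def power_divide ennreal_mult[symmetric])
  also have "\<dots> = ennreal ((1 / real (card A))\<^sup>2) * (\<integral>\<^sup>+\<omega>. ennreal ((norm (\<Sum>i\<in>A. f i \<omega>))\<^sup>2) \<partial>M)"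
    using meas by (intro nn_integral_cmult) measurable
  also have "\<dots> \<le> ennreal ((1 / real (card A))\<^sup>2) * ennreal (D * B)" by (intro mult_left_mono le) simp
  also have "\<dots> = ennreal ((1 / real (card A))\<^sup>2 * (D * B))" by (rule ennreal_mult'[symmetric]) simp
  also have "\<dots> \<le> ennreal (D\<^sup>2 / real (card A))"
  proof (rule ennreal_leI)
    have "D * B \<le> D * (real (card A) * D1)" using B D(1) by (intro mult_left_mono) auto
    also have "\<dots> \<le> real (card A) * D\<^sup>2" using mult_left_mono[OF D(5), of "real (card A)"] by (simp add: mult_ac)
    finally have "(1 / real (card A))\<^sup>2 * (D * B) \<le> (1 / real (card A))\<^sup>2 * (real (card A) * D\<^sup>2)"
      by (intro mult_left_mono) auto
    then show "(1 / real (card A))\<^sup>2 * (D * B) \<le> D\<^sup>2 / real (card A)"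
      using A by (simp add: power2_eq_square field_simps)
  qed
  finally show ?thesis .
qed

lemma second_moment_u\<Lambda>:
  assumes t: "t \<in> {1..T}"
  shows "(\<integral>\<^sup>+\<omega>. ennreal ((norm (avg {1..N} (\<lambda>j. u j t \<omega> *\<^sub>R \<Lambda> j \<omega>)))\<^sup>2) \<partial>M) \<le> ennreal (D\<^sup>2 / N)"
proof -
  have "(\<integral>\<^sup>+\<omega>. ennreal ((norm (avg {1..N} (\<lambda>j. u j t \<omega> *\<^sub>R \<Lambda> j \<omega>)))\<^sup>2) \<partial>M)
      \<le> ennreal (D\<^sup>2 / real (card {1..N}))"
  proof (rule nn_integral_avg_sum[OF second_moment_weighted_sum_le])
    show "(\<Sum>i\<in>{1..N}. \<Sum>j\<in>{1..N}. \<bar>\<integral>\<omega>. u i t \<omega> * u j t \<omega> \<partial>M\<bar>) \<le> real (card {1..N}) * D1"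
      using units_sum_le[OF t] by (simp add: \<gamma>_def)
  qed (use t N rv_u rv_\<Lambda> second_moment_\<Lambda> D indep_\<Lambda> in auto)
  then show ?thesis by simp
qed

lemma second_moment_uF:
  assumes j: "j \<in> {1..N}"
  shows "(\<integral>\<^sup>+\<omega>. ennreal ((norm (avg {1..T} (\<lambda>t. u j t \<omega> *\<^sub>R F t \<omega>)))\<^sup>2) \<partial>M) \<le> ennreal (D\<^sup>2 / T)"
proof -
  have "(\<integral>\<^sup>+\<omega>. ennreal ((norm (avg {1..T} (\<lambda>t. u j t \<omega> *\<^sub>R F t \<omega>)))\<^sup>2) \<partial>M)
      \<le> ennreal (D\<^sup>2 / real (card {1..T}))"
  proof (rule nn_integral_avg_sum[OF second_moment_weighted_sum_le])
    have "(\<Sum>t\<in>{1..T}. \<Sum>s\<in>{1..T}. \<bar>\<gamma> j t j s\<bar>) \<le> real T * D1"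
      using j by (intro times_sum_le Max_Max_ge) auto
    then show "(\<Sum>t\<in>{1..T}. \<Sum>s\<in>{1..T}. \<bar>\<integral>\<omega>. u j t \<omega> * u j s \<omega> \<partial>M\<bar>) \<le> real (card {1..T}) * D1"
      by (simp add: \<gamma>_def)
  qed (use j T rv_u rv_F second_moment_F D indep_F in auto)
  then show ?thesis by simp
qed

text \<open>A pair of unit and period is treated as one index, so that the double average is a
  single one over \<open>N * T\<close> terms and the correlations add up to the fourfold sum in
  \<open>dep_all\<close>.\<close>

lemma second_moment_uX:
  "(\<integral>\<^sup>+\<omega>. ennreal ((norm (avg {1..N} (\<lambda>j. avg {1..T} (\<lambda>t. u j t \<omega> *\<^sub>R X j t \<omega>))))\<^sup>2) \<partial>M)
     \<le> ennreal (D\<^sup>2 / (N * T))"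
proof -
  have "(\<integral>\<^sup>+\<omega>. ennreal ((norm (avg ({1..N} \<times> {1..T}) (\<lambda>i. u (fst i) (snd i) \<omega> *\<^sub>R X (fst i) (snd i) \<omega>)))\<^sup>2) \<partial>M)
      \<le> ennreal (D\<^sup>2 / real (card ({1..N} \<times> {1..T})))"
  proof (rule nn_integral_avg_sum[OF second_moment_weighted_sum_le])
    have "(\<Sum>i\<in>{1..N} \<times> {1..T}. \<Sum>j\<in>{1..N} \<times> {1..T}. \<bar>\<gamma> (fst i) (snd i) (fst j) (snd j)\<bar>)
        = (\<Sum>i=1..N. \<Sum>t=1..T. \<Sum>j=1..N. \<Sum>s=1..T. \<bar>\<gamma> i t j s\<bar>)"
      by (simp add: sum.cartesian_product')
    also have "\<dots> = (\<Sum>i=1..N. \<Sum>j=1..N. \<Sum>t=1..T. \<Sum>s=1..T. \<bar>\<gamma> i t j s\<bar>)"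
      by (rule sum.cong[OF refl], rule sum.swap)
    also have "\<dots> = (\<Sum>i=1..N. \<Sum>j=1..N. \<Sum>s=1..T. \<Sum>t=1..T. \<bar>\<gamma> i t j s\<bar>)"
      by (rule sum.cong[OF refl], rule sum.cong[OF refl], rule sum.swap)
    also have "\<dots> \<le> real (card ({1..N} \<times> {1..T})) * D1"
      using dep_all N T by (simp add: \<gamma>_def divide_le_eq mult.commute)
    finally show "(\<Sum>i\<in>{1..N} \<times> {1..T}. \<Sum>j\<in>{1..N} \<times> {1..T}.
        \<bar>\<integral>\<omega>. u (fst i) (snd i) \<omega> * u (fst j) (snd j) \<omega> \<partial>M\<bar>) \<le> real (card ({1..N} \<times> {1..T})) * D1"
      by (simp add: \<gamma>_def)
  qed (use N T rv_u rv_X second_moment_X D indep_X in auto)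
  then show ?thesis by (simp add: avg_Times case_prod_unfold)
qed

text \<open>Entry \<open>(t, s)\<close> of \<open>E(UU')/N\<close>, the mean around which the Gram
  matrix of the errors fluctuates.\<close>

definition \<gamma>avg :: "nat \<Rightarrow> nat \<Rightarrow> real" where "\<gamma>avg t s = avg {1..N} (\<lambda>j. \<gamma> j t j s)"

lemma \<gamma>avg_le: "t \<in> {1..T} \<Longrightarrow> s \<in> {1..T} \<Longrightarrow> \<bar>\<gamma>avg t s\<bar> \<le> D"
  unfolding \<gamma>avg_def using N
  by (intro order_trans[OF abs_avg_le] avg_le_const) (auto intro: integrable_uu(2))

text \<open>A fluctuation of order N^(-1/2), by the fourth moment condition, plus a deterministic
  mean. The mean need not be small entry by entry; its mean square over the matrix or over one row
  is.\<close>

lemma second_moment_gram: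
  assumes t: "t \<in> {1..T}" and s: "s \<in> {1..T}"
  shows "(\<integral>\<^sup>+\<omega>. ennreal ((norm (avg {1..N} (\<lambda>j. u j t \<omega> * u j s \<omega>)))\<^sup>2) \<partial>M)
    \<le> ennreal (2 * D / N + 2 * (\<gamma>avg t s)\<^sup>2)"
proof -
  define a where "a = (\<lambda>\<omega>. (1 / sqrt (real N)) * (\<Sum>i=1..N. u i t \<omega> * u i s \<omega> - \<gamma> i t i s))"
  have [measurable]: "a \<in> borel_measurable M"
    unfolding a_def using t s rv_u by (intro borel_measurable_times borel_measurable_sum borel_measurable_diff) auto
  have a2: "(\<integral>\<^sup>+\<omega>. ennreal ((norm (a \<omega>))\<^sup>2) \<partial>M) \<le> ennreal D"
  proof -
    have "(\<integral>\<^sup>+\<omega>. ennreal (norm (a \<omega>) ^ 4) \<partial>M) \<le> ennreal D1"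
      using fourth_moment[OF s t] by (simp add: a_def \<gamma>_def)
    then show ?thesis
      unfolding D_def using D1_pos by (intro second_moment_le[where m = 4]) simp_all
  qed
  have eq: "avg {1..N} (\<lambda>j. u j t \<omega> * u j s \<omega>) = a \<omega> / sqrt N + \<gamma>avg t s" for \<omega>
    using N by (simp add: a_def avg_def \<gamma>avg_def sum_subtractf field_simps)
  have le: "(norm (avg {1..N} (\<lambda>j. u j t \<omega> * u j s \<omega>)))\<^sup>2 \<le> 2 / N * (norm (a \<omega>))\<^sup>2 + 2 * (\<gamma>avg t s)\<^sup>2" for \<omega>
    using sum_squares_bound[of "a \<omega> / sqrt N" "\<gamma>avg t s"] unfolding eq
    by (simp add: power2_sum power_divide)
  have "(\<integral>\<^sup>+\<omega>. ennreal ((norm (avg {1..N} (\<lambda>j. u j t \<omega> * u j s \<omega>)))\<^sup>2) \<partial>M)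
      \<le> (\<integral>\<^sup>+\<omega>. ennreal (2 / N) * ennreal ((norm (a \<omega>))\<^sup>2) + ennreal (2 * (\<gamma>avg t s)\<^sup>2) \<partial>M)"
    using le by (intro nn_integral_mono) (simp add: ennreal_mult[symmetric] ennreal_plus[symmetric] ennreal_leI del: ennreal_plus)
  also have "\<dots> = ennreal (2 / N) * (\<integral>\<^sup>+\<omega>. ennreal ((norm (a \<omega>))\<^sup>2) \<partial>M) + ennreal (2 * (\<gamma>avg t s)\<^sup>2)"
    by (subst nn_integral_add) (auto simp: nn_integral_cmult emeasure_space_1)
  also have "\<dots> \<le> ennreal (2 / N) * ennreal D + ennreal (2 * (\<gamma>avg t s)\<^sup>2)"
    by (intro add_right_mono mult_left_mono a2) simp
  also have "\<dots> = ennreal (2 * D / N + 2 * (\<gamma>avg t s)\<^sup>2)"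
    using D(1) by (simp add: ennreal_mult[symmetric] ennreal_plus[symmetric] del: ennreal_plus)
  finally show ?thesis .
qed

text \<open>One factor of each square is bounded by \<open>D\<close>; the absolute values of the
  other sum to order T over all pairs of periods by \<open>dep_times\<close>. Dividing by T^2 leaves
  1/T.\<close>

lemma avg_\<gamma>avg_le: "avg {1..T} (\<lambda>t. avg {1..T} (\<lambda>s. (\<gamma>avg t s)\<^sup>2)) \<le> D\<^sup>2 / T"
proof -
  have abs: "\<bar>\<gamma>avg t s\<bar> \<le> (MAX i\<in>{1..N}. MAX j\<in>{1..N}. \<bar>\<gamma> i t j s\<bar>)" for t s
    unfolding \<gamma>avg_def using N
    by (intro order_trans[OF abs_avg_le] avg_le_const Max_Max_ge) auto
  have "(\<Sum>t\<in>{1..T}. \<Sum>s\<in>{1..T}. (\<gamma>avg t s)\<^sup>2) \<le> (\<Sum>t\<in>{1..T}. \<Sum>s\<in>{1..T}. D * \<bar>\<gamma>avg t s\<bar>)"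
  proof (intro sum_mono)
    fix t s assume "t \<in> {1..T}" "s \<in> {1..T}"
    then have "\<bar>\<gamma>avg t s\<bar> * \<bar>\<gamma>avg t s\<bar> \<le> D * \<bar>\<gamma>avg t s\<bar>" by (intro mult_right_mono \<gamma>avg_le) auto
    then show "(\<gamma>avg t s)\<^sup>2 \<le> D * \<bar>\<gamma>avg t s\<bar>" by (simp add: power2_eq_square)
  qed
  also have "\<dots> = D * (\<Sum>t\<in>{1..T}. \<Sum>s\<in>{1..T}. \<bar>\<gamma>avg t s\<bar>)" by (simp add: sum_distrib_left)
  also have "\<dots> \<le> D * (real T * D1)" using D(1) abs by (intro mult_left_mono times_sum_le) auto
  also have "\<dots> \<le> real T * D\<^sup>2"
    using mult_left_mono[OF D(5), of "real T"] by (simp add: mult_ac)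
  finally have "(\<Sum>t\<in>{1..T}. \<Sum>s\<in>{1..T}. (\<gamma>avg t s)\<^sup>2) / (real T * real T) \<le> (real T * D\<^sup>2) / (real T * real T)"
    by (intro divide_right_mono) auto
  then show ?thesis using T by (simp add: avg_def sum_divide_distrib[symmetric])
qed

text \<open>If \<open>A\<close> is the covariance matrix of one unit and \<open>y\<close> its row \<open>\<tau>\<close>, then \<open>E(D\<^sub>1u\<^sub>\<tau> - y'u)\<^sup>2 \<ge> 0\<close> together with
  \<open>y'Ay \<le> D\<^sub>1|y|\<^sup>2\<close> gives \<open>|y|\<^sup>2 \<le> D\<^sub>1A\<^sub>\<tau>\<^sub>\<tau>\<close>.\<close>

lemma covariance_row_le:
  assumes j: "j \<in> {1..N}" and \<tau>: "\<tau> \<in> {1..T}"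
  shows "(\<Sum>s=1..T. (\<gamma> j \<tau> j s)\<^sup>2) \<le> D1 * D"
proof -
  define y where "y = (\<lambda>s. \<gamma> j \<tau> j s)"
  define S where "S = (\<Sum>s=1..T. (y s)\<^sup>2)"
  define W where "W = (\<lambda>\<omega>. \<Sum>s=1..T. y s * u j s \<omega>)"
  have W2: "(W \<omega>)\<^sup>2 = (\<Sum>t=1..T. \<Sum>s=1..T. (y t * y s) * (u j t \<omega> * u j s \<omega>))" for \<omega>
    by (simp add: W_def power2_eq_square sum_product mult_ac)
  have Wu: "u j \<tau> \<omega> * W \<omega> = (\<Sum>s=1..T. y s * (u j \<tau> \<omega> * u j s \<omega>))" for \<omega>
    by (simp add: W_def sum_distrib_left mult_ac)
  have int: "integrable M (\<lambda>\<omega>. u j t \<omega> * u j s \<omega>)" if "t \<in> {1..T}" "s \<in> {1..T}" for t s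
    using integrable_uu(1) j that by auto
  have intW2: "integrable M (\<lambda>\<omega>. (W \<omega>)\<^sup>2)"
    unfolding W2 using int by (intro Bochner_Integration.integrable_sum integrable_mult_right) auto
  have intWu: "integrable M (\<lambda>\<omega>. u j \<tau> \<omega> * W \<omega>)"
    unfolding Wu using int \<tau> by (intro Bochner_Integration.integrable_sum integrable_mult_right) auto
  have intu2: "integrable M (\<lambda>\<omega>. (u j \<tau> \<omega>)\<^sup>2)" using int[OF \<tau> \<tau>] by (simp add: power2_eq_square)
  have EWu: "(\<integral>\<omega>. u j \<tau> \<omega> * W \<omega> \<partial>M) = S"
    unfolding Wu using int \<tau>
    by (subst Bochner_Integration.integral_sum) (auto simp: S_def y_def \<gamma>_def power2_eq_square)
  have EW2: "(\<integral>\<omega>. (W \<omega>)\<^sup>2 \<partial>M) = (\<Sum>t=1..T. \<Sum>s=1..T. \<gamma> j t j s * y t * y s)"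
  proof -
    have "(\<integral>\<omega>. (W \<omega>)\<^sup>2 \<partial>M) = (\<Sum>t=1..T. \<integral>\<omega>. (\<Sum>s=1..T. (y t * y s) * (u j t \<omega> * u j s \<omega>)) \<partial>M)"
      unfolding W2 using int
      by (intro Bochner_Integration.integral_sum Bochner_Integration.integrable_sum integrable_mult_right) auto
    also have "\<dots> = (\<Sum>t=1..T. \<Sum>s=1..T. \<integral>\<omega>. (y t * y s) * (u j t \<omega> * u j s \<omega>) \<partial>M)"
      using int by (intro sum.cong refl Bochner_Integration.integral_sum integrable_mult_right) auto
    finally show ?thesis by (simp add: \<gamma>_def mult_ac)
  qed
  \<comment> \<open>The matrix in the eigenvalue condition is indexed from 0, the periods from
    1.\<close>
  have "(\<Sum>t=1..T. \<Sum>s=1..T. \<gamma> j t j s * y t * y s)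
      = (\<Sum>t<T. \<Sum>s<T. \<gamma> j (Suc t) j (Suc s) * y (Suc t) * y (Suc s))"
    by (simp add: sum.atLeast1_atMost_eq)
  also have "\<dots> \<le> D1 * (\<Sum>t<T. (y (Suc t))\<^sup>2)"
  proof (rule quadratic_form_le_eigenvalue_bound)
    show "\<gamma> j (Suc t) j (Suc s) = \<gamma> j (Suc s) j (Suc t)" for t s by (simp add: \<gamma>_def mult.commute)
    show "e \<le> D1" if "eigenvalue (Matrix.mat T T (\<lambda>(t, s). \<gamma> j (Suc t) j (Suc s))) e" for e
      using largest_eigenvalue[OF j] that by (simp add: \<gamma>_def)
  qed
  also have "\<dots> = D1 * S" by (simp add: S_def sum.atLeast1_atMost_eq)
  finally have EW2_le: "(\<integral>\<omega>. (W \<omega>)\<^sup>2 \<partial>M) \<le> D1 * S" by (simp add: EW2)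
  have "0 \<le> (\<integral>\<omega>. (D1 * u j \<tau> \<omega> - W \<omega>)\<^sup>2 \<partial>M)" by (rule integral_nonneg_AE) simp
  also have "\<dots> = (\<integral>\<omega>. D1\<^sup>2 * (u j \<tau> \<omega>)\<^sup>2 - 2 * D1 * (u j \<tau> \<omega> * W \<omega>) + (W \<omega>)\<^sup>2 \<partial>M)"
    by (simp add: power2_eq_square algebra_simps)
  also have "\<dots> = D1\<^sup>2 * \<gamma> j \<tau> j \<tau> - 2 * D1 * S + (\<integral>\<omega>. (W \<omega>)\<^sup>2 \<partial>M)"
    using intW2 intWu intu2 by (simp add: EWu) (simp add: \<gamma>_def power2_eq_square)
  finally have "D1 * S \<le> D1 * (D1 * \<gamma> j \<tau> j \<tau>)" using EW2_le by (simp add: power2_eq_square)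
  then have "S \<le> D1 * \<gamma> j \<tau> j \<tau>" using D1_pos by simp
  also have "\<dots> \<le> D1 * D" using integrable_uu(2)[OF j \<tau> j \<tau>] D1_pos by (intro mult_left_mono) auto
  finally show ?thesis by (simp add: S_def y_def)
qed

text \<open>\<open>dep_times\<close> controls all rows together, so a given row could carry more
  than its share. Hence the row bound of each single unit is used, and Jensen's inequality passes to
  the average over units.\<close>

lemma avg_\<gamma>avg_at_le:
  assumes \<tau>: "\<tau> \<in> {1..T}"
  shows "avg {1..T} (\<lambda>s. (\<gamma>avg \<tau> s)\<^sup>2) \<le> D\<^sup>2 / T"
proof -
  have jensen: "(\<gamma>avg \<tau> s)\<^sup>2 \<le> avg {1..N} (\<lambda>j. (\<gamma> j \<tau> j s)\<^sup>2)" for s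
  proof -
    have "(rms {1..N} (\<lambda>j. 1 :: real)) = 1" using N by (simp add: rms_def avg_const)
    then have "\<bar>\<gamma>avg \<tau> s\<bar> \<le> rms {1..N} (\<lambda>j. \<gamma> j \<tau> j s)"
      using abs_avg_mult_le[of "{1..N}" "\<lambda>j. 1" "\<lambda>j. \<gamma> j \<tau> j s"] by (simp add: \<gamma>avg_def)
    then have "\<bar>\<gamma>avg \<tau> s\<bar>\<^sup>2 \<le> (rms {1..N} (\<lambda>j. \<gamma> j \<tau> j s))\<^sup>2" by (intro power_mono) auto
    then show ?thesis by (simp add: rms_power2)
  qed
  have "avg {1..T} (\<lambda>s. (\<gamma>avg \<tau> s)\<^sup>2) \<le> avg {1..T} (\<lambda>s. avg {1..N} (\<lambda>j. (\<gamma> j \<tau> j s)\<^sup>2))"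
    by (intro avg_mono jensen)
  also have "\<dots> = avg {1..N} (\<lambda>j. avg {1..T} (\<lambda>s. (\<gamma> j \<tau> j s)\<^sup>2))" by (rule avg_swap)
  also have "\<dots> \<le> D\<^sup>2 / T"
  proof (rule avg_le_const)
    fix j assume "j \<in> {1..N}"
    then have "(\<Sum>s=1..T. (\<gamma> j \<tau> j s)\<^sup>2) \<le> D\<^sup>2"
      using covariance_row_le[OF _ \<tau>, of j] D(5) by (simp add: mult.commute)
    then show "avg {1..T} (\<lambda>s. (\<gamma> j \<tau> j s)\<^sup>2) \<le> D\<^sup>2 / T" by (simp add: avg_def divide_right_mono)
  qed (use N in auto)
  finally show ?thesis .
qed

end

section \<open>Projections onto factors\<close>

text \<open>With inner products scaled by \<open>1/T\<close>, \<open>orthonormal\<close> is the constraint \<open>G'G/T = I\<close>, \<open>coef\<close> is \<open>G'x/T\<close>,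
  \<open>kernel_dist\<close> is the Hilbert-Schmidt norm of \<open>P\<^sub>H - P\<^sub>G\<close>, and \<open>residual\<close> has the rows of \<open>M\<^sub>HG\<close>.\<close>

definition orthonormal :: "'i set \<Rightarrow> ('i \<Rightarrow> 'b::euclidean_space) \<Rightarrow> bool" where
  "orthonormal I G \<longleftrightarrow> (\<forall>v. avg I (\<lambda>t. (G t \<bullet> v) *\<^sub>R G t) = v)"

definition coef :: "'i set \<Rightarrow> ('i \<Rightarrow> 'b::euclidean_space) \<Rightarrow> ('i \<Rightarrow> real) \<Rightarrow> 'b" where
  "coef I G x = avg I (\<lambda>t. x t *\<^sub>R G t)"

lemma coef_add: "coef I G (\<lambda>t. x t + y t) = coef I G x + coef I G y"
  and coef_diff: "coef I G (\<lambda>t. x t - y t) = coef I G x - coef I G y"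
  by (simp_all add: coef_def algebra_simps avg_linear)

lemma coef_inner: "coef I G x \<bullet> v = avg I (\<lambda>t. x t * (G t \<bullet> v))"
  by (simp add: coef_def avg_inner_left[symmetric])

text \<open>Up to scaling the left side is \<open>x'P_G y\<close>. Written with the kernel
  \<open>G t \<bullet> G s\<close>, a difference of two projections can be paired with other
  matrices by Cauchy-Schwarz.\<close>

lemma coef_inner_coef:
  "coef I G x \<bullet> coef I G y = avg I (\<lambda>t. avg I (\<lambda>s. (G t \<bullet> G s) * (x t * y s)))"
proof -
  have "coef I G x \<bullet> coef I G y = avg I (\<lambda>t. x t * (coef I G y \<bullet> G t))"
    by (simp add: coef_inner inner_commute)
  also have "\<dots> = avg I (\<lambda>t. x t * avg I (\<lambda>s. y s * (G s \<bullet> G t)))"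
    by (simp only: coef_inner)
  finally show ?thesis
    by (simp add: avg_mult_left[symmetric] inner_commute mult_ac)
qed

context
  fixes I :: "'i set" and G :: "'i \<Rightarrow> 'b::euclidean_space"
  assumes ortho: "orthonormal I G"
begin

lemma orthonormal_coef [simp]: "coef I G (\<lambda>t. G t \<bullet> v) = v" "coef I G (\<lambda>t. v \<bullet> G t) = v"
  using ortho by (simp_all add: orthonormal_def coef_def inner_commute)

lemma orthonormal_inner: "avg I (\<lambda>t. (G t \<bullet> v) * (G t \<bullet> w)) = v \<bullet> w"
  using coef_inner[of I G "\<lambda>t. G t \<bullet> v" w] by simp

lemma orthonormal_rms_inner [simp]: "rms I (\<lambda>t. G t \<bullet> v) = norm v" "rms I (\<lambda>t. v \<bullet> G t) = norm v"
  using orthonormal_inner[of v v]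
  by (simp_all add: rms_def power2_eq_square norm_eq_sqrt_inner inner_commute)

text \<open>The trace of a projection is its rank.\<close>

lemma orthonormal_rms: "(rms I G)\<^sup>2 = DIM('b)"
proof -
  have "(rms I G)\<^sup>2 = avg I (\<lambda>t. \<Sum>b\<in>Basis. (G t \<bullet> b) * (G t \<bullet> b))"
    unfolding rms_power2 by (simp add: power2_norm_eq_inner euclidean_inner[symmetric])
  also have "\<dots> = (\<Sum>b\<in>Basis. (b::'b) \<bullet> b)"
    by (simp add: avg_sum orthonormal_inner)
  also have "\<dots> = DIM('b)" by (simp add: inner_same_Basis)
  finally show ?thesis .
qed

text \<open>Bessel's inequality, by testing the coefficient vector against itself.\<close>

lemma coef_le: "norm (coef I G x) \<le> rms I x"
proof (cases "coef I G x = 0")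
  case False
  have "norm (coef I G x) * norm (coef I G x) = avg I (\<lambda>t. x t * (G t \<bullet> coef I G x))"
    by (simp add: coef_inner[symmetric] power2_norm_eq_inner[symmetric] power2_eq_square[symmetric])
  also have "\<dots> \<le> rms I x * norm (coef I G x)"
    using abs_avg_mult_le[of I x "\<lambda>t. G t \<bullet> coef I G x"] by simp
  finally show ?thesis using False by simp
qed simp

text \<open>Pythagoras. The best \<open>v\<close> is \<open>coef I G x\<close>; this is how the
  loadings are concentrated out of the criterion.\<close>

lemma least_squares_decomp:
  "avg I (\<lambda>t. (x t - v \<bullet> G t)\<^sup>2)
     = avg I (\<lambda>t. (x t)\<^sup>2) - (norm (coef I G x))\<^sup>2 + (norm (v - coef I G x))\<^sup>2"
proof -
  have "avg I (\<lambda>t. (x t - v \<bullet> G t)\<^sup>2)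
      = avg I (\<lambda>t. (x t)\<^sup>2 - 2 * (x t * (G t \<bullet> v)) + (G t \<bullet> v) * (G t \<bullet> v))"
    by (rule avg_cong) (simp add: power2_eq_square algebra_simps inner_commute)
  also have "\<dots> = avg I (\<lambda>t. (x t)\<^sup>2) - 2 * (coef I G x \<bullet> v) + v \<bullet> v"
    by (simp add: avg_linear coef_inner orthonormal_inner)
  finally show ?thesis
    by (simp add: power2_norm_eq_inner inner_diff_left inner_diff_right inner_commute)
qed

lemma orthonormal_rms_eq: "rms I G = sqrt DIM('b)"
  using orthonormal_rms by (metis real_sqrt_abs abs_of_nonneg rms_nonneg)

lemma orthonormal_kernel_rms: "rms I (\<lambda>t. rms I (\<lambda>s. G t \<bullet> G s)) = sqrt DIM('b)"
  by (simp add: orthonormal_rms_eq)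

end

definition kernel_dist :: "'i set \<Rightarrow> ('i \<Rightarrow> 'b::euclidean_space) \<Rightarrow> ('i \<Rightarrow> 'b) \<Rightarrow> real" where
  "kernel_dist I G H = rms I (\<lambda>t. rms I (\<lambda>s. H t \<bullet> H s - G t \<bullet> G s))"

lemma kernel_dist_commute: "kernel_dist I G H = kernel_dist I H G"
  unfolding kernel_dist_def by (intro rms_cong) (simp, intro rms_cong, simp add: abs_minus_commute)

lemma kernel_dist_nonneg: "0 \<le> kernel_dist I G H"
  by (simp add: kernel_dist_def)

lemma kernel_dist_le:
  fixes G H :: "'i \<Rightarrow> 'b::euclidean_space"
  assumes "orthonormal I G" "orthonormal I H"
  shows "kernel_dist I G H \<le> 2 * sqrt DIM('b)"
proof -
  have "kernel_dist I G H \<le> rms I (\<lambda>t. rms I (\<lambda>s. H t \<bullet> H s) + rms I (\<lambda>s. G t \<bullet> G s))"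
    unfolding kernel_dist_def by (intro rms_mono) (simp add: rms_triangle_diff)
  also have "\<dots> \<le> rms I (\<lambda>t. rms I (\<lambda>s. H t \<bullet> H s)) + rms I (\<lambda>t. rms I (\<lambda>s. G t \<bullet> G s))"
    by (rule rms_triangle)
  finally show ?thesis using assms by (simp add: orthonormal_kernel_rms orthonormal_rms_eq)
qed

text \<open>Under the normalization the norm of a coefficient vector is the \<open>rms\<close> of
  its fitted values, so the two norms differ by at most the size of \<open>(P_H - P_G)x\<close>.
  Correlations with the estimated factors are thereby traded for correlations with the true
  ones.\<close>

lemma coef_le_coef:
  assumes G: "orthonormal I G" and H: "orthonormal I H"
  shows "norm (coef I H x) \<le> norm (coef I G x) + kernel_dist I G H * rms I x"
proof -
  have eq: "H t \<bullet> coef I H x - G t \<bullet> coef I G x = avg I (\<lambda>s. x s *\<^sub>R (H t \<bullet> H s - G t \<bullet> G s))" for t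
    by (simp add: coef_def avg_inner_right[symmetric] avg_diff[symmetric] algebra_simps)
  have "norm (coef I H x) - norm (coef I G x)
      \<le> rms I (\<lambda>t. H t \<bullet> coef I H x - G t \<bullet> coef I G x)"
    using rms_triangle_diff2[of I "\<lambda>t. H t \<bullet> coef I H x" "\<lambda>t. G t \<bullet> coef I G x"] G H by simp
  also have "\<dots> \<le> rms I x * rms I (\<lambda>s. rms I (\<lambda>t. H t \<bullet> H s - G t \<bullet> G s))"
    unfolding eq by (rule rms_avg_le)
  also have "\<dots> = rms I x * kernel_dist I G H"
    unfolding kernel_dist_def by (subst rms_rms_swap) simp
  finally show ?thesis by (simp add: mult.commute)
qed

definition residual :: "'i set \<Rightarrow> ('i \<Rightarrow> 'b::euclidean_space) \<Rightarrow> ('i \<Rightarrow> 'b) \<Rightarrow> 'i \<Rightarrow> 'b" where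
  "residual I H G t = G t - avg I (\<lambda>s. (H s \<bullet> H t) *\<^sub>R G s)"

lemma residual_inner: "residual I H G t \<bullet> v = G t \<bullet> v - coef I H (\<lambda>s. G s \<bullet> v) \<bullet> H t"
  by (simp add: residual_def inner_diff_left avg_inner_left[symmetric] coef_inner mult.commute)

lemma residual_power2:
  assumes G: "orthonormal I G" and H: "orthonormal I H"
  shows "avg I (\<lambda>t. (residual I H G t \<bullet> v)\<^sup>2) = (norm v)\<^sup>2 - (norm (coef I H (\<lambda>s. G s \<bullet> v)))\<^sup>2"
  using least_squares_decomp[OF H, of "\<lambda>t. G t \<bullet> v" "coef I H (\<lambda>s. G s \<bullet> v)"]
    orthonormal_inner[OF G, of v v]
  by (simp add: residual_inner power2_eq_square[of "G _ \<bullet> v"] power2_norm_eq_inner)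

text \<open>Both sides equal \<open>2k - 2 tr(P_H P_G)\<close> with \<open>k\<close> the number of
  factors; the trace is \<open>?m\<close>.\<close>

lemma kernel_dist_residual:
  fixes G H :: "'i \<Rightarrow> 'b::euclidean_space"
  assumes G: "orthonormal I G" and H: "orthonormal I H"
  shows "(kernel_dist I G H)\<^sup>2 = 2 * (rms I (residual I H G))\<^sup>2"
proof -
  let ?m = "\<Sum>b\<in>Basis. (norm (coef I H (\<lambda>s. G s \<bullet> b)))\<^sup>2"
  have "avg I (\<lambda>t. avg I (\<lambda>s. (H t \<bullet> H s) * (G t \<bullet> G s)))
      = avg I (\<lambda>t. avg I (\<lambda>s. \<Sum>b\<in>Basis. (H t \<bullet> H s) * ((G t \<bullet> b) * (G s \<bullet> b))))"
    by (simp add: sum_distrib_left[symmetric] euclidean_inner[symmetric])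
  also have "\<dots> = ?m"
    by (simp add: avg_sum coef_inner_coef power2_norm_eq_inner)
  finally have m: "avg I (\<lambda>t. avg I (\<lambda>s. (H t \<bullet> H s) * (G t \<bullet> G s))) = ?m" .
  have sq: "avg I (\<lambda>t. avg I (\<lambda>s. (F t \<bullet> F s) * (F t \<bullet> F s))) = DIM('b)"
    if "orthonormal I F" for F :: "'i \<Rightarrow> 'b"
    using orthonormal_rms[OF that] orthonormal_inner[OF that]
    by (simp add: inner_commute rms_power2 power2_norm_eq_inner)
  have "(kernel_dist I G H)\<^sup>2 = avg I (\<lambda>t. avg I (\<lambda>s. (H t \<bullet> H s) * (H t \<bullet> H s)
      - 2 * ((H t \<bullet> H s) * (G t \<bullet> G s)) + (G t \<bullet> G s) * (G t \<bullet> G s)))"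
    unfolding kernel_dist_def rms_power2
    by (simp add: rms_power2) (simp add: power2_eq_square algebra_simps)
  also have "\<dots> = 2 * DIM('b) - 2 * ?m"
    by (simp add: avg_add avg_diff avg_mult_left m sq[OF G] sq[OF H])
  finally have 1: "(kernel_dist I G H)\<^sup>2 = 2 * DIM('b) - 2 * ?m" .
  have "(rms I (residual I H G))\<^sup>2 = avg I (\<lambda>t. \<Sum>b\<in>Basis. (residual I H G t \<bullet> b)\<^sup>2)"
    unfolding rms_power2
    by (simp add: power2_norm_eq_inner power2_eq_square[of "_ \<bullet> _"] euclidean_inner[symmetric])
  also have "\<dots> = (\<Sum>b\<in>Basis. (norm (b::'b))\<^sup>2) - ?m"
    by (simp add: avg_sum residual_power2[OF G H] sum_subtractf)
  finally show ?thesis using 1 by simp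
qed

lemma rms_residual_le:
  assumes G: "orthonormal I G" and H: "orthonormal I H"
  shows "rms I (residual I H G) \<le> kernel_dist I G H"
proof (rule rms_le_power2)
  show "(rms I (residual I H G))\<^sup>2 \<le> (kernel_dist I G H)\<^sup>2"
    unfolding kernel_dist_residual[OF assms] by (simp add: zero_le_power2)
qed (simp add: kernel_dist_nonneg)

lemma avg_mult_avg: "avg I f * avg J g = avg I (\<lambda>s. avg J (\<lambda>t. f s * g t))"
  for f :: "_ \<Rightarrow> real"
  by (simp only: avg_mult_left avg_mult_right)

text \<open>\<open>|Ua|\<^sup>2\<close> is a quadratic form in \<open>U'U\<close>, whose operator norm is that of \<open>UU'\<close> and hence at most the
  Hilbert-Schmidt norm of \<open>UU'\<close>.\<close>

lemma rms_avg_le_sqrt_gram: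
  "rms I (\<lambda>s. avg J (\<lambda>j. a j * U s j))
     \<le> rms J a * sqrt (rms I (\<lambda>t. rms I (\<lambda>s. avg J (\<lambda>j. U t j * U s j))))"
  for a :: "_ \<Rightarrow> real"
proof -
  \<comment> \<open>Up to scaling \<open>y = Ua\<close> and \<open>z = U'y\<close>. Then
    \<open>|y|^2 = <a, z> \<le> |a| |z|\<close> and \<open>|z|^2 = y'UU'y \<le> g |y|^2\<close>;
    cancelling one factor \<open>|y|\<close> gives the claim without spectral theory.\<close>
  define y where "y = (\<lambda>s. avg J (\<lambda>j. a j * U s j))"
  define z where "z = (\<lambda>j. avg I (\<lambda>s. y s * U s j))"
  define g where "g = rms I (\<lambda>t. rms I (\<lambda>s. avg J (\<lambda>j. U t j * U s j)))"
  have y2: "(rms I y)\<^sup>2 = avg J (\<lambda>j. a j * z j)"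
  proof -
    have "(rms I y)\<^sup>2 = avg I (\<lambda>s. y s * avg J (\<lambda>j. a j * U s j))"
      unfolding rms_power2 by (simp add: y_def power2_eq_square)
    also have "\<dots> = avg J (\<lambda>j. avg I (\<lambda>s. y s * (a j * U s j)))"
      by (simp add: avg_mult_left[symmetric] avg_swap[of I])
    also have "\<dots> = avg J (\<lambda>j. a j * z j)"
      unfolding z_def by (simp add: avg_mult_left[symmetric] mult_ac)
    finally show ?thesis .
  qed
  have "(rms J z)\<^sup>2 = avg J (\<lambda>j. avg I (\<lambda>s. y s * U s j) * avg I (\<lambda>t. y t * U t j))"
    unfolding rms_power2 z_def by (simp only: power2_eq_square real_norm_def abs_mult_self_eq)
  also have "\<dots> = avg J (\<lambda>j. avg I (\<lambda>s. avg I (\<lambda>t. (y s * y t) * (U s j * U t j))))"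
    by (simp only: avg_mult_avg mult_ac)
  also have "\<dots> = avg I (\<lambda>s. avg I (\<lambda>t. (y s * y t) * avg J (\<lambda>j. U s j * U t j)))"
    by (simp add: avg_mult_left[symmetric] avg_swap[of J])
  also have "\<dots> \<le> rms I (\<lambda>s. rms I (\<lambda>t. y s * y t)) * g"
    using abs_avg_avg_mult_le[of I I "\<lambda>s t. y s * y t" "\<lambda>s t. avg J (\<lambda>j. U s j * U t j)"]
    by (simp add: g_def)
  also have "rms I (\<lambda>s. rms I (\<lambda>t. y s * y t)) = (rms I y)\<^sup>2"
    using rms_norm[of I y] by (simp add: rms_mult_left rms_mult_right power2_eq_square)
  finally have "(rms J z)\<^sup>2 \<le> (rms I y * sqrt g)\<^sup>2"
    by (simp add: power_mult_distrib g_def)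
  then have z: "rms J z \<le> rms I y * sqrt g"
    by (rule rms_le_power2[rotated]) (simp add: g_def)
  have "rms I y * rms I y \<le> rms J a * rms J z"
    using y2 abs_avg_mult_le[of J a z] by (simp add: power2_eq_square)
  also have "\<dots> \<le> rms J a * (rms I y * sqrt g)"
    by (intro mult_left_mono z) simp
  finally have "rms I y * rms I y \<le> (rms J a * sqrt g) * rms I y" by (simp add: mult_ac)
  then have "rms I y \<le> rms J a * sqrt g"
  proof (cases "rms I y = 0")
    case True
    then show ?thesis by (simp add: g_def)
  next
    case False
    then have "0 < rms I y" using rms_nonneg[of I y] by linarith
    then show ?thesis
      using \<open>rms I y * rms I y \<le> (rms J a * sqrt g) * rms I y\<close> by (rule mult_right_le_imp_le[rotated])
  qed
  then show ?thesis by (simp add: y_def g_def)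
qed

section \<open>Rates of a least squares fit\<close>

text \<open>\<open>G\<close> and \<open>L\<close> are the true factors and loadings after normalization, \<open>H\<close> the estimated factors, \<open>U\<close> the
  errors, \<open>Q\<close> the covariates times the estimation error of the slope, which has norm \<open>x\<close>. The outcome net
  of the fitted covariates is \<open>L j \<bullet> G t + U t j - Q t j\<close>. The loadings have been concentrated out of the
  last two assumptions, which compare \<open>(H, slope estimate)\<close> with \<open>(G, slope estimate)\<close> and with
  \<open>(G, true slope)\<close>.\<close>

locale factor_fit =
  fixes I :: "'i set" and J :: "'j set"
    and G H :: "'i \<Rightarrow> 'b::euclidean_space" and L :: "'j \<Rightarrow> 'b"
    and U Q :: "'i \<Rightarrow> 'j \<Rightarrow> real"
    and K \<kappa> c r x :: real
  assumes orthoG: "orthonormal I G" and orthoH: "orthonormal I H"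
    and K: "1 \<le> K" and \<kappa>: "0 < \<kappa>" and c: "0 < c" and r: "0 < r" "r \<le> 1" and x: "0 \<le> x"
    and dim_le: "sqrt DIM('b) \<le> K"
    and L_lower: "\<And>v. \<kappa> * (norm v)\<^sup>2 \<le> avg J (\<lambda>j. (L j \<bullet> v)\<^sup>2)"
    and L_le: "rms J L \<le> K"
    and UU_le: "rms I (\<lambda>t. rms I (\<lambda>s. avg J (\<lambda>j. U t j * U s j))) \<le> K * r"
    and UL_le: "rms I (\<lambda>t. avg J (\<lambda>j. U t j *\<^sub>R L j)) \<le> K * r"
    and UG_le: "rms J (\<lambda>j. coef I G (\<lambda>t. U t j)) \<le> K * r"
    and Q_le: "rms I (\<lambda>t. rms J (Q t)) \<le> K * x"
    and QU_le: "\<bar>avg J (\<lambda>j. avg I (\<lambda>t. Q t j * U t j))\<bar> \<le> K * x * r"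
    and design_lower: "c * x\<^sup>2 \<le> avg J (\<lambda>j. avg I (\<lambda>t. (L j \<bullet> G t - Q t j)\<^sup>2)
          - (norm (coef I H (\<lambda>t. L j \<bullet> G t - Q t j)))\<^sup>2)"
    and fit_given_slope: "avg J (\<lambda>j. (norm (coef I G (\<lambda>t. L j \<bullet> G t + U t j - Q t j)))\<^sup>2)
          \<le> avg J (\<lambda>j. (norm (coef I H (\<lambda>t. L j \<bullet> G t + U t j - Q t j)))\<^sup>2)"
    and fit: "avg J (\<lambda>j. avg I (\<lambda>t. (L j \<bullet> G t + U t j - Q t j)\<^sup>2)
          - (norm (coef I H (\<lambda>t. L j \<bullet> G t + U t j - Q t j)))\<^sup>2)
          \<le> avg J (\<lambda>j. avg I (\<lambda>t. (U t j)\<^sup>2) - (norm (coef I G (\<lambda>t. U t j)))\<^sup>2)"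
begin

definition d :: real where "d = kernel_dist I G H"

definition C :: "'i \<Rightarrow> 'j \<Rightarrow> real" where "C t j = L j \<bullet> G t"

text \<open>The bilinear form of \<open>P_H - P_G\<close>, averaged over units. The comparisons are
  expanded in it because each of its values carries a factor \<open>d\<close>.\<close>

definition q :: "('i \<Rightarrow> 'j \<Rightarrow> real) \<Rightarrow> ('i \<Rightarrow> 'j \<Rightarrow> real) \<Rightarrow> real" where
  "q X Y = avg J (\<lambda>j. coef I H (\<lambda>t. X t j) \<bullet> coef I H (\<lambda>t. Y t j)
                    - coef I G (\<lambda>t. X t j) \<bullet> coef I G (\<lambda>t. Y t j))"

lemma d_nonneg: "0 \<le> d" by (simp add: d_def kernel_dist_nonneg)

lemma K_pos: "0 < K" and K_le_K2: "K \<le> K\<^sup>2" and sqrt_K_le: "sqrt K \<le> K"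
  using K by (auto simp: power2_eq_square intro: real_le_lsqrt)

lemma d_le: "d \<le> 2 * K"
  using kernel_dist_le[OF orthoG orthoH] dim_le by (simp add: d_def)

text \<open>Cauchy-Schwarz between the difference of the kernels and the matrix \<open>XY'\<close>.
  The bounds below thus ask only for the Hilbert-Schmidt norm of such a product.\<close>

lemma q_bound: "\<bar>q X Y\<bar> \<le> d * rms I (\<lambda>t. rms I (\<lambda>s. avg J (\<lambda>j. X t j * Y s j)))"
proof -
  have "q X Y = avg J (\<lambda>j. avg I (\<lambda>t. avg I (\<lambda>s.
      (H t \<bullet> H s - G t \<bullet> G s) * (X t j * Y s j))))"
    unfolding q_def coef_inner_coef avg_diff[symmetric] left_diff_distrib ..
  also have "\<dots> = avg I (\<lambda>t. avg I (\<lambda>s.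
      (H t \<bullet> H s - G t \<bullet> G s) * avg J (\<lambda>j. X t j * Y s j)))"
    by (simp add: avg_mult_left[symmetric] avg_swap[of J])
  finally show ?thesis
    using abs_avg_avg_mult_le[of I I "\<lambda>t s. H t \<bullet> H s - G t \<bullet> G s"
        "\<lambda>t s. avg J (\<lambda>j. X t j * Y s j)"]
    by (simp add: d_def kernel_dist_def)
qed

lemma q_boundI:
  assumes "rms I (\<lambda>t. rms I (\<lambda>s. avg J (\<lambda>j. X t j * Y s j))) \<le> B"
  shows "\<bar>q X Y\<bar> \<le> d * B"
  using q_bound[of X Y] mult_left_mono[OF assms d_nonneg] by linarith

text \<open>Submultiplicativity of the Hilbert-Schmidt norm.\<close>

lemma gram_le:
  "rms I (\<lambda>t. rms I (\<lambda>s. avg J (\<lambda>j. X t j * Y s j)))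
     \<le> rms I (\<lambda>t. rms J (X t)) * rms I (\<lambda>t. rms J (Y t))"
  for X Y :: "'i \<Rightarrow> 'j \<Rightarrow> real"
proof -
  have "rms I (\<lambda>t. rms I (\<lambda>s. avg J (\<lambda>j. X t j * Y s j)))
      \<le> rms I (\<lambda>t. rms J (X t) * rms J (\<lambda>j. rms I (\<lambda>s. Y s j)))"
  proof (intro rms_mono)
    fix t
    show "norm (rms I (\<lambda>s. avg J (\<lambda>j. X t j * Y s j)))
        \<le> norm (rms J (X t) * rms J (\<lambda>j. rms I (\<lambda>s. Y s j)))"
      using rms_avg_le[of I J "X t" "\<lambda>j s. Y s j"] by simp
  qed
  then show ?thesis by (simp add: rms_mult_right rms_rms_swap[of J])
qed

lemma C_le: "rms I (\<lambda>t. rms J (C t)) \<le> K"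
  using L_le by (subst rms_rms_swap) (simp add: C_def orthonormal_rms_inner[OF orthoG])

lemma qUU: "\<bar>q U U\<bar> \<le> d * (K * r)"
  by (intro q_boundI UU_le)

lemma qQQ: "\<bar>q Q Q\<bar> \<le> d * (K * x)\<^sup>2"
  using gram_le[of Q Q] mult_mono[OF Q_le Q_le] K_pos x
  by (intro q_boundI) (simp add: power2_eq_square)

lemma qCQ: "\<bar>q C Q\<bar> \<le> d * (K\<^sup>2 * x)"
  using gram_le[of C Q] mult_mono[OF C_le Q_le] K_pos x
  by (intro q_boundI) (simp add: power2_eq_square)

text \<open>Since \<open>C\<close> factors through the loadings, the product \<open>CU'\<close>
  contains the errors only as \<open>UL\<close>, which is of order \<open>r\<close> by
  \<open>UL_le\<close>.\<close>

lemma qCU: "\<bar>q C U\<bar> \<le> d * (K\<^sup>2 * r)"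
proof (rule q_boundI)
  have eq: "avg J (\<lambda>j. C t j * U s j) = avg J (\<lambda>j. U s j *\<^sub>R L j) \<bullet> G t" for t s
    by (simp add: C_def avg_inner_left[symmetric] mult.commute)
  have "rms I (\<lambda>t. rms I (\<lambda>s. avg J (\<lambda>j. C t j * U s j)))
      \<le> rms I (\<lambda>t. rms I (\<lambda>s. avg J (\<lambda>j. U s j *\<^sub>R L j)) * norm (G t))"
    unfolding eq by (intro rms_mono) (simp add: rms_inner_le)
  also have "\<dots> = rms I (\<lambda>s. avg J (\<lambda>j. U s j *\<^sub>R L j)) * sqrt DIM('b)"
    by (simp add: rms_mult_left orthonormal_rms_eq[OF orthoG])
  also have "\<dots> \<le> (K * r) * K"
    using UL_le dim_le K_pos r by (intro mult_mono) auto
  finally show "rms I (\<lambda>t. rms I (\<lambda>s. avg J (\<lambda>j. C t j * U s j))) \<le> K\<^sup>2 * r"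
    by (simp add: power2_eq_square mult_ac)
qed

lemma avg_U_le: "rms I (\<lambda>s. avg J (\<lambda>j. a j * U s j)) \<le> rms J a * (K * sqrt r)" for a :: "'j \<Rightarrow> real"
proof -
  have "sqrt (rms I (\<lambda>t. rms I (\<lambda>s. avg J (\<lambda>j. U t j * U s j)))) \<le> sqrt K * sqrt r"
    using UU_le by (simp add: real_sqrt_mult[symmetric])
  also have "\<dots> \<le> K * sqrt r" using sqrt_K_le r by (intro mult_right_mono) auto
  finally show ?thesis
    using rms_avg_le_sqrt_gram[of I J a U]
    by (meson mult_left_mono order_trans rms_nonneg)
qed

text \<open>\<open>Q\<close> has no factor structure, so the errors enter through their operator
  norm, of order \<open>sqrt r\<close> only. This is the origin of the half power in the comparison
  with the true slope.\<close>

lemma qQU: "\<bar>q Q U\<bar> \<le> d * (K\<^sup>2 * x * sqrt r)"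
proof (rule q_boundI)
  have "rms I (\<lambda>t. rms I (\<lambda>s. avg J (\<lambda>j. Q t j * U s j))) \<le> rms I (\<lambda>t. rms J (Q t) * (K * sqrt r))"
    by (rule rms_mono) (use order_trans[OF avg_U_le abs_ge_self] in \<open>simp only: real_norm_def abs_of_nonneg rms_nonneg\<close>)
  also have "\<dots> = rms I (\<lambda>t. rms J (Q t)) * (K * sqrt r)"
    using K_pos r by (simp add: rms_mult_right abs_mult)
  also have "\<dots> \<le> (K * x) * (K * sqrt r)" using Q_le K_pos r by (intro mult_right_mono) auto
  finally show "rms I (\<lambda>t. rms I (\<lambda>s. avg J (\<lambda>j. Q t j * U s j))) \<le> K\<^sup>2 * x * sqrt r"
    by (simp add: power2_eq_square mult_ac)
qed

lemma coef_C: "coef I G (\<lambda>t. C t j) = L j"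
  using orthonormal_coef[OF orthoG] by (simp add: C_def)

text \<open>The columns of \<open>C\<close> lie in the span of \<open>G\<close>, so
  \<open>- q C C\<close> is the mean square of \<open>C\<close> projected off \<open>H\<close>. By
  \<open>L_lower\<close> it is at least \<open>\<kappa>\<close> times that of
  \<open>residual I H G\<close>, which is half of \<open>d\<close> squared.\<close>

lemma qCC: "q C C \<le> - (\<kappa> * d\<^sup>2 / 2)"
proof -
  have "- q C C = avg J (\<lambda>j. avg I (\<lambda>t. (residual I H G t \<bullet> L j)\<^sup>2))"
    unfolding q_def coef_C residual_power2[OF orthoG orthoH] avg_minus[symmetric]
    by (simp add: C_def power2_norm_eq_inner inner_commute)
  also have "\<dots> = avg I (\<lambda>t. avg J (\<lambda>j. (L j \<bullet> residual I H G t)\<^sup>2))"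
    by (subst avg_swap) (simp add: inner_commute)
  also have "\<dots> \<ge> avg I (\<lambda>t. \<kappa> * (norm (residual I H G t))\<^sup>2)"
    by (intro avg_mono L_lower)
  finally have "\<kappa> * (rms I (residual I H G))\<^sup>2 \<le> - q C C"
    by (simp add: avg_mult_left rms_power2)
  then show ?thesis using kernel_dist_residual[OF orthoG orthoH] by (simp add: d_def)
qed

text \<open>Both sides of \<open>fit_given_slope\<close> use the same outcome, so the comparison
  says that \<open>q\<close> is nonnegative at \<open>C + U - Q\<close>. In the expansion only
  \<open>q C C\<close> is negative of second order in \<open>d\<close>.\<close>

lemma kernel_ineq:
  "\<kappa> * d\<^sup>2 / 2 \<le> d * (K * r + (K * x)\<^sup>2 + 2 * (K\<^sup>2 * r) + 2 * (K\<^sup>2 * x) + 2 * (K\<^sup>2 * x * sqrt r))"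
proof -
  have "0 \<le> q (\<lambda>t j. C t j + U t j - Q t j) (\<lambda>t j. C t j + U t j - Q t j)"
    using fit_given_slope by (simp add: q_def C_def avg_diff power2_norm_eq_inner)
  also have "\<dots> = q C C + q U U + q Q Q + 2 * q C U - 2 * q C Q - 2 * q Q U"
    unfolding q_def
    by (simp add: coef_add coef_diff inner_add_left inner_add_right inner_diff_left inner_diff_right
        avg_add avg_diff) (simp add: inner_commute)
  finally show ?thesis
    using qCC qUU qQQ qCU qCQ qQU by (simp add: distrib_left abs_le_iff)
qed

text \<open>The design condition takes care of \<open>C - Q\<close> as a whole, so no term in
  \<open>C\<close> and \<open>Q\<close> alone is left. The sum of squares of \<open>U\<close>
  cancels. Since \<open>C\<close> lies in the span of \<open>G\<close>, its product with
  \<open>U\<close> equals the projected one and combines with the projection on \<open>H\<close> to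
  \<open>q C U\<close>.\<close>

lemma slope_ineq:
  "c * x\<^sup>2 \<le> 2 * (d * (K\<^sup>2 * r)) + 2 * (K * x * r) + 2 * (K * x * (K * r))
     + 2 * (d * (K\<^sup>2 * x * sqrt r)) + d * (K * r)"
proof -
  let ?in = "\<lambda>X Y. avg J (\<lambda>j. avg I (\<lambda>t. X t j * Y t j))"
  let ?h = "\<lambda>X Y. avg J (\<lambda>j. coef I H (\<lambda>t. X t j) \<bullet> coef I H (\<lambda>t. Y t j))"
  let ?g = "\<lambda>X Y. avg J (\<lambda>j. coef I G (\<lambda>t. X t j) \<bullet> coef I G (\<lambda>t. Y t j))"
  have q: "q X Y = ?h X Y - ?g X Y" for X Y by (simp add: q_def avg_diff)
  have CU: "?in C U = ?g C U"
    unfolding coef_C by (simp add: C_def coef_inner inner_commute[of "L _" "coef _ _ _"]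
        inner_commute[of "G _"] mult.commute)
  have gQU: "\<bar>?g Q U\<bar> \<le> K * x * (K * r)"
  proof -
    have "\<bar>?g Q U\<bar> \<le> rms J (\<lambda>j. coef I G (\<lambda>t. Q t j)) * rms J (\<lambda>j. coef I G (\<lambda>t. U t j))"
      by (rule abs_avg_inner_le)
    also have "rms J (\<lambda>j. coef I G (\<lambda>t. Q t j)) \<le> rms J (\<lambda>j. rms I (\<lambda>t. Q t j))"
      by (intro rms_mono) (simp add: coef_le[OF orthoG])
    also have "\<dots> \<le> K * x" using Q_le by (subst rms_rms_swap)
    finally show ?thesis using UG_le K_pos x mult_mono[of _ "K * x" _ "K * r"]
      by (meson mult_mono order_trans mult_nonneg_nonneg less_imp_le rms_nonneg mult_right_mono
          mult_left_mono)
  qed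
  have "?in (\<lambda>t j. C t j + U t j - Q t j) (\<lambda>t j. C t j + U t j - Q t j)
       - ?h (\<lambda>t j. C t j + U t j - Q t j) (\<lambda>t j. C t j + U t j - Q t j) \<le> ?in U U - ?g U U"
    using fit by (simp add: C_def avg_diff power2_norm_eq_inner power2_eq_square[of "_ - _"]
        power2_eq_square[of "U _ _"])
  moreover have "c * x\<^sup>2 \<le> ?in (\<lambda>t j. C t j - Q t j) (\<lambda>t j. C t j - Q t j)
       - ?h (\<lambda>t j. C t j - Q t j) (\<lambda>t j. C t j - Q t j)"
    using design_lower by (simp add: C_def avg_diff power2_norm_eq_inner power2_eq_square[of "_ - _"])
  moreover have "?in (\<lambda>t j. C t j + U t j - Q t j) (\<lambda>t j. C t j + U t j - Q t j)
      = ?in (\<lambda>t j. C t j - Q t j) (\<lambda>t j. C t j - Q t j) + ?in U U + 2 * ?in C U - 2 * ?in Q U"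
    by (simp add: avg_add[symmetric] avg_diff[symmetric] avg_mult_left[symmetric])
      (intro avg_cong, simp add: algebra_simps)
  moreover have "?h (\<lambda>t j. C t j + U t j - Q t j) (\<lambda>t j. C t j + U t j - Q t j)
      = ?h (\<lambda>t j. C t j - Q t j) (\<lambda>t j. C t j - Q t j) + ?h U U + 2 * ?h C U - 2 * ?h Q U"
    by (simp add: coef_add coef_diff inner_add_left inner_add_right inner_diff_left inner_diff_right
        avg_add avg_diff) (simp add: inner_commute)
  ultimately have "c * x\<^sup>2 \<le> 2 * q C U + 2 * ?in Q U - 2 * ?g Q U - 2 * q Q U + q U U"
    using CU by (simp add: q)
  then show ?thesis
    using qCU qQU qUU QU_le gQU by (simp add: abs_le_iff)
qed

end

text \<open>Divide by \<open>d\<close>. For \<open>x \<le> 1\<close> the terms in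
  \<open>x\<^sup>2\<close> and \<open>x * sqrt r\<close> are at most of order \<open>x\<close>,
  which gives the summand \<open>10 * K\<^sup>2 / \<kappa>\<close>; for \<open>x > 1\<close> the
  bound \<open>d \<le> 2 * K\<close> is already enough, which gives \<open>2 * K\<close>.\<close>

lemma kernel_rate:
  fixes d K r x \<kappa> :: real
  assumes K: "1 \<le> K" and \<kappa>: "0 < \<kappa>" and r: "0 < r" "r \<le> 1" and x: "0 \<le> x"
    and d: "0 \<le> d" "d \<le> 2 * K"
    and ineq: "\<kappa> * d\<^sup>2 / 2 \<le> d * (K * r + (K * x)\<^sup>2 + 2 * (K\<^sup>2 * r) + 2 * (K\<^sup>2 * x) + 2 * (K\<^sup>2 * x * sqrt r))"
  shows "d \<le> (10 * K\<^sup>2 / \<kappa> + 2 * K) * (r + x)"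
proof (cases "x \<le> 1")
  case True
  have "d * (\<kappa> * d) \<le> d * (2 * (K * r + (K * x)\<^sup>2 + 2 * (K\<^sup>2 * r) + 2 * (K\<^sup>2 * x) + 2 * (K\<^sup>2 * x * sqrt r)))"
    using ineq by (simp add: power2_eq_square algebra_simps)
  then have "d = 0 \<or> \<kappa> * d \<le> 2 * (K * r + (K * x)\<^sup>2 + 2 * (K\<^sup>2 * r) + 2 * (K\<^sup>2 * x) + 2 * (K\<^sup>2 * x * sqrt r))"
    using d(1) by (auto simp: mult_le_cancel_left)
  moreover have "K * r \<le> K\<^sup>2 * r" using K r by (simp add: power2_eq_square)
  moreover have "(K * x)\<^sup>2 \<le> K\<^sup>2 * x" using x True mult_left_mono[of "x * x" x "K\<^sup>2"] mult_left_le[of x x]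
    by (simp add: power_mult_distrib power2_eq_square mult_ac)
  moreover have "K\<^sup>2 * x * sqrt r \<le> K\<^sup>2 * x * 1" using r x by (intro mult_left_mono) auto
  moreover have "0 \<le> K\<^sup>2 * r" "0 \<le> K\<^sup>2 * x" using r x by auto
  ultimately have "d = 0 \<or> \<kappa> * d \<le> 10 * (K\<^sup>2 * r) + 10 * (K\<^sup>2 * x)" by argo
  then have "d = 0 \<or> d \<le> 10 * K\<^sup>2 / \<kappa> * (r + x)"
    using \<kappa> by (auto simp: field_simps)
  moreover have "0 \<le> 2 * K * (r + x)" using K r x by simp
  moreover have "0 \<le> 10 * K\<^sup>2 / \<kappa> * (r + x)" using K r x \<kappa> by simp
  ultimately show ?thesis unfolding distrib_right[of _ _ "r + x"] by linarith
next
  case False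
  have "2 * K * 1 \<le> 2 * K * (r + x)" using K r False by (intro mult_left_mono) auto
  moreover have "0 \<le> 10 * K\<^sup>2 / \<kappa> * (r + x)" using K r x \<kappa> by simp
  ultimately show ?thesis using d unfolding distrib_right[of _ _ "r + x"] by linarith
qed

text \<open>The case \<open>x \<le> r\<close> is the 1 in the constant. Otherwise
  \<open>r * r \<le> x * r\<close>, and after the bound on \<open>d\<close> is inserted every term
  on the right is a multiple of \<open>x * r\<close> except one in
  \<open>sqrt r * x\<^sup>2\<close>. By \<open>small\<close> half of the left side absorbs that one,
  and a factor \<open>x\<close> cancels.\<close>

lemma slope_rate:
  fixes d K r x c A :: real
  assumes K: "1 \<le> K" and c: "0 < c" and r: "0 < r" "r \<le> 1" and x: "0 \<le> x" and A: "0 \<le> A"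
    and d: "d \<le> A * (r + x)"
    and small: "2 * K\<^sup>2 * A * sqrt r \<le> c / 2"
    and ineq: "c * x\<^sup>2 \<le> 2 * (d * (K\<^sup>2 * r)) + 2 * (K * x * r) + 2 * (K * x * (K * r))
     + 2 * (d * (K\<^sup>2 * x * sqrt r)) + d * (K * r)"
  shows "x \<le> (1 + 4 * (5 * K\<^sup>2 * A + 4 * K\<^sup>2) / c) * r"
proof (cases "x \<le> r")
  case True
  moreover have "0 \<le> 4 * (5 * K\<^sup>2 * A + 4 * K\<^sup>2) / c * r" using K A c r by simp
  ultimately show ?thesis by (simp only: distrib_right mult_1)
next
  case False
  define E where "E = 5 * K\<^sup>2 * A + 4 * K\<^sup>2"
  have sr: "sqrt r \<le> 1" using r by simp
  have KA: "0 \<le> K\<^sup>2 * A" using A by simp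
  have 1: "d * (K\<^sup>2 * r) \<le> A * (r + x) * (K\<^sup>2 * r)" using d r by (intro mult_right_mono) auto
  have 2: "d * (K\<^sup>2 * x * sqrt r) \<le> A * (r + x) * (K\<^sup>2 * x * sqrt r)"
    using d r x by (intro mult_right_mono) auto
  have 3: "d * (K * r) \<le> A * (r + x) * (K\<^sup>2 * r)"
  proof -
    have "d * (K * r) \<le> A * (r + x) * (K * r)" using d r K by (intro mult_right_mono) auto
    also have "\<dots> \<le> A * (r + x) * (K\<^sup>2 * r)"
      using K r x A by (intro mult_left_mono mult_right_mono) (auto simp: power2_eq_square)
    finally show ?thesis .
  qed
  have 4: "K * x * r \<le> K\<^sup>2 * (x * r)"
  proof -
    have "K * (x * r) \<le> K\<^sup>2 * (x * r)"
      using K x r by (intro mult_right_mono) (auto simp: power2_eq_square)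
    then show ?thesis by (simp add: mult_ac)
  qed
  have rr: "r * r \<le> x * r" using False r by (intro mult_right_mono) auto
  have 5: "A * (r + x) * (K\<^sup>2 * r) \<le> 2 * (K\<^sup>2 * A * (x * r))"
    using mult_left_mono[OF rr KA] by (simp add: algebra_simps)
  have 6: "A * (r + x) * (K\<^sup>2 * x * sqrt r) \<le> K\<^sup>2 * A * (x * r) + (K\<^sup>2 * A * sqrt r) * x\<^sup>2"
  proof -
    have "K\<^sup>2 * A * (x * r) * sqrt r \<le> K\<^sup>2 * A * (x * r) * 1"
      using KA x r sr by (intro mult_left_mono) auto
    then show ?thesis by (simp add: algebra_simps power2_eq_square)
  qed
  have 7: "2 * (K\<^sup>2 * A * sqrt r) * x\<^sup>2 \<le> c / 2 * x\<^sup>2"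
    using small by (intro mult_right_mono) auto
  have 8: "K * x * (K * r) = K\<^sup>2 * (x * r)" by (simp add: power2_eq_square mult_ac)
  have 9: "2 * (K\<^sup>2 * A * sqrt r) * x\<^sup>2 = 2 * ((K\<^sup>2 * A * sqrt r) * x\<^sup>2)" by simp
  have "0 \<le> K\<^sup>2 * A * (x * r)" "0 \<le> K\<^sup>2 * (x * r)" using KA x r by auto
  then have "c / 2 * x\<^sup>2 \<le> 8 * (K\<^sup>2 * A * (x * r)) + 4 * (K\<^sup>2 * (x * r))"
    using ineq 1 2 3 4 5 6 7 8 9 by linarith
  also have "\<dots> \<le> 10 * (K\<^sup>2 * A * (x * r)) + 8 * (K\<^sup>2 * (x * r))"
    using \<open>0 \<le> K\<^sup>2 * A * (x * r)\<close> \<open>0 \<le> K\<^sup>2 * (x * r)\<close> by linarith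
  also have "\<dots> = 2 * E * (x * r)"
    by (simp add: E_def algebra_simps)
  finally have "x * (c * x) \<le> x * (4 * E * r)" by (simp add: power2_eq_square mult_ac)
  then have "c * x \<le> 4 * E * r" using False r by (simp add: mult_le_cancel_left)
  then have "x \<le> 4 * E / c * r" using c by (simp add: field_simps)
  then show ?thesis using r by (simp add: E_def distrib_right)
qed

section \<open>Mean squared error of the fitted mean\<close>

context factor_fit
begin

definition A where "A = 10 * K\<^sup>2 / \<kappa> + 2 * K"

lemma d_rate: "d \<le> A * (r + x)"
  unfolding A_def by (rule kernel_rate[OF K \<kappa> r x d_nonneg d_le kernel_ineq])

lemma x_rate:
  assumes "2 * K\<^sup>2 * A * sqrt r \<le> c / 2"
  shows "x \<le> (1 + 4 * (5 * K\<^sup>2 * A + 4 * K\<^sup>2) / c) * r"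
  by (rule slope_rate[OF K c r x _ d_rate assms slope_ineq]) (use K \<kappa> in \<open>simp add: A_def\<close>)

definition E :: "'i \<Rightarrow> 'j \<Rightarrow> real" where "E t j = U t j - Q t j"

lemma W_eq: "L j \<bullet> G t + U t j - Q t j = C t j + E t j"
  by (simp add: C_def E_def)

text \<open>Estimated minus true mean of unit \<open>j\<close>: the coefficient vector is the
  concentrated loading, and \<open>Q\<close> enters with a plus sign because it is the covariate
  effect of estimated minus true slope.\<close>

definition fit_error :: "'j \<Rightarrow> 'i \<Rightarrow> real" where
  "fit_error j t = coef I H (\<lambda>t. L j \<bullet> G t + U t j - Q t j) \<bullet> H t - L j \<bullet> G t + Q t j"

text \<open>Three sources of error: noise and slope error passed on to the fitted loading, the part
  of the true common component outside the span of \<open>H\<close>, and the slope error in the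
  covariate term.\<close>

lemma fit_error_eq:
  "fit_error j t = coef I H (\<lambda>t. E t j) \<bullet> H t - L j \<bullet> residual I H G t + Q t j"
  using residual_inner[of I H G t "L j"]
  unfolding fit_error_def W_eq coef_add
  by (simp add: inner_add_left inner_add_right C_def inner_commute)

text \<open>The errors are nearly orthogonal to the true factors; replacing these by the estimated
  ones costs \<open>d\<close> times the size of the errors, which is of order \<open>r\<close> once
  \<open>d\<close> is.\<close>

lemma coef_E_le:
  assumes "rms I (\<lambda>t. U t j) \<le> K" "norm (coef I G (\<lambda>t. U t j)) \<le> K * r"
    "rms I (\<lambda>t. Q t j) \<le> K * x"
  shows "norm (coef I H (\<lambda>t. E t j)) \<le> K * (r + d + x)"
proof -
  have "norm (coef I H (\<lambda>t. E t j)) \<le> norm (coef I H (\<lambda>t. U t j)) + norm (coef I H (\<lambda>t. Q t j))"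
    by (simp add: E_def coef_diff norm_triangle_ineq4)
  also have "norm (coef I H (\<lambda>t. U t j)) \<le> K * r + d * K"
    using coef_le_coef[OF orthoG orthoH, of "\<lambda>t. U t j"] assms(2)
      mult_left_mono[OF assms(1) d_nonneg] by (simp add: d_def)
  also have "norm (coef I H (\<lambda>t. Q t j)) \<le> K * x"
    using coef_le[OF orthoH] assms(3) by (rule order_trans)
  finally show ?thesis by (simp add: algebra_simps)
qed

lemma rms_fit_error_le:
  assumes "rms I (\<lambda>t. U t j) \<le> K" "norm (coef I G (\<lambda>t. U t j)) \<le> K * r"
    "rms I (\<lambda>t. Q t j) \<le> K * x" and "norm (L j) \<le> K"
  shows "rms I (fit_error j) \<le> K * (r + 2 * d + 2 * x)"
proof -
  have "rms I (fit_error j) \<le> rms I (\<lambda>t. coef I H (\<lambda>t. E t j) \<bullet> H t - L j \<bullet> residual I H G t) + rms I (\<lambda>t. Q t j)"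
    unfolding fit_error_eq by (rule rms_triangle)
  also have "rms I (\<lambda>t. coef I H (\<lambda>t. E t j) \<bullet> H t - L j \<bullet> residual I H G t)
      \<le> rms I (\<lambda>t. coef I H (\<lambda>t. E t j) \<bullet> H t) + rms I (\<lambda>t. L j \<bullet> residual I H G t)"
    by (rule rms_triangle_diff)
  also have "rms I (\<lambda>t. coef I H (\<lambda>t. E t j) \<bullet> H t) \<le> K * (r + d + x)"
    using coef_E_le[OF assms(1-3)] by (simp add: orthonormal_rms_inner[OF orthoH])
  also have "rms I (\<lambda>t. L j \<bullet> residual I H G t) \<le> d * K"
    using rms_inner_le[of I "residual I H G" "L j"] rms_residual_le[OF orthoG orthoH]
      mult_mono[of "rms I (residual I H G)" d "norm (L j)" K] assms(4) d_nonneg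
    by (simp add: d_def inner_commute)
  finally show ?thesis using assms(3) by (simp add: algebra_simps)
qed

end

lemma le_of_mult_self_le: "a * a \<le> b * a \<Longrightarrow> 0 \<le> a \<Longrightarrow> 0 \<le> b \<Longrightarrow> a \<le> (b::real)"
  by (cases "a = 0") (simp_all add: mult_le_cancel_right)

lemma norm_leI_inner:
  fixes w :: "'a::real_inner"
  assumes "\<And>v. w \<bullet> v \<le> B * norm v" and "0 \<le> B"
  shows "norm w \<le> B"
proof (cases "w = 0")
  case False
  have "norm w * norm w \<le> B * norm w"
    using assms(1)[of w] by (simp add: power2_norm_eq_inner[symmetric] power2_eq_square)
  then show ?thesis using False by simp
qed (simp add: assms)

section \<open>Fitted loadings and the rows of a single period\<close>

context factor_fit
begin

definition Lh :: "'j \<Rightarrow> 'b" where "Lh j = coef I H (\<lambda>t. L j \<bullet> G t + U t j - Q t j)"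

text \<open>Signal part of the fitted loading; \<open>\<epsilon>\<close> is its error part.\<close>

definition \<gamma> :: "'j \<Rightarrow> 'b" where "\<gamma> j = coef I H (\<lambda>t. C t j)"

definition \<epsilon> :: "'j \<Rightarrow> 'b" where "\<epsilon> j = coef I H (\<lambda>t. E t j)"

lemma Lh_eq: "Lh j = \<gamma> j + \<epsilon> j"
  by (simp add: Lh_def \<gamma>_def \<epsilon>_def W_eq coef_add)

text \<open>The matrix \<open>G'H/T\<close>, transpose of the map taking \<open>L j\<close> to
  \<open>\<gamma> j\<close>. For small \<open>d\<close> it is nearly isometric, by
  \<open>dual_le\<close> and \<open>dual_ge\<close>.\<close>

definition dual :: "'b \<Rightarrow> 'b" where "dual v = coef I G (\<lambda>t. H t \<bullet> v)"

lemma \<gamma>_inner: "\<gamma> j \<bullet> v = L j \<bullet> dual v"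
  unfolding \<gamma>_def dual_def
  by (simp add: coef_inner inner_commute[of _ "coef _ _ _"]) (simp add: C_def inner_commute mult.commute)

lemma dual_le: "norm (dual v) \<le> norm v"
  using coef_le[OF orthoG, of "\<lambda>t. H t \<bullet> v"] by (simp add: dual_def orthonormal_rms_inner[OF orthoH])

lemma dual_ge: "(1 - d) * norm v \<le> norm (dual v)"
proof -
  have "coef I H (\<lambda>t. H t \<bullet> v) = v" by (simp add: orthonormal_coef[OF orthoH])
  then show ?thesis
    using coef_le_coef[OF orthoG orthoH, of "\<lambda>t. H t \<bullet> v"]
    by (simp add: dual_def d_def left_diff_distrib orthonormal_rms_inner[OF orthoH])
qed

lemma \<epsilon>_inner: "\<epsilon> j \<bullet> v = avg I (\<lambda>s. (H s \<bullet> v) * E s j)"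
  by (simp add: \<epsilon>_def coef_inner mult.commute)

definition \<rho> :: real where "\<rho> = sqrt r + x"

lemma \<rho>_nonneg: "0 \<le> \<rho>" using r x by (simp add: \<rho>_def)

text \<open>The square of \<open>U'H\<close> is the pairing of \<open>UU'\<close> with the kernel of
  \<open>H\<close>, hence of order \<open>r\<close>. Taking the root leaves only
  \<open>sqrt r\<close>, which is why \<open>\<rho>\<close> is defined with it.\<close>

lemma rms_\<epsilon>_le: "rms J \<epsilon> \<le> K * \<rho>"
proof -
  have "(rms J (\<lambda>j. coef I H (\<lambda>t. U t j)))\<^sup>2
      = avg I (\<lambda>t. avg I (\<lambda>s. (H t \<bullet> H s) * avg J (\<lambda>j. U t j * U s j)))"
    by (simp add: rms_power2 power2_norm_eq_inner coef_inner_coef avg_mult_left[symmetric] avg_swap[of J])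
  also have "\<dots> \<le> sqrt DIM('b) * (K * r)"
  proof (rule order_trans)
    show "sqrt DIM('b) * rms I (\<lambda>t. rms I (\<lambda>s. avg J (\<lambda>j. U t j * U s j))) \<le> sqrt DIM('b) * (K * r)"
      by (intro mult_left_mono UU_le) simp
  qed (use abs_avg_avg_mult_le[of I I "\<lambda>t s. H t \<bullet> H s" "\<lambda>t s. avg J (\<lambda>j. U t j * U s j)"] in
      \<open>simp add: orthonormal_kernel_rms[OF orthoH] orthonormal_rms_eq[OF orthoH]\<close>)
  also have "\<dots> \<le> K * (K * r)" using dim_le K_pos r by (intro mult_right_mono) auto
  also have "\<dots> = (K * sqrt r)\<^sup>2" using r by (simp add: power_mult_distrib power2_eq_square)
  finally have U: "rms J (\<lambda>j. coef I H (\<lambda>t. U t j)) \<le> K * sqrt r"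
    by (rule rms_le_power2[rotated]) (use K_pos r in simp)
  have "rms J (\<lambda>j. coef I H (\<lambda>t. Q t j)) \<le> rms J (\<lambda>j. rms I (\<lambda>t. Q t j))"
    by (intro rms_mono) (simp add: coef_le[OF orthoH])
  also have "\<dots> \<le> K * x" using Q_le by (subst rms_rms_swap)
  finally show ?thesis
    using U rms_triangle_diff[of J "\<lambda>j. coef I H (\<lambda>t. U t j)" "\<lambda>j. coef I H (\<lambda>t. Q t j)"]
    by (simp add: \<epsilon>_def[abs_def] E_def coef_diff \<rho>_def algebra_simps)
qed

text \<open>The fitted loadings are well conditioned: the signal part inherits the lower bound of
  \<open>L\<close> through \<open>dual\<close>, and the error part is a perturbation of size
  \<open>K * \<rho>\<close>.\<close>

lemma rms_Lh_ge: "sqrt \<kappa> * ((1 - d) * norm v) - K * \<rho> * norm v \<le> rms J (\<lambda>j. Lh j \<bullet> v)"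
proof -
  have "sqrt \<kappa> * ((1 - d) * norm v) \<le> sqrt \<kappa> * norm (dual v)"
    using dual_ge \<kappa> by (intro mult_left_mono) auto
  also have "\<dots> \<le> rms J (\<lambda>j. L j \<bullet> dual v)"
  proof -
    have "sqrt (\<kappa> * (norm (dual v))\<^sup>2) \<le> rms J (\<lambda>j. L j \<bullet> dual v)"
      using L_lower[of "dual v"] unfolding rms_def by (intro real_sqrt_le_mono) simp
    then show ?thesis by (simp add: real_sqrt_mult)
  qed
  also have "\<dots> \<le> rms J (\<lambda>j. Lh j \<bullet> v) + rms J (\<lambda>j. \<epsilon> j \<bullet> v)"
    using rms_triangle_diff[of J "\<lambda>j. Lh j \<bullet> v" "\<lambda>j. \<epsilon> j \<bullet> v"]
    by (simp add: Lh_eq inner_add_left \<gamma>_inner)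
  also have "rms J (\<lambda>j. \<epsilon> j \<bullet> v) \<le> K * \<rho> * norm v"
    using rms_inner_le[of J \<epsilon> v] mult_right_mono[OF rms_\<epsilon>_le, of "norm v"] by simp
  finally show ?thesis by simp
qed

lemma avg_EL_le:
  "rms I (\<lambda>t. avg J (\<lambda>j. E t j *\<^sub>R L j)) \<le> K\<^sup>2 * (r + x)"
proof -
  have "rms I (\<lambda>t. avg J (\<lambda>j. Q t j *\<^sub>R L j)) \<le> rms I (\<lambda>t. rms J (Q t) * rms J L)"
    by (intro rms_mono) (simp add: norm_avg_scaleR_le)
  also have "\<dots> \<le> (K * x) * K"
    using Q_le L_le K_pos x by (simp add: rms_mult_right mult_mono)
  finally have "rms I (\<lambda>t. avg J (\<lambda>j. Q t j *\<^sub>R L j)) \<le> K\<^sup>2 * x" by (simp add: power2_eq_square mult_ac)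
  moreover have "K * r \<le> K\<^sup>2 * r" using K_le_K2 r by simp
  ultimately show ?thesis
    using UL_le rms_triangle_diff[of I "\<lambda>t. avg J (\<lambda>j. U t j *\<^sub>R L j)" "\<lambda>t. avg J (\<lambda>j. Q t j *\<^sub>R L j)"]
    by (simp add: E_def scaleR_diff_left avg_diff distrib_left)
qed

end

text \<open>The smallness assumptions will follow from the rates when \<open>r\<close> is small and
  keep the matrices below invertible with fixed constants. The assumptions ending in
  \<open>_at\<close> bound row \<open>\<tau>\<close> of the data; \<open>first_order\<close> is the
  normal equation of regressing the outcomes of period \<open>\<tau>\<close> on the fitted
  loadings.\<close>

locale factor_fit_at = factor_fit +
  fixes \<tau>
  assumes x_le: "x \<le> 1" and d_half: "d \<le> 1 / 2"
    and \<rho>1: "K * \<rho> \<le> sqrt \<kappa> / 4" and \<rho>2: "K\<^sup>2 * \<rho> \<le> \<kappa> / 4"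
    and G_at: "norm (G \<tau>) \<le> K" and U_at: "rms J (U \<tau>) \<le> K" and Q_at: "rms J (Q \<tau>) \<le> K * x"
    and UL_at: "norm (avg J (\<lambda>j. U \<tau> j *\<^sub>R L j)) \<le> K * r"
    and UU_at: "rms I (\<lambda>s. avg J (\<lambda>j. U \<tau> j * U s j)) \<le> K * r"
    and first_order: "avg J (\<lambda>j. (L j \<bullet> G \<tau> + U \<tau> j - Q \<tau> j
          - coef I H (\<lambda>t. L j \<bullet> G t + U t j - Q t j) \<bullet> H \<tau>) *\<^sub>R
          coef I H (\<lambda>t. L j \<bullet> G t + U t j - Q t j)) = 0"
begin

text \<open>By \<open>first_order\<close> the fitted values \<open>Lh j \<bullet> H \<tau>\<close>
  are orthogonal to their residuals, hence no larger in \<open>rms\<close> than the outcomes of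
  period \<open>\<tau>\<close>, which are at most \<open>3 * K\<^sup>2\<close>. The smallness
  assumptions leave \<open>sqrt \<kappa> / 4\<close> of the lower bound in
  \<open>rms_Lh_ge\<close>.\<close>

lemma H_at: "norm (H \<tau>) \<le> 12 * K\<^sup>2 / sqrt \<kappa>"
proof -
  define a where "a = (\<lambda>j. Lh j \<bullet> H \<tau>)"
  define W where "W = (\<lambda>j. C \<tau> j + (U \<tau> j - Q \<tau> j))"
  have "avg J (\<lambda>j. (W j - a j) *\<^sub>R Lh j) \<bullet> H \<tau> = 0"
    using first_order by (simp add: Lh_def[symmetric] a_def W_def C_def add_diff_eq)
  then have "avg J (\<lambda>j. a j * a j) = avg J (\<lambda>j. W j * a j)"
    by (simp add: avg_inner_left[symmetric] a_def[symmetric] left_diff_distrib avg_diff)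
      (simp add: a_def)
  then have "rms J a * rms J a \<le> rms J W * rms J a"
    using abs_avg_mult_le[of J W a] rms_power2[of J a] by (simp add: power2_eq_square)
  then have "rms J a \<le> rms J W"
    by (rule le_of_mult_self_le) simp_all
  also have "\<dots> \<le> rms J (C \<tau>) + (rms J (U \<tau>) + rms J (Q \<tau>))"
    using rms_triangle[of J "C \<tau>" "\<lambda>j. U \<tau> j - Q \<tau> j"] rms_triangle_diff[of J "U \<tau>" "Q \<tau>"]
    by (simp add: W_def)
  also have "rms J (C \<tau>) \<le> K * K"
    using rms_inner_le[of J L "G \<tau>"] mult_mono[OF L_le G_at] K_pos by (simp add: C_def[abs_def])
  also have "rms J (U \<tau>) + rms J (Q \<tau>) \<le> K + K * 1"
    using U_at Q_at x_le K_pos mult_left_mono[OF x_le, of K] by linarith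
  finally have a: "rms J a \<le> 3 * K\<^sup>2" using K_le_K2 by (simp add: power2_eq_square)
  have "sqrt \<kappa> * (1 / 2 * norm (H \<tau>)) \<le> sqrt \<kappa> * ((1 - d) * norm (H \<tau>))"
    using d_half \<kappa> by (intro mult_left_mono mult_right_mono) auto
  moreover have "K * \<rho> * norm (H \<tau>) \<le> sqrt \<kappa> / 4 * norm (H \<tau>)"
    using \<rho>1 by (intro mult_right_mono) auto
  ultimately have "sqrt \<kappa> / 4 * norm (H \<tau>) \<le> 3 * K\<^sup>2"
    using rms_Lh_ge[of "H \<tau>"] a by (simp add: a_def)
  then show ?thesis using \<kappa> by (simp add: field_simps)
qed

text \<open>The product of the errors with their own row \<open>\<tau>\<close> is of order
  \<open>r\<close> by \<open>UU_at\<close>; all other products contain \<open>Q\<close>, hence a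
  factor \<open>x\<close>, and crude bounds suffice for them.\<close>

lemma EE_at: "rms I (\<lambda>s. avg J (\<lambda>j. E \<tau> j * E s j)) \<le> 4 * K\<^sup>2 * (r + x)"
proof -
  have eq: "avg J (\<lambda>j. E \<tau> j * E s j) = avg J (\<lambda>j. U \<tau> j * U s j) - avg J (\<lambda>j. E \<tau> j * Q s j)
      - avg J (\<lambda>j. Q \<tau> j * U s j)" for s
    by (simp add: avg_diff[symmetric] E_def algebra_simps)
  have "rms I (\<lambda>s. avg J (\<lambda>j. E \<tau> j * Q s j)) \<le> rms J (E \<tau>) * (K * x)"
    using rms_avg_le[of I J "E \<tau>" "\<lambda>j s. Q s j"] mult_left_mono[OF Q_le, of "rms J (E \<tau>)"]
    by (simp add: rms_rms_swap[of J])
  also have "\<dots> \<le> (2 * K) * (K * x)"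
  proof (rule mult_right_mono)
    have "K * x \<le> K * 1" using x_le K_pos by (intro mult_left_mono) auto
    then show "rms J (E \<tau>) \<le> 2 * K"
      using rms_triangle_diff[of J "U \<tau>" "Q \<tau>"] U_at Q_at unfolding E_def[abs_def] by linarith
  qed (use K_pos x in simp)
  finally have 1: "rms I (\<lambda>s. avg J (\<lambda>j. E \<tau> j * Q s j)) \<le> 2 * (K\<^sup>2 * x)"
    by (simp add: power2_eq_square mult_ac)
  have "rms I (\<lambda>s. avg J (\<lambda>j. Q \<tau> j * U s j)) \<le> (K * x) * (K * 1)"
    by (rule order_trans[OF avg_U_le mult_mono]) (use Q_at K_pos r x in auto)
  then have 2: "rms I (\<lambda>s. avg J (\<lambda>j. Q \<tau> j * U s j)) \<le> K\<^sup>2 * x"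
    by (simp add: power2_eq_square mult_ac)
  have "rms I (\<lambda>s. avg J (\<lambda>j. E \<tau> j * E s j)) \<le> K * r + 2 * (K\<^sup>2 * x) + K\<^sup>2 * x"
    unfolding eq
    using rms_triangle_diff[of I "\<lambda>s. avg J (\<lambda>j. U \<tau> j * U s j) - avg J (\<lambda>j. E \<tau> j * Q s j)"
        "\<lambda>s. avg J (\<lambda>j. Q \<tau> j * U s j)"]
      rms_triangle_diff[of I "\<lambda>s. avg J (\<lambda>j. U \<tau> j * U s j)" "\<lambda>s. avg J (\<lambda>j. E \<tau> j * Q s j)"]
      1 2 UU_at by linarith
  moreover have "K * r \<le> K\<^sup>2 * r" "0 \<le> K\<^sup>2 * r" "0 \<le> K\<^sup>2 * x" using K_le_K2 r x by auto
  ultimately show ?thesis by (simp add: algebra_simps)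
qed

lemma EL_at: "norm (avg J (\<lambda>j. E \<tau> j *\<^sub>R L j)) \<le> K\<^sup>2 * (r + x)"
proof -
  have "norm (avg J (\<lambda>j. Q \<tau> j *\<^sub>R L j)) \<le> (K * x) * K"
    by (rule order_trans[OF norm_avg_scaleR_le mult_mono]) (use Q_at L_le K_pos x in auto)
  then have "norm (avg J (\<lambda>j. E \<tau> j *\<^sub>R L j)) \<le> K * r + K\<^sup>2 * x"
    using UL_at norm_triangle_ineq4[of "avg J (\<lambda>j. U \<tau> j *\<^sub>R L j)" "avg J (\<lambda>j. Q \<tau> j *\<^sub>R L j)"]
    by (simp add: E_def scaleR_diff_left avg_diff power2_eq_square mult_ac)
  moreover have "K * r \<le> K\<^sup>2 * r" using K_le_K2 r by simp
  ultimately show ?thesis by (simp add: distrib_left)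
qed

text \<open>Bounding \<open>E\<close> and \<open>\<epsilon>\<close> separately would lose half a
  power of \<open>r\<close>. Tested against \<open>v\<close>, the signal part of \<open>Lh\<close>
  leads to \<open>EL_at\<close>, while the error part becomes a combination over periods of products
  with row \<open>\<tau>\<close>, which \<open>EE_at\<close> controls.\<close>

lemma avg_E_Lh_le: "norm (avg J (\<lambda>j. E \<tau> j *\<^sub>R Lh j)) \<le> 5 * K\<^sup>2 * (r + x)"
proof (rule norm_leI_inner)
  fix v
  have "avg J (\<lambda>j. E \<tau> j *\<^sub>R Lh j) \<bullet> v
      = avg J (\<lambda>j. E \<tau> j *\<^sub>R L j) \<bullet> dual v + avg I (\<lambda>s. (H s \<bullet> v) * avg J (\<lambda>j. E \<tau> j * E s j))"
  proof -
    have "avg J (\<lambda>j. E \<tau> j *\<^sub>R Lh j) \<bullet> v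
        = avg J (\<lambda>j. E \<tau> j * (L j \<bullet> dual v)) + avg J (\<lambda>j. E \<tau> j * avg I (\<lambda>s. (H s \<bullet> v) * E s j))"
      by (simp add: avg_inner_left[symmetric] Lh_eq inner_add_left \<gamma>_inner \<epsilon>_inner distrib_left avg_add)
    also have "avg J (\<lambda>j. E \<tau> j * avg I (\<lambda>s. (H s \<bullet> v) * E s j))
        = avg I (\<lambda>s. (H s \<bullet> v) * avg J (\<lambda>j. E \<tau> j * E s j))"
      by (simp only: avg_mult_left[symmetric] avg_swap[of J] mult_ac)
    finally show ?thesis by (simp add: avg_inner_left[symmetric])
  qed
  also have "avg J (\<lambda>j. E \<tau> j *\<^sub>R L j) \<bullet> dual v \<le> K\<^sup>2 * (r + x) * norm v"
    using Cauchy_Schwarz_ineq2[of "avg J (\<lambda>j. E \<tau> j *\<^sub>R L j)" "dual v"]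
      mult_mono[OF EL_at dual_le[of v]] r x by auto
  also have "avg I (\<lambda>s. (H s \<bullet> v) * avg J (\<lambda>j. E \<tau> j * E s j)) \<le> norm v * (4 * K\<^sup>2 * (r + x))"
    using abs_avg_mult_le[of I "\<lambda>s. H s \<bullet> v" "\<lambda>s. avg J (\<lambda>j. E \<tau> j * E s j)"]
      mult_left_mono[OF EE_at, of "norm v"] by (simp add: orthonormal_rms_inner[OF orthoH])
  finally show "avg J (\<lambda>j. E \<tau> j *\<^sub>R Lh j) \<bullet> v \<le> 5 * K\<^sup>2 * (r + x) * norm v"
    by (simp add: algebra_simps)
qed (use r x in simp)

lemma \<rho>_power2_le: "\<rho>\<^sup>2 \<le> 2 * (r + x)"
proof -
  have "\<rho>\<^sup>2 \<le> 2 * (sqrt r)\<^sup>2 + 2 * x\<^sup>2"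
    using sum_squares_bound[of "sqrt r" x] unfolding \<rho>_def power2_sum by linarith
  also have "x\<^sup>2 \<le> x" using x x_le by (simp add: power2_eq_square mult_left_le)
  finally show ?thesis using r by simp
qed

text \<open>With the signal part of \<open>Lh\<close>, the average regroups into products of the
  rows of \<open>E\<close> with \<open>L\<close>, of order \<open>r + x\<close> by
  \<open>avg_EL_le\<close>. The rest is quadratic in \<open>\<epsilon>\<close>, hence of order
  \<open>\<rho>\<^sup>2\<close>, which is again \<open>r + x\<close>.\<close>

lemma avg_\<epsilon>_Lh_le:
  "norm (avg J (\<lambda>j. (\<epsilon> j \<bullet> H \<tau>) *\<^sub>R Lh j)) \<le> 3 * K\<^sup>2 * (r + x) * norm (H \<tau>)"
proof (rule norm_leI_inner)
  fix v
  have "avg J (\<lambda>j. (\<epsilon> j \<bullet> H \<tau>) *\<^sub>R Lh j) \<bullet> v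
      = avg J (\<lambda>j. (\<epsilon> j \<bullet> H \<tau>) * (L j \<bullet> dual v)) + avg J (\<lambda>j. (\<epsilon> j \<bullet> H \<tau>) * (\<epsilon> j \<bullet> v))"
    by (simp add: avg_inner_left[symmetric] Lh_eq inner_add_left \<gamma>_inner distrib_left avg_add)
  also have "avg J (\<lambda>j. (\<epsilon> j \<bullet> H \<tau>) * (L j \<bullet> dual v))
      = avg I (\<lambda>s. (H s \<bullet> H \<tau>) * (avg J (\<lambda>j. E s j *\<^sub>R L j) \<bullet> dual v))"
  proof -
    have "avg J (\<lambda>j. (\<epsilon> j \<bullet> H \<tau>) * (L j \<bullet> dual v))
        = avg J (\<lambda>j. avg I (\<lambda>s. (H s \<bullet> H \<tau>) * (E s j * (L j \<bullet> dual v))))"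
      by (simp only: \<epsilon>_inner avg_mult_right[symmetric] mult.assoc)
    also have "\<dots> = avg I (\<lambda>s. avg J (\<lambda>j. (H s \<bullet> H \<tau>) * (E s j * (L j \<bullet> dual v))))"
      by (rule avg_swap)
    finally show ?thesis
      by (simp only: avg_mult_left avg_inner_left[symmetric] inner_scaleR_left)
  qed
  also have "\<dots> \<le> norm (H \<tau>) * (K\<^sup>2 * (r + x) * norm v)"
  proof -
    have "rms I (\<lambda>s. avg J (\<lambda>j. E s j *\<^sub>R L j) \<bullet> dual v) \<le> K\<^sup>2 * (r + x) * norm v"
      by (rule order_trans[OF rms_inner_le mult_mono[OF avg_EL_le dual_le]]) (use r x in auto)
    from mult_left_mono[OF this, of "norm (H \<tau>)"] show ?thesis
      using abs_avg_mult_le[of I "\<lambda>s. H s \<bullet> H \<tau>" "\<lambda>s. avg J (\<lambda>j. E s j *\<^sub>R L j) \<bullet> dual v"]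
      by (simp add: orthonormal_rms_inner[OF orthoH])
  qed
  also have "avg J (\<lambda>j. (\<epsilon> j \<bullet> H \<tau>) * (\<epsilon> j \<bullet> v)) \<le> (K * \<rho> * norm (H \<tau>)) * (K * \<rho> * norm v)"
  proof -
    have "rms J (\<lambda>j. \<epsilon> j \<bullet> w) \<le> K * \<rho> * norm w" for w
      by (rule order_trans[OF rms_inner_le mult_right_mono[OF rms_\<epsilon>_le]]) simp
    from mult_mono[OF this[of "H \<tau>"] this[of v]] show ?thesis
      using abs_avg_mult_le[of J "\<lambda>j. \<epsilon> j \<bullet> H \<tau>" "\<lambda>j. \<epsilon> j \<bullet> v"] K_pos \<rho>_nonneg
      by simp
  qed
  also have "(K * \<rho> * norm (H \<tau>)) * (K * \<rho> * norm v) = \<rho>\<^sup>2 * (K\<^sup>2 * (norm (H \<tau>) * norm v))"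
    by (simp add: power2_eq_square mult_ac)
  also have "\<dots> \<le> 2 * (r + x) * (K\<^sup>2 * (norm (H \<tau>) * norm v))"
    by (intro mult_right_mono \<rho>_power2_le) auto
  finally show "avg J (\<lambda>j. (\<epsilon> j \<bullet> H \<tau>) *\<^sub>R Lh j) \<bullet> v \<le> 3 * K\<^sup>2 * (r + x) * norm (H \<tau>) * norm v"
    by (simp add: algebra_simps)
qed (use r x in simp)

text \<open>\<open>Lh'L/N\<close> is invertible. Its main part is \<open>H'G/T\<close> times
  \<open>L'L/N\<close>, where the second factor is bounded below by \<open>\<kappa>\<close> and the
  first by \<open>1 - d \<ge> 1 / 2\<close>; the error part of \<open>Lh\<close> takes away at most
  \<open>\<kappa> / 4\<close>.\<close>

lemma avg_L_Lh_ge: "\<kappa> / 4 * norm m \<le> norm (avg J (\<lambda>j. (L j \<bullet> m) *\<^sub>R Lh j))"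
proof -
  define y where "y = avg J (\<lambda>j. (L j \<bullet> m) *\<^sub>R L j)"
  have "\<kappa> * norm m * norm m \<le> norm y * norm m"
  proof -
    have "\<kappa> * (norm m)\<^sup>2 \<le> y \<bullet> m"
      using L_lower[of m] by (simp add: y_def avg_inner_left[symmetric] power2_eq_square)
    then show ?thesis
      using Cauchy_Schwarz_ineq2[of y m] by (simp add: power2_eq_square mult_ac)
  qed
  then have y: "\<kappa> * norm m \<le> norm y"
    using \<kappa> mult_right_le_imp_le[of "\<kappa> * norm m" "norm m" "norm y"] by (cases "m = 0") simp_all
  have eq: "avg J (\<lambda>j. (L j \<bullet> m) *\<^sub>R \<gamma> j) = coef I H (\<lambda>t. G t \<bullet> y)"
  proof (rule vector_eq_rdot[THEN iffD1], rule allI)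
    fix v
    have "avg J (\<lambda>j. (L j \<bullet> m) *\<^sub>R \<gamma> j) \<bullet> v = avg J (\<lambda>j. (L j \<bullet> m) * avg I (\<lambda>t. (H t \<bullet> v) * (L j \<bullet> G t)))"
      by (simp add: avg_inner_left[symmetric] \<gamma>_def coef_inner C_def mult.commute)
    also have "\<dots> = avg I (\<lambda>t. avg J (\<lambda>j. (L j \<bullet> m) * (L j \<bullet> G t)) * (H t \<bullet> v))"
    proof -
      have "avg J (\<lambda>j. (L j \<bullet> m) * avg I (\<lambda>t. (H t \<bullet> v) * (L j \<bullet> G t)))
          = avg J (\<lambda>j. avg I (\<lambda>t. (L j \<bullet> m) * (L j \<bullet> G t) * (H t \<bullet> v)))"
        by (simp only: avg_mult_left[symmetric] mult_ac)
      also have "\<dots> = avg I (\<lambda>t. avg J (\<lambda>j. (L j \<bullet> m) * (L j \<bullet> G t) * (H t \<bullet> v)))"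
        by (rule avg_swap)
      finally show ?thesis by (simp only: avg_mult_right)
    qed
    finally show "avg J (\<lambda>j. (L j \<bullet> m) *\<^sub>R \<gamma> j) \<bullet> v = coef I H (\<lambda>t. G t \<bullet> y) \<bullet> v"
      by (simp add: coef_inner y_def avg_inner_right[symmetric] inner_commute[of "G _"])
  qed
  have "1 / 2 * norm y \<le> (1 - d) * norm y" using d_half by (intro mult_right_mono) auto
  also have "\<dots> \<le> norm (coef I H (\<lambda>t. G t \<bullet> y))"
    using coef_le_coef[OF orthoH orthoG, of "\<lambda>t. G t \<bullet> y"]
    by (simp add: d_def kernel_dist_commute[of I H G] left_diff_distrib
        orthonormal_rms_inner[OF orthoG] orthonormal_coef[OF orthoG])
  also have "\<dots> \<le> norm (avg J (\<lambda>j. (L j \<bullet> m) *\<^sub>R Lh j)) + norm (avg J (\<lambda>j. (L j \<bullet> m) *\<^sub>R \<epsilon> j))"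
    using norm_triangle_ineq4[of "avg J (\<lambda>j. (L j \<bullet> m) *\<^sub>R Lh j)" "avg J (\<lambda>j. (L j \<bullet> m) *\<^sub>R \<epsilon> j)"]
    by (simp add: eq[symmetric] Lh_eq scaleR_add_right avg_add)
  also have "norm (avg J (\<lambda>j. (L j \<bullet> m) *\<^sub>R \<epsilon> j)) \<le> (K * norm m) * (K * \<rho>)"
    by (rule order_trans[OF norm_avg_scaleR_le mult_mono[OF order_trans[OF rms_inner_le] rms_\<epsilon>_le]])
      (use L_le K_pos in \<open>auto intro: mult_right_mono\<close>)
  also have "\<dots> = K\<^sup>2 * \<rho> * norm m" by (simp add: power2_eq_square mult_ac)
  also have "\<dots> \<le> \<kappa> / 4 * norm m" by (intro mult_right_mono \<rho>2) auto
  finally show ?thesis using y by simp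
qed

text \<open>Splitting \<open>G \<tau>\<close> into \<open>m\<close> and its projection on
  \<open>H\<close> turns the normal equation into \<open>Lh'L/N\<close> applied to \<open>m\<close>
  on one side and the averages in \<open>avg_\<epsilon>_Lh_le\<close> and \<open>avg_E_Lh_le\<close>
  on the other. The factor 36 is 3 times the 12 of \<open>H_at\<close>.\<close>

lemma residual_at:
  "norm (residual I H G \<tau>) \<le> 4 / \<kappa> * (5 * K\<^sup>2 + 36 * K^4 / sqrt \<kappa>) * (r + x)"
proof -
  define m where "m = residual I H G \<tau>"
  have W: "L j \<bullet> G \<tau> + U \<tau> j - Q \<tau> j - Lh j \<bullet> H \<tau> = L j \<bullet> m + E \<tau> j - \<epsilon> j \<bullet> H \<tau>" for j
    using residual_inner[of I H G \<tau> "L j"]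
    by (simp add: m_def Lh_eq inner_add_left inner_add_right \<gamma>_def C_def E_def inner_commute)
  have "avg J (\<lambda>j. (L j \<bullet> m + E \<tau> j - \<epsilon> j \<bullet> H \<tau>) *\<^sub>R Lh j) = 0"
    using first_order by (simp add: Lh_def[symmetric] W)
  then have "avg J (\<lambda>j. (L j \<bullet> m) *\<^sub>R Lh j)
      = avg J (\<lambda>j. (\<epsilon> j \<bullet> H \<tau>) *\<^sub>R Lh j) - avg J (\<lambda>j. E \<tau> j *\<^sub>R Lh j)"
    by (simp add: scaleR_add_left scaleR_diff_left avg_add avg_diff algebra_simps)
  then have "\<kappa> / 4 * norm m \<le> 3 * K\<^sup>2 * (r + x) * norm (H \<tau>) + 5 * K\<^sup>2 * (r + x)"
    using avg_L_Lh_ge[of m] avg_\<epsilon>_Lh_le avg_E_Lh_le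
      norm_triangle_ineq4[of "avg J (\<lambda>j. (\<epsilon> j \<bullet> H \<tau>) *\<^sub>R Lh j)" "avg J (\<lambda>j. E \<tau> j *\<^sub>R Lh j)"]
    by simp
  also have "3 * K\<^sup>2 * (r + x) * norm (H \<tau>) \<le> 3 * K\<^sup>2 * (r + x) * (12 * K\<^sup>2 / sqrt \<kappa>)"
    using H_at r x by (intro mult_left_mono) auto
  finally have "\<kappa> / 4 * norm m \<le> (5 * K\<^sup>2 + 36 * K^4 / sqrt \<kappa>) * (r + x)"
    by (simp add: algebra_simps add_divide_distrib power2_eq_square power4_eq_xxxx)
  then show ?thesis using \<kappa> by (simp add: m_def field_simps)
qed

lemma fit_error_at:
  assumes "rms I (\<lambda>t. U t j) \<le> K" "norm (coef I G (\<lambda>t. U t j)) \<le> K * r"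
    "rms I (\<lambda>t. Q t j) \<le> K * x" and "norm (L j) \<le> K" and "\<bar>Q \<tau> j\<bar> \<le> K * x"
  shows "\<bar>fit_error j \<tau>\<bar> \<le> (12 * K\<^sup>2 / sqrt \<kappa>) * (K * (r + d + x))
     + K * (4 / \<kappa> * (5 * K\<^sup>2 + 36 * K^4 / sqrt \<kappa>) * (r + x)) + K * x"
proof -
  have "\<bar>coef I H (\<lambda>t. E t j) \<bullet> H \<tau>\<bar> \<le> (K * (r + d + x)) * (12 * K\<^sup>2 / sqrt \<kappa>)"
    by (rule order_trans[OF Cauchy_Schwarz_ineq2 mult_mono[OF coef_E_le[OF assms(1-3)] H_at]])
      (use K_pos r x d_nonneg in auto)
  moreover have "\<bar>L j \<bullet> residual I H G \<tau>\<bar> \<le> K * (4 / \<kappa> * (5 * K\<^sup>2 + 36 * K^4 / sqrt \<kappa>) * (r + x))"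
    by (rule order_trans[OF Cauchy_Schwarz_ineq2 mult_mono[OF assms(4) residual_at]])
      (use K_pos in auto)
  ultimately show ?thesis
    using assms(5) unfolding fit_error_eq by (simp add: mult.commute)
qed

end

text \<open>\<open>C\<close> and \<open>r0\<close> come before the index sets and the data, so one
  pair serves all samples. The bound at \<open>\<tau>\<close> is nested inside since it needs
  further information on that period.\<close>

lemma factor_fit_error_bounds:
  fixes K \<kappa> c :: real
  assumes K: "1 \<le> K" and \<kappa>: "0 < \<kappa>" and c: "0 < c"
  shows "\<exists>C r0. 0 < r0 \<and> (\<forall>(I :: 'i set) (J :: 'j set) (G :: 'i \<Rightarrow> 'b::euclidean_space) H L U Q r x j \<tau>.
    r < r0 \<longrightarrow> factor_fit I J G H L U Q K \<kappa> c r x \<longrightarrow>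
    rms I (\<lambda>t. U t j) \<le> K \<longrightarrow> norm (coef I G (\<lambda>t. U t j)) \<le> K * r \<longrightarrow>
    rms I (\<lambda>t. Q t j) \<le> K * x \<longrightarrow> norm (L j) \<le> K \<longrightarrow>
    rms I (\<lambda>t. coef I H (\<lambda>t. L j \<bullet> G t + U t j - Q t j) \<bullet> H t - L j \<bullet> G t + Q t j) \<le> C * r \<and>
    (norm (G \<tau>) \<le> K \<longrightarrow> rms J (U \<tau>) \<le> K \<longrightarrow> rms J (Q \<tau>) \<le> K * x \<longrightarrow> \<bar>Q \<tau> j\<bar> \<le> K * x \<longrightarrow>
     norm (avg J (\<lambda>j. U \<tau> j *\<^sub>R L j)) \<le> K * r \<longrightarrow>
     rms I (\<lambda>s. avg J (\<lambda>j. U \<tau> j * U s j)) \<le> K * r \<longrightarrow>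
     avg J (\<lambda>j. (L j \<bullet> G \<tau> + U \<tau> j - Q \<tau> j
          - coef I H (\<lambda>t. L j \<bullet> G t + U t j - Q t j) \<bullet> H \<tau>) *\<^sub>R
          coef I H (\<lambda>t. L j \<bullet> G t + U t j - Q t j)) = 0 \<longrightarrow>
     \<bar>coef I H (\<lambda>t. L j \<bullet> G t + U t j - Q t j) \<bullet> H \<tau> - L j \<bullet> G \<tau> + Q \<tau> j\<bar> \<le> C * r))"
proof -
  \<comment> \<open>\<open>a\<close> and \<open>B\<close> are the constants of
    \<open>kernel_rate\<close> and \<open>slope_rate\<close>; inserting \<open>x \<le> B * r\<close>
    in the former gives \<open>d \<le> B' * r\<close>.\<close>
  define a where "a = 10 * K\<^sup>2 / \<kappa> + 2 * K"
  define B where "B = 1 + 4 * (5 * K\<^sup>2 * a + 4 * K\<^sup>2) / c"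
  define B' where "B' = a * (1 + B)"
  define C1 where "C1 = K * (1 + 2 * B' + 2 * B)"
  define C2 where "C2 = (12 * K\<^sup>2 / sqrt \<kappa>) * (K * (1 + B' + B))
     + K * (4 / \<kappa> * (5 * K\<^sup>2 + 36 * K^4 / sqrt \<kappa>) * (1 + B)) + K * B"
  have a0: "0 \<le> a" using K \<kappa> by (simp add: a_def)
  have B0: "0 \<le> B" using K c a0 by (simp add: B_def)
  have sqrt0: "((\<lambda>r::real. sqrt r) \<longlongrightarrow> 0) (at_right 0)"
    by (rule tendsto_eq_intros tendsto_ident_at | simp)+
  \<comment> \<open>With \<open>x\<close> and \<open>d\<close> replaced by their bounds
    \<open>B * r\<close> and \<open>B' * r\<close>, each quantity that has to be small vanishes with
    \<open>r\<close>, so a common threshold exists.\<close>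
  have "((\<lambda>r. 2 * K\<^sup>2 * a * sqrt r) \<longlongrightarrow> 0) (at_right 0)" "((\<lambda>r. K * (sqrt r + B * r)) \<longlongrightarrow> 0) (at_right 0)"
    "((\<lambda>r. K\<^sup>2 * (sqrt r + B * r)) \<longlongrightarrow> 0) (at_right 0)" "((\<lambda>r. B * r) \<longlongrightarrow> 0) (at_right 0)"
    "((\<lambda>r. B' * r) \<longlongrightarrow> 0) (at_right 0)"
    by (rule tendsto_eq_intros sqrt0 tendsto_ident_at | simp)+
  then have "\<forall>\<^sub>F r in at_right 0. 2 * K\<^sup>2 * a * sqrt r < c / 2 \<and> K * (sqrt r + B * r) < sqrt \<kappa> / 4 \<and>
      K\<^sup>2 * (sqrt r + B * r) < \<kappa> / 4 \<and> B * r < 1 \<and> B' * r < 1 / 2"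
    using c \<kappa> by (intro eventually_conj order_tendstoD) auto
  then obtain r0 where r0: "0 < r0" and small: "\<And>r. 0 < r \<Longrightarrow> r < r0 \<Longrightarrow> 2 * K\<^sup>2 * a * sqrt r < c / 2 \<and>
      K * (sqrt r + B * r) < sqrt \<kappa> / 4 \<and> K\<^sup>2 * (sqrt r + B * r) < \<kappa> / 4 \<and> B * r < 1 \<and> B' * r < 1 / 2"
    unfolding eventually_at_right_field by blast
  have "rms I (\<lambda>t. coef I H (\<lambda>t. L j \<bullet> G t + U t j - Q t j) \<bullet> H t - L j \<bullet> G t + Q t j) \<le> max C1 C2 * r \<and>
    (norm (G \<tau>) \<le> K \<longrightarrow> rms J (U \<tau>) \<le> K \<longrightarrow> rms J (Q \<tau>) \<le> K * x \<longrightarrow> \<bar>Q \<tau> j\<bar> \<le> K * x \<longrightarrow>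
     norm (avg J (\<lambda>j. U \<tau> j *\<^sub>R L j)) \<le> K * r \<longrightarrow>
     rms I (\<lambda>s. avg J (\<lambda>j. U \<tau> j * U s j)) \<le> K * r \<longrightarrow>
     avg J (\<lambda>j. (L j \<bullet> G \<tau> + U \<tau> j - Q \<tau> j
          - coef I H (\<lambda>t. L j \<bullet> G t + U t j - Q t j) \<bullet> H \<tau>) *\<^sub>R
          coef I H (\<lambda>t. L j \<bullet> G t + U t j - Q t j)) = 0 \<longrightarrow>
     \<bar>coef I H (\<lambda>t. L j \<bullet> G t + U t j - Q t j) \<bullet> H \<tau> - L j \<bullet> G \<tau> + Q \<tau> j\<bar> \<le> max C1 C2 * r)"
    (is "?avg \<and> ?at")
    if less: "r < r0" and fit: "factor_fit I J G H L U Q K \<kappa> c r x"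
      and unit: "rms I (\<lambda>t. U t j) \<le> K" "norm (coef I G (\<lambda>t. U t j)) \<le> K * r"
        "rms I (\<lambda>t. Q t j) \<le> K * x" "norm (L j) \<le> K"
    for I :: "'i set" and J :: "'j set" and G :: "'i \<Rightarrow> 'b" and H L U Q r x j \<tau>
  proof -
    interpret factor_fit I J G H L U Q K \<kappa> c r x by (rule fit)
    note sm = small[OF r(1) less]
    have xB: "x \<le> B * r" using x_rate sm unfolding A_def a_def[symmetric] B_def by simp
    have "d \<le> a * (r + x)" using d_rate unfolding A_def a_def .
    also have "\<dots> \<le> a * (r + B * r)" using xB a0 by (intro mult_left_mono) auto
    finally have dB: "d \<le> B' * r" by (simp add: B'_def algebra_simps)
    have "rms I (fit_error j) \<le> K * (r + 2 * d + 2 * x)"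
      by (rule rms_fit_error_le[OF unit])
    also have "\<dots> \<le> K * (r + 2 * (B' * r) + 2 * (B * r))"
      using xB dB K by (intro mult_left_mono add_mono) auto
    also have "\<dots> = C1 * r" by (simp add: C1_def algebra_simps)
    also have "\<dots> \<le> max C1 C2 * r" using r by (intro mult_right_mono) auto
    finally have avg: ?avg by (simp add: fit_error_def[abs_def])
    have at: ?at
    proof (intro impI)
      assume at: "norm (G \<tau>) \<le> K" "rms J (U \<tau>) \<le> K" "rms J (Q \<tau>) \<le> K * x" "\<bar>Q \<tau> j\<bar> \<le> K * x"
        "norm (avg J (\<lambda>j. U \<tau> j *\<^sub>R L j)) \<le> K * r"
        "rms I (\<lambda>s. avg J (\<lambda>j. U \<tau> j * U s j)) \<le> K * r"
        "avg J (\<lambda>j. (L j \<bullet> G \<tau> + U \<tau> j - Q \<tau> j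
          - coef I H (\<lambda>t. L j \<bullet> G t + U t j - Q t j) \<bullet> H \<tau>) *\<^sub>R
          coef I H (\<lambda>t. L j \<bullet> G t + U t j - Q t j)) = 0"
      have \<rho>: "\<rho> \<le> sqrt r + B * r" using xB by (simp add: \<rho>_def)
      interpret factor_fit_at I J G H L U Q K \<kappa> c r x \<tau>
      proof
        show "x \<le> 1" "d \<le> 1 / 2" using xB dB sm by linarith+
        show "K * \<rho> \<le> sqrt \<kappa> / 4" using mult_left_mono[OF \<rho>, of K] K sm by linarith
        show "K\<^sup>2 * \<rho> \<le> \<kappa> / 4" using mult_left_mono[OF \<rho>, of "K\<^sup>2"] sm by simp
      qed (use at in auto)
      have "\<bar>fit_error j \<tau>\<bar> \<le> (12 * K\<^sup>2 / sqrt \<kappa>) * (K * (r + d + x))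
          + K * (4 / \<kappa> * (5 * K\<^sup>2 + 36 * K^4 / sqrt \<kappa>) * (r + x)) + K * x"
        by (rule fit_error_at[OF unit at(4)])
      also have "\<dots> \<le> (12 * K\<^sup>2 / sqrt \<kappa>) * (K * (r + B' * r + B * r))
          + K * (4 / \<kappa> * (5 * K\<^sup>2 + 36 * K^4 / sqrt \<kappa>) * (r + B * r)) + K * (B * r)"
        using xB dB K \<kappa> by (intro add_mono mult_left_mono) auto
      also have "\<dots> = C2 * r"
        by (simp add: C2_def algebra_simps add_divide_distrib)
      also have "\<dots> \<le> max C1 C2 * r" using r by (intro mult_right_mono) auto
      finally show "\<bar>coef I H (\<lambda>t. L j \<bullet> G t + U t j - Q t j) \<bullet> H \<tau> - L j \<bullet> G \<tau> + Q \<tau> j\<bar> \<le> max C1 C2 * r"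
        by (simp add: fit_error_def)
    qed
    from avg at show ?thesis ..
  qed
  with r0 show ?thesis by blast
qed

section \<open>Diagonalization and the constrained estimator\<close>

definition orthonormal_rows :: "real ^ 'k ^ 'k \<Rightarrow> bool" where
  "orthonormal_rows P \<longleftrightarrow> (\<forall>a b. P $ a \<bullet> P $ b = (if a = b then 1 else 0))"

lemma orthonormal_rowsD: "orthonormal_rows P \<Longrightarrow> P $ a \<bullet> P $ b = (if a = b then 1 else 0)"
  by (simp add: orthonormal_rows_def)

lemma orthonormal_rows_inverse:
  assumes "orthonormal_rows P"
  shows "transpose P ** P = mat 1"
proof -
  have "P ** transpose P = mat 1"
    using assms by (simp add: vec_eq_iff matrix_matrix_mult_def transpose_def mat_def
        orthonormal_rows_def inner_vec_def)
  then show ?thesis by (simp add: matrix_left_right_inverse)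
qed

lemma orthonormal_rows_expand:
  assumes "orthonormal_rows P"
  shows "(\<Sum>a\<in>UNIV. (P $ a \<bullet> v) *\<^sub>R P $ a) = v"
proof -
  have "(\<Sum>a\<in>UNIV. (P $ a \<bullet> v) *\<^sub>R P $ a) = transpose P *v (P *v v)"
    by (simp add: vec_eq_iff matrix_vector_mult_def transpose_def inner_vec_def mult.commute)
  also have "\<dots> = v" by (simp add: matrix_vector_mul_assoc orthonormal_rows_inverse[OF assms])
  finally show ?thesis .
qed

lemma orthonormal_rows_inner:
  assumes "orthonormal_rows P"
  shows "(\<Sum>a\<in>UNIV. (P $ a \<bullet> v) * (P $ a \<bullet> w)) = v \<bullet> w"
proof -
  have "v \<bullet> w = (\<Sum>a\<in>UNIV. (P $ a \<bullet> v) *\<^sub>R P $ a) \<bullet> w"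
    by (simp add: orthonormal_rows_expand[OF assms])
  then show ?thesis by (simp add: inner_sum_left)
qed

lemma compact_orthonormal_rows: "compact {P :: real ^ 'k ^ 'k. orthonormal_rows P}"
proof -
  have "{P :: real ^ 'k ^ 'k. orthonormal_rows P} = (\<Inter>a b. {P. P $ a \<bullet> P $ b = (if a = b then 1 else 0)})"
    by (auto simp: orthonormal_rows_def)
  also have "closed \<dots>"
    by (intro closed_INT ballI closed_Collect_eq continuous_intros)
  finally have "closed {P :: real ^ 'k ^ 'k. orthonormal_rows P}" .
  moreover have "bounded {P :: real ^ 'k ^ 'k. orthonormal_rows P}"
  proof (rule boundedI[of _ "sqrt CARD('k)"])
    fix P :: "real ^ 'k ^ 'k" assume "P \<in> {P. orthonormal_rows P}"
    then have "norm (P $ a) = 1" for a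
      by (simp add: orthonormal_rows_def norm_eq_1)
    then show "norm P \<le> sqrt CARD('k)"
      by (simp add: norm_vec_def L2_set_def)
  qed
  ultimately show ?thesis by (simp add: compact_eq_bounded_closed)
qed

text \<open>Maximize \<open>\<Sum>\<^sub>a w\<^sub>a e\<^sub>a'Ae\<^sub>a\<close> with distinct weights over orthonormal bases; rotating \<open>e\<^sub>a, e\<^sub>b\<close> shows
  that \<open>e\<^sub>a'Ae\<^sub>b = 0\<close> at a maximum.\<close>

lemma symmetric_diagonalizable:
  fixes A :: "real ^ 'k ^ 'k"
  assumes sym: "transpose A = A"
  obtains P where "orthonormal_rows P" "\<And>a b. a \<noteq> b \<Longrightarrow> P $ a \<bullet> (A *v P $ b) = 0"
proof -
  obtain w :: "'k \<Rightarrow> nat" where w: "inj w"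
    using finite_imp_inj_to_nat_seg[of "UNIV :: 'k set"] by auto
  define f where "f = (\<lambda>P :: real ^ 'k ^ 'k. \<Sum>a\<in>UNIV. real (w a) * (P $ a \<bullet> (A *v P $ a)))"
  have "orthonormal_rows (mat 1 :: real ^ 'k ^ 'k)"
    by (simp add: orthonormal_rows_def inner_vec_def mat_def if_distrib[of "\<lambda>x. x * _"] cong: if_cong)
  then have ne: "{P :: real ^ 'k ^ 'k. orthonormal_rows P} \<noteq> {}" by blast
  have cont: "continuous_on {P :: real ^ 'k ^ 'k. orthonormal_rows P} f"
    unfolding f_def matrix_vector_mult_def inner_vec_def by (simp, intro continuous_intros)
  obtain P where P: "orthonormal_rows P" and max: "\<And>P'. orthonormal_rows P' \<Longrightarrow> f P' \<le> f P"
    using continuous_attains_sup[OF compact_orthonormal_rows ne cont] by auto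
  have symA: "x \<bullet> (A *v y) = y \<bullet> (A *v x)" for x y
  proof -
    have "x \<bullet> (A *v y) = (transpose A *v x) \<bullet> y"
      unfolding transpose_matrix_vector dot_lmul_matrix ..
    then show ?thesis unfolding sym by (simp only: inner_commute)
  qed
  have "P $ a \<bullet> (A *v P $ b) = 0" if ab: "a \<noteq> b" for a b
  proof -
    define B where "B = (\<lambda>i j. P $ i \<bullet> (A *v P $ j))"
    define \<Delta> where "\<Delta> = real (w a) - real (w b)"
    have \<Delta>: "\<Delta> \<noteq> 0" using w ab by (auto simp: \<Delta>_def inj_def)
    have B_sym: "B b a = B a b" by (simp add: B_def symA)
    \<comment> \<open>\<open>s\<close> is the tangent of the rotation angle, \<open>c\<close> and
      \<open>\<sigma>\<close> are its cosine and sine. Dividing the gain by \<open>c * c\<close>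
      makes it polynomial in \<open>s\<close>.\<close>
    have "\<Delta> * (B b b - B a a) * s\<^sup>2 + 2 * (\<Delta> * B a b) * s \<le> 0" for s
    proof -
      define c where "c = 1 / sqrt (1 + s\<^sup>2)"
      define \<sigma> where "\<sigma> = s * c"
      have pos: "0 < 1 + s\<^sup>2" by (simp add: add_pos_nonneg)
      then have c: "0 < c" "c * c * (1 + s\<^sup>2) = 1" by (simp_all add: c_def)
      then have cs: "c * c + \<sigma> * \<sigma> = 1" by (simp add: \<sigma>_def power2_eq_square algebra_simps)
      define P' where "P' = (\<chi> i. if i = a then c *\<^sub>R P $ a + \<sigma> *\<^sub>R P $ b
          else if i = b then c *\<^sub>R P $ b - \<sigma> *\<^sub>R P $ a else P $ i)"
      have a: "P' $ a = c *\<^sub>R P $ a + \<sigma> *\<^sub>R P $ b" by (simp add: P'_def)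
      have b: "P' $ b = c *\<^sub>R P $ b - \<sigma> *\<^sub>R P $ a" using ab by (simp add: P'_def)
      have other: "P' $ i = P $ i" if "i \<noteq> a" "i \<noteq> b" for i using that by (simp add: P'_def)
      note inner = inner_add_left inner_add_right inner_diff_left inner_diff_right
        orthonormal_rowsD[OF P]
      have "P' $ i \<bullet> P' $ j = (if i = j then 1 else 0)" for i j
      proof -
        consider "i = a" "j = a" | "i = a" "j = b" | "i = b" "j = a" | "i = b" "j = b"
          | "i = a" "j \<noteq> a" "j \<noteq> b" | "i = b" "j \<noteq> a" "j \<noteq> b"
          | "j = a" "i \<noteq> a" "i \<noteq> b" | "j = b" "i \<noteq> a" "i \<noteq> b"
          | "i \<noteq> a" "i \<noteq> b" "j \<noteq> a" "j \<noteq> b" by blast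
        then show ?thesis
          by cases (use ab cs in \<open>simp_all add: a b other inner\<close>)
      qed
      then have "orthonormal_rows P'" by (simp add: orthonormal_rows_def)
      from max[OF this] have le: "f P' \<le> f P" .
      have rest: "(\<Sum>i\<in>UNIV - {a} - {b}. real (w i) * (P' $ i \<bullet> (A *v P' $ i)))
          = (\<Sum>i\<in>UNIV - {a} - {b}. real (w i) * (P $ i \<bullet> (A *v P $ i)))"
        by (rule sum.cong) (auto simp: other)
      have split: "f R = real (w a) * (R $ a \<bullet> (A *v R $ a)) + (real (w b) * (R $ b \<bullet> (A *v R $ b))
          + (\<Sum>i\<in>UNIV - {a} - {b}. real (w i) * (R $ i \<bullet> (A *v R $ i))))" for R
        using ab sum.remove[of UNIV a "\<lambda>i. real (w i) * (R $ i \<bullet> (A *v R $ i))"]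
          sum.remove[of "UNIV - {a}" b "\<lambda>i. real (w i) * (R $ i \<bullet> (A *v R $ i))"]
        by (simp add: f_def)
      have Aa: "P' $ a \<bullet> (A *v P' $ a) = c * c * B a a + 2 * (c * \<sigma>) * B a b + \<sigma> * \<sigma> * B b b"
        unfolding a by (simp add: matrix_vector_right_distrib matrix_vector_mult_scaleR
            inner_add_left inner_add_right B_def symA[of "P $ b" "P $ a"] algebra_simps)
      have Ab: "P' $ b \<bullet> (A *v P' $ b) = c * c * B b b - 2 * (c * \<sigma>) * B a b + \<sigma> * \<sigma> * B a a"
        unfolding b by (simp add: matrix_vector_mult_diff_distrib matrix_vector_mult_scaleR
            inner_diff_left inner_diff_right B_def symA[of "P $ b" "P $ a"] algebra_simps)
      have cc: "c * c = 1 - \<sigma> * \<sigma>" using cs by simp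
      have "real (w a) * (P' $ a \<bullet> (A *v P' $ a)) + real (w b) * (P' $ b \<bullet> (A *v P' $ b))
          \<le> real (w a) * B a a + real (w b) * B b b"
        using le unfolding split[of P'] split[of P] rest B_def by simp
      then have "\<Delta> * (B b b - B a a) * (\<sigma> * \<sigma>) + 2 * (\<Delta> * B a b) * (c * \<sigma>) \<le> 0"
        unfolding Aa Ab cc \<Delta>_def by (simp add: algebra_simps)
      then have "(c * c) * (\<Delta> * (B b b - B a a) * s\<^sup>2 + 2 * (\<Delta> * B a b) * s) \<le> 0"
        unfolding \<sigma>_def by (simp add: algebra_simps power2_eq_square)
      moreover have "0 < c * c" using c by simp
      ultimately show ?thesis by (meson mult_pos_pos not_le)
    qed
    then have "\<Delta> * B a b = 0" by (rule quadratic_nonpos_imp_zero)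
    then show ?thesis using \<Delta> by (simp add: B_def)
  qed
  with P show ?thesis by (rule that)
qed

lemma norm_vec_power2: "(norm (v :: real ^ 'k))\<^sup>2 = (\<Sum>a\<in>UNIV. (v $ a)\<^sup>2)"
  unfolding power2_norm_eq_inner inner_vec_def by (simp add: power2_eq_square)

text \<open>In an eigenbasis of \<open>S\<close> with eigenvalues \<open>\<mu> a\<close>,
  \<open>B\<close> scales by \<open>\<mu>^(-1/2)\<close> and \<open>B'\<close> by
  \<open>\<mu>^(1/2)\<close>; \<open>Bt\<close> and \<open>Bt'\<close> are their transposes. If
  \<open>S\<close> is the second moment matrix of the factors, \<open>B\<close> makes them
  orthonormal, and \<open>B'\<close> on the loadings preserves the common component. The last three
  properties bound the distortion by eigenvalue bounds on \<open>S\<close>.\<close>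

lemma whitening:
  fixes S :: "real ^ 'k ^ 'k"
  assumes sym: "transpose S = S" and pos: "\<And>v. v \<noteq> 0 \<Longrightarrow> 0 < v \<bullet> (S *v v)"
  obtains B B' Bt Bt' :: "real ^ 'k \<Rightarrow> real ^ 'k"
  where "linear B" "linear B'"
    "\<And>v w. B v \<bullet> w = v \<bullet> Bt w" "\<And>v w. B' v \<bullet> w = v \<bullet> Bt' w" "\<And>v w. B' v \<bullet> B w = v \<bullet> w"
    "\<And>v. B (S *v Bt v) = v"
    "\<And>\<kappa> v. 0 < \<kappa> \<Longrightarrow> (\<And>v. \<kappa> * (norm v)\<^sup>2 \<le> v \<bullet> (S *v v)) \<Longrightarrow> norm (B v) \<le> norm v / sqrt \<kappa>"
    "\<And>\<kappa> v. 0 < \<kappa> \<Longrightarrow> (\<And>v. \<kappa> * (norm v)\<^sup>2 \<le> v \<bullet> (S *v v)) \<Longrightarrow> sqrt \<kappa> * norm v \<le> norm (Bt' v)"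
    "\<And>K v. 0 < K \<Longrightarrow> (\<And>v. v \<bullet> (S *v v) \<le> K * (norm v)\<^sup>2) \<Longrightarrow> norm (B' v) \<le> sqrt K * norm v"
proof -
  obtain P where P: "orthonormal_rows P" and diag: "\<And>a b. a \<noteq> b \<Longrightarrow> P $ a \<bullet> (S *v P $ b) = 0"
    using symmetric_diagonalizable[OF sym] by blast
  define \<mu> where "\<mu> = (\<lambda>a. P $ a \<bullet> (S *v P $ a))"
  have P_norm: "norm (P $ a) = 1" for a by (simp add: norm_eq_1 orthonormal_rowsD[OF P])
  have \<mu>: "0 < \<mu> a" for a
    unfolding \<mu>_def using P_norm[of a] by (intro pos) auto
  have SP: "P $ a \<bullet> (S *v P $ b) = (if a = b then \<mu> a else 0)" for a b
    using diag by (simp add: \<mu>_def)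
  define comb where "comb = (\<lambda>c :: 'k \<Rightarrow> real. \<Sum>a\<in>UNIV. c a *\<^sub>R P $ a)"
  have comb_inner: "P $ a \<bullet> comb c = c a" for a c
    by (simp add: comb_def inner_sum_right orthonormal_rowsD[OF P] if_distrib[of "\<lambda>x. _ * x"] cong: if_cong)
  have comb_norm: "(norm (comb c))\<^sup>2 = (\<Sum>a\<in>UNIV. (c a)\<^sup>2)" for c
    using orthonormal_rows_inner[OF P, of "comb c" "comb c"]
    by (simp add: comb_inner power2_norm_eq_inner power2_eq_square[of "c _"])
  have inner_S_comb: "P $ a \<bullet> (S *v comb c) = c a * \<mu> a" for a c
    by (simp add: comb_def linear_sum[OF matrix_vector_mul_linear] matrix_vector_mult_scaleR inner_sum_right SP
        if_distrib[of "\<lambda>x. _ * x"] cong: if_cong)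
  define B where "B = (\<lambda>v. \<chi> a. (P $ a \<bullet> v) / sqrt (\<mu> a))"
  define B' where "B' = (\<lambda>v. \<chi> a. sqrt (\<mu> a) * (P $ a \<bullet> v))"
  define Bt where "Bt = (\<lambda>w. comb (\<lambda>a. w $ a / sqrt (\<mu> a)))"
  define Bt' where "Bt' = (\<lambda>w. comb (\<lambda>a. sqrt (\<mu> a) * w $ a))"
  show ?thesis
  proof (rule that[of B B' Bt Bt'])
    show "linear B" unfolding B_def
      by (rule linearI) (simp_all add: vec_eq_iff inner_add_right add_divide_distrib)
    show "linear B'" unfolding B'_def
      by (rule linearI) (simp_all add: vec_eq_iff inner_add_right algebra_simps)
    show "B v \<bullet> w = v \<bullet> Bt w" for v w
      by (simp add: B_def Bt_def comb_def inner_sum_right inner_vec_def[of _ w] inner_commute[of v] mult.commute)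
    show "B' v \<bullet> w = v \<bullet> Bt' w" for v w
      by (simp add: B'_def Bt'_def comb_def inner_sum_right inner_vec_def[of _ w] inner_commute[of v] mult_ac)
    have "sqrt (\<mu> a) \<noteq> 0" for a using \<mu>[of a] by simp
    then have "B' v \<bullet> B w = (\<Sum>a\<in>UNIV. (P $ a \<bullet> v) * (P $ a \<bullet> w))" for v w
      unfolding B_def B'_def inner_vec_def by simp
    then show "B' v \<bullet> B w = v \<bullet> w" for v w by (simp add: orthonormal_rows_inner[OF P])
    show "B (S *v Bt v) = v" for v
      using \<mu> by (simp add: B_def Bt_def inner_S_comb vec_eq_iff less_imp_le less_imp_neq[THEN not_sym])
    have normP: "(norm v)\<^sup>2 = (\<Sum>a\<in>UNIV. (P $ a \<bullet> v)\<^sup>2)" for v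
      using orthonormal_rows_inner[OF P, of v v] by (simp add: power2_norm_eq_inner power2_eq_square[of "_ \<bullet> _"])
    show "norm (B v) \<le> norm v / sqrt \<kappa>"
      if \<kappa>: "0 < \<kappa>" and le: "\<And>v. \<kappa> * (norm v)\<^sup>2 \<le> v \<bullet> (S *v v)" for \<kappa> v
    proof (rule power2_le_imp_le)
      have \<mu>\<kappa>: "\<kappa> \<le> \<mu> a" for a using le[of "P $ a"] by (simp add: P_norm \<mu>_def)
      have "(norm (B v))\<^sup>2 = (\<Sum>a\<in>UNIV. (P $ a \<bullet> v)\<^sup>2 / \<mu> a)"
        using \<mu> by (simp add: norm_vec_power2 B_def power_divide less_imp_le)
      also have "\<dots> \<le> (\<Sum>a\<in>UNIV. (P $ a \<bullet> v)\<^sup>2 / \<kappa>)"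
        using \<mu>\<kappa> \<kappa> by (intro sum_mono divide_left_mono) (auto intro: mult_pos_pos \<mu>)
      finally show "(norm (B v))\<^sup>2 \<le> (norm v / sqrt \<kappa>)\<^sup>2"
        using \<kappa> by (simp add: power_divide normP sum_divide_distrib)
    qed (use \<kappa> in simp)
    show "sqrt \<kappa> * norm v \<le> norm (Bt' v)"
      if \<kappa>: "0 < \<kappa>" and le: "\<And>v. \<kappa> * (norm v)\<^sup>2 \<le> v \<bullet> (S *v v)" for \<kappa> v
    proof (rule power2_le_imp_le)
      have \<mu>\<kappa>: "\<kappa> \<le> \<mu> a" for a using le[of "P $ a"] by (simp add: P_norm \<mu>_def)
      have "(sqrt \<kappa> * norm v)\<^sup>2 = (\<Sum>a\<in>UNIV. \<kappa> * (v $ a)\<^sup>2)"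
        using \<kappa> by (simp add: power_mult_distrib norm_vec_power2 sum_distrib_left)
      also have "\<dots> \<le> (\<Sum>a\<in>UNIV. \<mu> a * (v $ a)\<^sup>2)"
        by (intro sum_mono mult_right_mono \<mu>\<kappa>) simp
      finally show "(sqrt \<kappa> * norm v)\<^sup>2 \<le> (norm (Bt' v))\<^sup>2"
        using \<mu> by (simp add: Bt'_def comb_norm power_mult_distrib less_imp_le)
    qed simp
    show "norm (B' v) \<le> sqrt K * norm v"
      if K: "0 < K" and le: "\<And>v. v \<bullet> (S *v v) \<le> K * (norm v)\<^sup>2" for K v
    proof (rule power2_le_imp_le)
      have \<mu>K: "\<mu> a \<le> K" for a using le[of "P $ a"] by (simp add: P_norm \<mu>_def)
      have "(norm (B' v))\<^sup>2 = (\<Sum>a\<in>UNIV. \<mu> a * (P $ a \<bullet> v)\<^sup>2)"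
        using \<mu> by (simp add: norm_vec_power2 B'_def power_mult_distrib less_imp_le)
      also have "\<dots> \<le> (\<Sum>a\<in>UNIV. K * (P $ a \<bullet> v)\<^sup>2)"
        by (intro sum_mono mult_right_mono \<mu>K) simp
      finally show "(norm (B' v))\<^sup>2 \<le> (sqrt K * norm v)\<^sup>2"
        using K by (simp add: power_mult_distrib normP sum_distrib_left)
    qed (use K in simp)
  qed
qed

section \<open>Matrix products in terms of averages\<close>

lemma outer_mult: "outer x y *v v = (y \<bullet> v) *\<^sub>R x"
  by (simp add: outer_def vec_eq_iff matrix_vector_mult_def inner_vec_def sum_distrib_left sum_distrib_right mult_ac)

lemma sum_matrix_vector_mult: "(\<Sum>i\<in>I. A i) *v v = (\<Sum>i\<in>I. A i *v v)" for A :: "_ \<Rightarrow> real ^ 'n ^ 'm"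
  by (induction I rule: infinite_finite_induct) (simp_all add: matrix_vector_mult_add_rdistrib)

lemma tmul_mult: "((1 / real m) *\<^sub>R tmul m A B) *v v = avg {1..m} (\<lambda>i. (B i \<bullet> v) *\<^sub>R A i)"
  by (simp add: tmul_def avg_def scaleR_matrix_vector_assoc[symmetric] sum_matrix_vector_mult outer_mult)

lemma tmul_component: "tmul m A B $ a $ b = (\<Sum>i=1..m. A i $ a * B i $ b)"
  by (simp add: tmul_def outer_def)

lemma transpose_tmul: "transpose (tmul m A A) = tmul m A A"
  by (simp add: transpose_def tmul_component vec_eq_iff mult.commute)

lemma transpose_scaleR: "transpose (c *\<^sub>R A) = c *\<^sub>R transpose A" for A :: "real ^ 'n ^ 'm"
  by (simp add: transpose_def vec_eq_iff)

lemma tmul_quadratic: "v \<bullet> (((1 / real m) *\<^sub>R tmul m A A) *v v) = avg {1..m} (\<lambda>i. (A i \<bullet> v)\<^sup>2)"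
  by (simp add: tmul_mult avg_inner_right[symmetric] power2_eq_square inner_commute)

lemma normalized_iff: "normalized m G \<longleftrightarrow> orthonormal {1..m} G"
  by (simp add: normalized_def matrix_eq tmul_mult orthonormal_def)

definition loss :: "nat \<Rightarrow> nat \<Rightarrow> (nat \<Rightarrow> nat \<Rightarrow> real) \<Rightarrow> (nat \<Rightarrow> nat \<Rightarrow> real ^ 'p) \<Rightarrow>
    (nat \<Rightarrow> real ^ 'k) \<Rightarrow> (nat \<Rightarrow> real ^ 'k) \<Rightarrow> real ^ 'p \<Rightarrow> real" where
  "loss N T Y X G L b = avg {1..N} (\<lambda>j. avg {1..T} (\<lambda>t. (Y j t - X j t \<bullet> b - L j \<bullet> G t)\<^sup>2))"

lemma loss_cong: "(\<And>j t. L j \<bullet> G t = L' j \<bullet> G' t) \<Longrightarrow> loss N T Y X G L b = loss N T Y X G' L' b"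
  by (simp add: loss_def)

section \<open>Consequences of minimality for the estimator\<close>

context
  fixes N T :: nat and Y and X :: "nat \<Rightarrow> nat \<Rightarrow> real ^ 'p" and Fh Lh :: "nat \<Rightarrow> real ^ 'k" and bh
  assumes opt: "is_least_squares N T Y X Fh Lh bh" and N: "1 \<le> N" and T: "1 \<le> T"
begin

lemma orthonormal_Fh: "orthonormal {1..T} Fh"
  using opt by (auto simp: is_least_squares_def is_arg_min_def normalized_iff)

lemma loss_le_diagonal:
  fixes G L :: "nat \<Rightarrow> real ^ 'k"
  assumes "orthonormal {1..T} G" "diagonal_matrix (tmul N L L)"
  shows "loss N T Y X Fh Lh bh \<le> loss N T Y X G L b"
proof -
  have eq: "loss N T Y X G L b = (\<Sum>t=1..T. \<Sum>j=1..N. (Y j t - ife_mean (L j) (G t) (X j t) b)\<^sup>2) / (real N * real T)" for G L b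
    unfolding loss_def avg_def
    by (subst sum.swap) (simp add: ife_mean_def sum_divide_distrib[symmetric] algebra_simps)
  have "\<forall>(G :: nat \<Rightarrow> real ^ 'k) (L :: nat \<Rightarrow> real ^ 'k) b. orthonormal {1..T} G \<longrightarrow> diagonal_matrix (tmul N L L) \<longrightarrow>
      (\<Sum>t=1..T. \<Sum>j=1..N. (Y j t - ife_mean (Lh j) (Fh t) (X j t) bh)\<^sup>2)
      \<le> (\<Sum>t=1..T. \<Sum>j=1..N. (Y j t - ife_mean (L j) (G t) (X j t) b)\<^sup>2)"
    using opt unfolding is_least_squares_def is_arg_min_def normalized_iff
    by (simp add: not_less)
  from this[rule_format, OF assms] show ?thesis unfolding eq by (simp add: divide_right_mono)
qed

text \<open>The diagonality constraint costs nothing: rotating factors and loadings into an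
  eigenbasis of \<open>tmul N L L\<close> diagonalizes it and preserves the normalization and all
  products of factors with loadings.\<close>

lemma loss_le:
  fixes G L :: "nat \<Rightarrow> real ^ 'k"
  assumes G: "orthonormal {1..T} G"
  shows "loss N T Y X Fh Lh bh \<le> loss N T Y X G L b"
proof -
  obtain P where P: "orthonormal_rows P"
    and diag: "\<And>a b. a \<noteq> b \<Longrightarrow> P $ a \<bullet> (((1 / real N) *\<^sub>R tmul N L L) *v P $ b) = 0"
    using symmetric_diagonalizable[of "(1 / real N) *\<^sub>R tmul N L L"]
    by (auto simp: transpose_scaleR transpose_tmul)
  define rot where "rot = (\<lambda>v. P *v v)"
  have rot: "rot v \<bullet> rot w = v \<bullet> w" for v w
    using orthonormal_rows_inner[OF P, of v w]
    by (simp add: rot_def inner_vec_def[of "_ *v _"] matrix_vector_mul_component)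
  have adj: "rot v \<bullet> w = v \<bullet> (transpose P *v w)" for v w
    unfolding rot_def by (metis dot_lmul_matrix inner_commute transpose_matrix_vector)
  have inv: "rot (transpose P *v v) = v" for v
  proof -
    have "P ** transpose P = mat 1"
      using orthonormal_rows_inverse[OF P] by (simp add: matrix_left_right_inverse)
    then show ?thesis unfolding rot_def matrix_vector_mul_assoc by simp
  qed
  have "orthonormal {1..T} (\<lambda>t. rot (G t))"
    unfolding orthonormal_def
  proof
    fix v
    have "avg {1..T} (\<lambda>t. (rot (G t) \<bullet> v) *\<^sub>R rot (G t)) = rot (avg {1..T} (\<lambda>t. (G t \<bullet> (transpose P *v v)) *\<^sub>R G t))"
      unfolding adj unfolding rot_def avg_def
      by (simp add: matrix_vector_mult_scaleR linear_sum[OF matrix_vector_mul_linear])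
    then show "avg {1..T} (\<lambda>t. (rot (G t) \<bullet> v) *\<^sub>R rot (G t)) = v"
      by (simp only: inv G[unfolded orthonormal_def, rule_format])
  qed
  moreover have "diagonal_matrix (tmul N (\<lambda>j. rot (L j)) (\<lambda>j. rot (L j)))"
    unfolding diagonal_matrix_def
  proof (intro allI impI)
    fix a b :: 'k assume ab: "a \<noteq> b"
    have "(\<Sum>j=1..N. rot (L j) $ a * rot (L j) $ b) = (\<Sum>j=1..N. (P $ a \<bullet> L j) * (P $ b \<bullet> L j))"
      by (simp add: rot_def matrix_vector_mul_component)
    also have "\<dots> = real N * (P $ a \<bullet> (((1 / real N) *\<^sub>R tmul N L L) *v P $ b))"
      using N unfolding tmul_mult by (simp add: avg_def inner_sum_right inner_commute mult.commute)
    finally show "tmul N (\<lambda>j. rot (L j)) (\<lambda>j. rot (L j)) $ a $ b = 0"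
      using diag[OF ab] by (simp add: tmul_component)
  qed
  ultimately have "loss N T Y X Fh Lh bh \<le> loss N T Y X (\<lambda>t. rot (G t)) (\<lambda>j. rot (L j)) b"
    by (rule loss_le_diagonal)
  also have "\<dots> = loss N T Y X G L b" by (rule loss_cong) (simp add: rot)
  finally show ?thesis .
qed

text \<open>The normalization is removed by whitening. This is needed to vary a single row of the
  factors, which may destroy orthonormality but not full rank.\<close>

lemma loss_le_full_rank:
  fixes G L :: "nat \<Rightarrow> real ^ 'k"
  assumes G: "\<And>v. v \<noteq> 0 \<Longrightarrow> 0 < avg {1..T} (\<lambda>t. (G t \<bullet> v)\<^sup>2)"
  shows "loss N T Y X Fh Lh bh \<le> loss N T Y X G L b"
proof -
  define S where "S = (1 / real T) *\<^sub>R tmul T G G"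
  have sym: "transpose S = S" by (simp add: S_def transpose_scaleR transpose_tmul)
  have pos: "0 < v \<bullet> (S *v v)" if "v \<noteq> 0" for v using G[OF that] by (simp only: S_def tmul_quadratic)
  obtain B B' Bt :: "real ^ 'k \<Rightarrow> real ^ 'k" where B: "linear B" "\<And>v w. B v \<bullet> w = v \<bullet> Bt w" "\<And>v w. B' v \<bullet> B w = v \<bullet> w"
    "\<And>v. B (S *v Bt v) = v"
    apply (rule whitening[OF sym pos])
     apply assumption
    subgoal premises p for B B' Bt Bt' by (rule that[OF p(2,4,6,7)])
    done
  have "orthonormal {1..T} (\<lambda>t. B (G t))"
    unfolding orthonormal_def
  proof
    fix v
    have "avg {1..T} (\<lambda>t. (B (G t) \<bullet> v) *\<^sub>R B (G t)) = B (avg {1..T} (\<lambda>t. (G t \<bullet> Bt v) *\<^sub>R G t))"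
      by (simp add: avg_def B(2) linear_sum[OF B(1)] linear_scale[OF B(1)])
    also have "\<dots> = B (S *v Bt v)" by (simp only: S_def tmul_mult)
    finally show "avg {1..T} (\<lambda>t. (B (G t) \<bullet> v) *\<^sub>R B (G t)) = v" by (simp only: B(4))
  qed
  then have "loss N T Y X Fh Lh bh \<le> loss N T Y X (\<lambda>t. B (G t)) (\<lambda>j. B' (L j)) b"
    by (rule loss_le)
  also have "\<dots> = loss N T Y X G L b" by (rule loss_cong) (simp add: B(3))
  finally show ?thesis .
qed

abbreviation "net b j \<equiv> \<lambda>t. Y j t - X j t \<bullet> b"

lemma loss_profile:
  assumes "orthonormal {1..T} G"
  shows "loss N T Y X G L b = avg {1..N} (\<lambda>j. avg {1..T} (\<lambda>t. (net b j t)\<^sup>2) - (norm (coef {1..T} G (net b j)))\<^sup>2)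
     + avg {1..N} (\<lambda>j. (norm (L j - coef {1..T} G (net b j)))\<^sup>2)"
  unfolding loss_def least_squares_decomp[OF assms] avg_add ..

lemma Lh_eq_coef:
  assumes j: "j \<in> {1..N}"
  shows "Lh j = coef {1..T} Fh (net bh j)"
proof -
  have "loss N T Y X Fh Lh bh \<le> loss N T Y X Fh (\<lambda>j. coef {1..T} Fh (net bh j)) bh"
    by (rule loss_le[OF orthonormal_Fh])
  then have "avg {1..N} (\<lambda>j. (norm (Lh j - coef {1..T} Fh (net bh j)))\<^sup>2) \<le> 0"
    by (simp add: loss_profile[OF orthonormal_Fh])
  then have "(\<Sum>j=1..N. (norm (Lh j - coef {1..T} Fh (net bh j)))\<^sup>2) \<le> 0"
    using N by (simp add: avg_def divide_le_0_iff)
  then have "(\<Sum>j=1..N. (norm (Lh j - coef {1..T} Fh (net bh j)))\<^sup>2) = 0"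
    by (intro antisym sum_nonneg) auto
  then show ?thesis using j by (simp add: sum_nonneg_eq_0_iff)
qed

text \<open>With \<open>b = bh\<close> this becomes the comparison at the estimated slope, and with
  \<open>b\<close> the true slope the comparison with the truth.\<close>

lemma profile_le:
  fixes G :: "nat \<Rightarrow> real ^ 'k"
  assumes G: "orthonormal {1..T} G"
  shows "avg {1..N} (\<lambda>j. avg {1..T} (\<lambda>t. (net bh j t)\<^sup>2) - (norm (coef {1..T} Fh (net bh j)))\<^sup>2)
     \<le> avg {1..N} (\<lambda>j. avg {1..T} (\<lambda>t. (net b j t)\<^sup>2) - (norm (coef {1..T} G (net b j)))\<^sup>2)"
proof -
  have "0 \<le> avg {1..N} (\<lambda>j. (norm (Lh j - coef {1..T} Fh (net bh j)))\<^sup>2)" by (rule avg_nonneg) simp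
  with loss_le[OF G, of "\<lambda>j. coef {1..T} G (net b j)" b] show ?thesis
    by (simp add: loss_profile[OF G] loss_profile[OF orthonormal_Fh])
qed

text \<open>If the descent direction \<open>z\<close> for row \<open>\<tau>\<close> were nonzero,
  adding a small multiple \<open>s *\<^sub>R z\<close> to that row would lower the loss, which
  changes by \<open>(s\<^sup>2 * m - 2 * s * (z \<bullet> z)) / real T\<close>. The competitor need
  not be normalized, so the contradiction comes from \<open>loss_le_full_rank\<close>.\<close>

lemma first_order_condition:
  assumes \<tau>: "\<tau> \<in> {1..T}"
  shows "avg {1..N} (\<lambda>j. (net bh j \<tau> - Lh j \<bullet> Fh \<tau>) *\<^sub>R Lh j) = 0"
proof (rule ccontr)
  define z where "z = avg {1..N} (\<lambda>j. (net bh j \<tau> - Lh j \<bullet> Fh \<tau>) *\<^sub>R Lh j)"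
  define m where "m = avg {1..N} (\<lambda>j. (Lh j \<bullet> z)\<^sup>2)"
  assume "avg {1..N} (\<lambda>j. (net bh j \<tau> - Lh j \<bullet> Fh \<tau>) *\<^sub>R Lh j) \<noteq> 0"
  then have z: "0 < (norm z)\<^sup>2" by (simp add: z_def)
  have m: "0 \<le> m" by (simp add: m_def avg_nonneg)
  have step: "2 * (norm z)\<^sup>2 \<le> s * m" if s: "0 < s" "2 * s * (norm (Fh \<tau>) * norm z) < 1" for s
  proof -
    define G where "G = (\<lambda>t. if t = \<tau> then Fh \<tau> + s *\<^sub>R z else Fh t)"
    have split: "avg {1..T} f = (f \<tau> + sum f ({1..T} - {\<tau>})) / real T" for f :: "nat \<Rightarrow> real"
      using \<tau> unfolding avg_def by (subst sum.remove[of _ \<tau>]) simp_all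
    have cancel: "real T * (a / real T) = a" for a using T by simp
    have same: "sum (\<lambda>t. f t (G t)) ({1..T} - {\<tau>}) = sum (\<lambda>t. f t (Fh t)) ({1..T} - {\<tau>})"
      for f :: "nat \<Rightarrow> real ^ 'k \<Rightarrow> real"
      by (rule sum.cong) (auto simp: G_def)
    \<comment> \<open>Full rank survives the move: the form of \<open>Fh\<close> is
      \<open>real T * (norm v)\<^sup>2\<close>, and the bound on \<open>s\<close> keeps the cross
      term below \<open>(norm v)\<^sup>2\<close>.\<close>
    have "0 < avg {1..T} (\<lambda>t. (G t \<bullet> v)\<^sup>2)" if v: "v \<noteq> 0" for v
    proof -
      have sm: "0 < (1 - 2 * s * (norm (Fh \<tau>) * norm z)) * (norm v)\<^sup>2" using s v by simp
      have "\<bar>(Fh \<tau> \<bullet> v) * (z \<bullet> v)\<bar> \<le> (norm (Fh \<tau>) * norm v) * (norm z * norm v)"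
        unfolding abs_mult by (intro mult_mono Cauchy_Schwarz_ineq2) auto
      then have "2 * s * - ((Fh \<tau> \<bullet> v) * (z \<bullet> v)) \<le> 2 * s * ((norm (Fh \<tau>) * norm v) * (norm z * norm v))"
        using s by (intro mult_left_mono) auto
      also have "\<dots> < (norm v)\<^sup>2"
        using sm by (simp add: algebra_simps power2_eq_square)
      also have "\<dots> \<le> real T * (norm v)\<^sup>2" using T mult_right_mono[of 1 "real T" "(norm v)\<^sup>2"] by simp
      finally have "0 < real T * (norm v)\<^sup>2 + 2 * s * ((Fh \<tau> \<bullet> v) * (z \<bullet> v)) + (s * (z \<bullet> v))\<^sup>2"
        by (simp add: add_pos_nonneg)
      also have "real T * (norm v)\<^sup>2 = real T * avg {1..T} (\<lambda>t. (Fh t \<bullet> v)\<^sup>2)"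
        using orthonormal_inner[OF orthonormal_Fh, of v v]
        by (simp add: power2_eq_square[of "_ \<bullet> _"] power2_norm_eq_inner)
      also have "\<dots> + 2 * s * ((Fh \<tau> \<bullet> v) * (z \<bullet> v)) + (s * (z \<bullet> v))\<^sup>2 = real T * avg {1..T} (\<lambda>t. (G t \<bullet> v)\<^sup>2)"
        unfolding split same[of "\<lambda>t g. (g \<bullet> v)\<^sup>2"] cancel
        by (simp add: G_def inner_add_left power2_eq_square algebra_simps)
      finally show ?thesis using T by (simp add: zero_less_mult_iff)
    qed
    then have le: "loss N T Y X Fh Lh bh \<le> loss N T Y X G Lh bh" by (rule loss_le_full_rank)
    have at: "avg {1..T} (\<lambda>t. (net bh j t - Lh j \<bullet> G t)\<^sup>2) = avg {1..T} (\<lambda>t. (net bh j t - Lh j \<bullet> Fh t)\<^sup>2)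
        + (s\<^sup>2 * (Lh j \<bullet> z)\<^sup>2 - 2 * s * ((net bh j \<tau> - Lh j \<bullet> Fh \<tau>) * (Lh j \<bullet> z))) / real T" for j
      unfolding split same[of "\<lambda>t g. (net bh j t - Lh j \<bullet> g)\<^sup>2"]
      by (simp add: G_def inner_add_right power2_eq_square algebra_simps add_divide_distrib diff_divide_distrib)
    have "loss N T Y X G Lh bh = loss N T Y X Fh Lh bh + (s\<^sup>2 * m - 2 * s * (z \<bullet> z)) / real T"
      unfolding loss_def at unfolding m_def
      by (simp add: avg_add avg_diff avg_divide avg_mult_left z_def[symmetric])
        (simp add: z_def[symmetric] avg_inner_left[symmetric] z_def)
    with le have "0 \<le> (s\<^sup>2 * m - 2 * s * (z \<bullet> z)) / real T" by simp
    then have "s * (2 * (norm z)\<^sup>2) \<le> s * (s * m)"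
      using T by (simp add: zero_le_divide_iff power2_eq_square[of s] power2_norm_eq_inner mult_ac)
    then show ?thesis using s by simp
  qed
  \<comment> \<open>The first bound preserves full rank; the second gives
    \<open>s * m \<le> (norm z)\<^sup>2\<close>, against
    \<open>2 * (norm z)\<^sup>2 \<le> s * m\<close> from \<open>step\<close>.\<close>
  define s where "s = min (1 / (4 * (1 + norm (Fh \<tau>) * norm z))) ((norm z)\<^sup>2 / (1 + m))"
  have pos: "0 < 1 + norm (Fh \<tau>) * norm z" by (simp add: add_pos_nonneg)
  have s0: "0 < s" using z m pos by (simp add: s_def)
  have "2 * s * (norm (Fh \<tau>) * norm z) \<le> 2 * (1 / (4 * (1 + norm (Fh \<tau>) * norm z))) * (norm (Fh \<tau>) * norm z)"
    by (intro mult_right_mono mult_left_mono) (simp_all add: s_def)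
  also have "\<dots> < 1"
  proof -
    have "0 < 2 * (norm z * norm (Fh \<tau>)) + 4" by (rule add_nonneg_pos) simp_all
    with pos show ?thesis by (simp add: divide_less_eq)
  qed
  finally have "2 * (norm z)\<^sup>2 \<le> s * m" by (rule step[OF s0])
  also have "\<dots> \<le> ((norm z)\<^sup>2 / (1 + m)) * m" by (intro mult_right_mono m) (simp add: s_def)
  also have "\<dots> \<le> (norm z)\<^sup>2" using m z by (simp add: divide_le_eq)
  finally show False using z by simp
qed

end

section \<open>Residual sums of squares and the design matrix\<close>

lemma avg_square_sum:
  assumes G: "orthonormal I G"
  shows "avg I (\<lambda>t. (l \<bullet> G t + x t)\<^sup>2) - (norm (coef I G (\<lambda>t. l \<bullet> G t + x t)))\<^sup>2
    = avg I (\<lambda>t. (x t)\<^sup>2) - (norm (coef I G x))\<^sup>2"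
proof -
  have "avg I (\<lambda>t. (l \<bullet> G t + x t)\<^sup>2)
      = avg I (\<lambda>t. (G t \<bullet> l) * (G t \<bullet> l) + 2 * (x t * (G t \<bullet> l)) + (x t)\<^sup>2)"
    by (rule avg_cong) (simp add: power2_eq_square algebra_simps inner_commute)
  also have "\<dots> = l \<bullet> l + 2 * (coef I G x \<bullet> l) + avg I (\<lambda>t. (x t)\<^sup>2)"
    by (simp add: avg_add avg_mult_left orthonormal_inner[OF G] coef_inner)
  finally show ?thesis
    by (simp add: coef_add orthonormal_coef[OF G] power2_norm_eq_inner inner_add_left inner_add_right
        inner_commute)
qed

lemma avg_residual_mult:
  assumes H: "orthonormal I H"
  shows "avg I (\<lambda>t. (x t - coef I H x \<bullet> H t) * (y t - coef I H y \<bullet> H t))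
    = avg I (\<lambda>t. x t * y t) - coef I H x \<bullet> coef I H y"
proof -
  have "avg I (\<lambda>t. (x t - coef I H x \<bullet> H t) * (y t - coef I H y \<bullet> H t))
      = avg I (\<lambda>t. x t * y t - x t * (H t \<bullet> coef I H y) - y t * (H t \<bullet> coef I H x)
          + (H t \<bullet> coef I H x) * (H t \<bullet> coef I H y))"
    by (rule avg_cong) (simp add: algebra_simps inner_commute)
  also have "\<dots> = avg I (\<lambda>t. x t * y t) - coef I H x \<bullet> coef I H y"
    by (simp add: avg_add avg_diff orthonormal_inner[OF H] coef_inner[symmetric]
        orthonormal_coef[OF H] inner_commute)
  finally show ?thesis .
qed

text \<open>\<open>matrix_inv\<close> is a choice that is meaningful for invertible matrices only;
  positivity of the quadratic form excludes a kernel.\<close>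

lemma posdef_matrix_inv:
  fixes S :: "real ^ 'k ^ 'k"
  assumes "\<And>v. v \<noteq> 0 \<Longrightarrow> 0 < v \<bullet> (S *v v)"
  shows "S *v (matrix_inv S *v w) = w"
proof -
  have "x = 0" if "S *v x = 0" for x using assms[of x] that by fastforce
  then have "\<exists>B. B ** S = mat 1" unfolding matrix_left_invertible_ker by blast
  then have "invertible S" by (simp add: invertible_left_inverse)
  then have "S ** matrix_inv S = mat 1"
    unfolding invertible_def matrix_inv_def by (rule someI2_ex) blast
  then show ?thesis by (simp add: matrix_vector_mul_assoc)
qed

text \<open>\<open>y\<close> is the coefficient of regressing \<open>z\<close> on the rows
  \<open>l\<close>, and the right side exceeds the left by the mean of
  \<open>(l j \<bullet> \<rho> - l j \<bullet> y)\<^sup>2\<close>. The left side is thus the least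
  residual, with every \<open>\<rho>\<close> as a competitor.\<close>

lemma projection_residual_le:
  fixes l :: "nat \<Rightarrow> real ^ 'k" and m :: nat
  defines "S \<equiv> (1 / real m) *\<^sub>R tmul m l l"
  assumes pos: "\<And>v. v \<noteq> 0 \<Longrightarrow> 0 < v \<bullet> (S *v v)"
  shows "avg {1..m} (\<lambda>j. (z j)\<^sup>2)
      - avg {1..m} (\<lambda>i. avg {1..m} (\<lambda>j. (l i \<bullet> (matrix_inv S *v l j)) * (z i * z j)))
    \<le> avg {1..m} (\<lambda>j. (l j \<bullet> \<rho> - z j)\<^sup>2)"
proof -
  define w where "w = avg {1..m} (\<lambda>j. z j *\<^sub>R l j)"
  define y where "y = matrix_inv S *v w"
  have Sy: "S *v y = w" unfolding y_def by (rule posdef_matrix_inv[OF pos])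
  have S: "avg {1..m} (\<lambda>j. (l j \<bullet> a) * (l j \<bullet> b)) = a \<bullet> (S *v b)" for a b
    unfolding S_def tmul_mult by (simp add: avg_inner_right[symmetric] inner_commute mult.commute)
  have y: "y = avg {1..m} (\<lambda>j. z j *\<^sub>R (matrix_inv S *v l j))"
    unfolding y_def w_def avg_def
    by (simp add: matrix_vector_mult_scaleR linear_sum[OF matrix_vector_mul_linear])
  have "avg {1..m} (\<lambda>i. avg {1..m} (\<lambda>j. (l i \<bullet> (matrix_inv S *v l j)) * (z i * z j))) = avg {1..m} (\<lambda>i. z i * (l i \<bullet> y))"
    unfolding y avg_inner_right[symmetric] avg_mult_left[symmetric]
    by (simp add: mult_ac)
  also have wy: "\<dots> = w \<bullet> y" by (simp add: w_def avg_inner_left[symmetric])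
  finally have inv: "avg {1..m} (\<lambda>i. avg {1..m} (\<lambda>j. (l i \<bullet> (matrix_inv S *v l j)) * (z i * z j))) = w \<bullet> y" .
  have "0 \<le> avg {1..m} (\<lambda>j. (l j \<bullet> \<rho> - l j \<bullet> y)\<^sup>2)" by (rule avg_nonneg) simp
  also have "\<dots> = avg {1..m} (\<lambda>j. (l j \<bullet> \<rho>) * (l j \<bullet> \<rho>) - 2 * ((l j \<bullet> \<rho>) * (l j \<bullet> y)) + (l j \<bullet> y) * (l j \<bullet> y))"
    by (rule avg_cong) (simp add: power2_eq_square algebra_simps)
  also have "\<dots> = \<rho> \<bullet> (S *v \<rho>) - 2 * (\<rho> \<bullet> w) + w \<bullet> y"
    unfolding avg_add avg_diff avg_mult_left S Sy by (simp add: inner_commute)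
  finally have "0 \<le> \<rho> \<bullet> (S *v \<rho>) - 2 * (\<rho> \<bullet> w) + w \<bullet> y" .
  moreover have "avg {1..m} (\<lambda>j. (l j \<bullet> \<rho> - z j)\<^sup>2)
      = avg {1..m} (\<lambda>j. (l j \<bullet> \<rho>) * (l j \<bullet> \<rho>) - 2 * (z j * (l j \<bullet> \<rho>)) + (z j)\<^sup>2)"
    by (rule avg_cong) (simp add: power2_eq_square algebra_simps)
  moreover have "\<dots> = \<rho> \<bullet> (S *v \<rho>) - 2 * (\<rho> \<bullet> w) + avg {1..m} (\<lambda>j. (z j)\<^sup>2)"
    unfolding avg_add avg_diff avg_mult_left S
    by (simp add: w_def avg_inner_right[symmetric] inner_commute)
  ultimately show ?thesis unfolding inv by linarith
qed

lemma annihilator_normalized: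
  assumes "normalized T G" "1 \<le> T"
  shows "annihilator T G t s = (if t = s then 1 else 0) - (G t \<bullet> G s) / real T"
proof -
  have "tmul T G G = real T *\<^sub>R ((1 / real T) *\<^sub>R tmul T G G)" using assms(2) by simp
  then have eq: "tmul T G G = real T *\<^sub>R mat 1" using assms(1) unfolding normalized_def by simp
  have R: "real T *\<^sub>R mat 1 *v v = real T *\<^sub>R (v :: real ^ 'a)" for v
    by (simp add: scaleR_matrix_vector_assoc[symmetric])
  have "real T *\<^sub>R mat 1 *v (matrix_inv (real T *\<^sub>R mat 1) *v G s) = G s"
    by (rule posdef_matrix_inv) (use assms(2) in \<open>simp add: R\<close>)
  then have "matrix_inv (real T *\<^sub>R mat 1) *v G s = (1 / real T) *\<^sub>R G s"
    unfolding R using assms(2) by (metis (no_types) divide_self_if inverse_eq_divide not_one_le_zero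
      of_nat_eq_0_iff scaleR_one scaleR_scaleR times_divide_eq_left mult_1)
  then show ?thesis by (simp add: annihilator_def eq)
qed

lemma annihilated_tmul_quadratic:
  assumes G: "normalized T G" "1 \<le> T"
  shows "v \<bullet> (annihilated_tmul T G Z W *v v)
    = real T * (avg {1..T} (\<lambda>t. (Z t \<bullet> v) * (W t \<bullet> v))
        - coef {1..T} G (\<lambda>t. Z t \<bullet> v) \<bullet> coef {1..T} G (\<lambda>t. W t \<bullet> v))"
proof -
  have "v \<bullet> (annihilated_tmul T G Z W *v v)
      = (\<Sum>t=1..T. \<Sum>s=1..T. annihilator T G t s * ((Z t \<bullet> v) * (W s \<bullet> v)))"
    unfolding annihilated_tmul_def
    by (simp add: sum_matrix_vector_mult scaleR_matrix_vector_assoc[symmetric] outer_mult inner_sum_right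
        inner_commute mult_ac)
  also have "\<dots> = (\<Sum>t=1..T. (Z t \<bullet> v) * (W t \<bullet> v))
      - (\<Sum>t=1..T. \<Sum>s=1..T. (G t \<bullet> G s) * ((Z t \<bullet> v) * (W s \<bullet> v))) / real T"
    unfolding annihilator_normalized[OF G]
    by (simp add: left_diff_distrib sum_subtractf sum_divide_distrib if_distrib[of "\<lambda>x. x * _"] cong: if_cong)
  also have "\<dots> = real T * (avg {1..T} (\<lambda>t. (Z t \<bullet> v) * (W t \<bullet> v))
        - avg {1..T} (\<lambda>t. avg {1..T} (\<lambda>s. (G t \<bullet> G s) * ((Z t \<bullet> v) * (W s \<bullet> v)))))"
    using G(2) by (simp add: avg_def right_diff_distrib sum_divide_distrib[symmetric])
  finally show ?thesis by (simp only: coef_inner_coef)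
qed

text \<open>Projecting off \<open>G\<close> leaves the residuals \<open>z\<close>; in each period
  the double sum with the inverse of \<open>\<Lambda>'\<Lambda>/N\<close> then removes their
  projection on the columns of \<open>\<Lambda>\<close>. What is left is a minimum over all common
  components of that period, hence at most its value at \<open>residual {1..T} G F t\<close>, for
  arbitrary \<open>F\<close>.\<close>

lemma design_matrix_quadratic_le:
  fixes \<Lambda> F G :: "nat \<Rightarrow> real ^ 'k" and X :: "nat \<Rightarrow> nat \<Rightarrow> real ^ 'p"
  assumes G: "normalized T G" and N: "1 \<le> N" and T: "1 \<le> T"
    and pos: "\<And>v. v \<noteq> 0 \<Longrightarrow> 0 < avg {1..N} (\<lambda>j. (\<Lambda> j \<bullet> v)\<^sup>2)"
  shows "v \<bullet> (design_matrix N T X \<Lambda> G *v v)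
    \<le> avg {1..N} (\<lambda>j. avg {1..T} (\<lambda>t. (\<Lambda> j \<bullet> F t - X j t \<bullet> v)\<^sup>2)
          - (norm (coef {1..T} G (\<lambda>t. \<Lambda> j \<bullet> F t - X j t \<bullet> v)))\<^sup>2)"
proof -
  have H: "orthonormal {1..T} G" using G by (simp add: normalized_iff)
  define S where "S = (1 / real N) *\<^sub>R tmul N \<Lambda> \<Lambda>"
  define x where "x = (\<lambda>j t. X j t \<bullet> v)"
  define z where "z = (\<lambda>j t. x j t - coef {1..T} G (x j) \<bullet> G t)"
  define a where "a = (\<lambda>i j. \<Lambda> i \<bullet> (matrix_inv S *v \<Lambda> j))"
  have z: "avg {1..T} (\<lambda>t. x i t * x j t) - coef {1..T} G (x i) \<bullet> coef {1..T} G (x j)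
      = avg {1..T} (\<lambda>t. z i t * z j t)" for i j
    unfolding z_def avg_residual_mult[OF H] ..
  have "v \<bullet> (design_matrix N T X \<Lambda> G *v v)
      = avg {1..N} (\<lambda>j. avg {1..T} (\<lambda>t. z j t * z j t))
        - avg {1..N} (\<lambda>i. avg {1..N} (\<lambda>j. a i j * avg {1..T} (\<lambda>t. z i t * z j t)))"
  proof -
    have q: "v \<bullet> (annihilated_tmul T G (X i) (X j) *v v) = real T * avg {1..T} (\<lambda>t. z i t * z j t)" for i j
      unfolding annihilated_tmul_quadratic[OF G T] z[symmetric] by (simp add: x_def[abs_def])
    show ?thesis
      unfolding design_matrix_def S_def[symmetric] avg_def[of "{1..N}"]
      using T N
      by (simp add: matrix_vector_mult_diff_rdistrib scaleR_matrix_vector_assoc[symmetric]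
          sum_matrix_vector_mult inner_diff_right inner_sum_right q a_def
          sum_distrib_left sum_divide_distrib power2_eq_square mult_ac)
  qed
  also have "\<dots> = avg {1..T} (\<lambda>t. avg {1..N} (\<lambda>j. (z j t)\<^sup>2)
        - avg {1..N} (\<lambda>i. avg {1..N} (\<lambda>j. a i j * (z i t * z j t))))"
  proof -
    have "avg {1..N} (\<lambda>i. avg {1..N} (\<lambda>j. a i j * avg {1..T} (\<lambda>t. z i t * z j t)))
        = avg {1..N} (\<lambda>i. avg {1..T} (\<lambda>t. avg {1..N} (\<lambda>j. a i j * (z i t * z j t))))"
      unfolding avg_mult_left[symmetric] by (rule avg_cong) (rule avg_swap)
    also have "\<dots> = avg {1..T} (\<lambda>t. avg {1..N} (\<lambda>i. avg {1..N} (\<lambda>j. a i j * (z i t * z j t))))"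
      by (rule avg_swap)
    finally show ?thesis
      unfolding avg_diff by (simp only: power2_eq_square avg_swap[of "{1..N}" "{1..T}" "\<lambda>j t. z j t * z j t"])
  qed
  also have "\<dots> \<le> avg {1..T} (\<lambda>t. avg {1..N} (\<lambda>j. (\<Lambda> j \<bullet> residual {1..T} G F t - z j t)\<^sup>2))"
    unfolding a_def S_def
    by (intro avg_mono projection_residual_le, unfold tmul_quadratic) (rule pos)
  also have "\<dots> = avg {1..N} (\<lambda>j. avg {1..T} (\<lambda>t. (\<Lambda> j \<bullet> residual {1..T} G F t - z j t)\<^sup>2))"
    by (rule avg_swap)
  also have "\<dots> = avg {1..N} (\<lambda>j. avg {1..T} (\<lambda>t. (\<Lambda> j \<bullet> F t - X j t \<bullet> v)\<^sup>2)
          - (norm (coef {1..T} G (\<lambda>t. \<Lambda> j \<bullet> F t - X j t \<bullet> v)))\<^sup>2)"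
  proof (rule avg_cong)
    fix j
    define e where "e = (\<lambda>t. \<Lambda> j \<bullet> F t - X j t \<bullet> v)"
    have "\<Lambda> j \<bullet> residual {1..T} G F t - z j t = e t - coef {1..T} G e \<bullet> G t" for t
      unfolding inner_commute[of "\<Lambda> j"] residual_inner z_def e_def coef_diff x_def
      by (simp add: inner_diff_left inner_commute[of "\<Lambda> j"])
    then have "avg {1..T} (\<lambda>t. (\<Lambda> j \<bullet> residual {1..T} G F t - z j t)\<^sup>2)
        = avg {1..T} (\<lambda>t. (e t)\<^sup>2) - (norm (coef {1..T} G e))\<^sup>2"
      using avg_residual_mult[OF H, of e e]
      by (simp add: power2_eq_square[of "_ - _"] power2_eq_square[of "e _"] power2_norm_eq_inner)
    then show "avg {1..T} (\<lambda>t. (\<Lambda> j \<bullet> residual {1..T} G F t - z j t)\<^sup>2)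
        = avg {1..T} (\<lambda>t. (\<Lambda> j \<bullet> F t - X j t \<bullet> v)\<^sup>2) - (norm (coef {1..T} G (\<lambda>t. \<Lambda> j \<bullet> F t - X j t \<bullet> v)))\<^sup>2"
      unfolding e_def .
  qed
  finally show ?thesis .
qed

text \<open>\<open>M\<close> is a constant, \<open>r\<close> the rate, and \<open>\<tau>\<close> the period of the pointwise statement.\<close>

locale sample_bounds =
  fixes N T :: nat and F \<Lambda> :: "nat \<Rightarrow> real ^ 'k" and X :: "nat \<Rightarrow> nat \<Rightarrow> real ^ 'p"
    and u :: "nat \<Rightarrow> nat \<Rightarrow> real" and M \<kappa> c r :: real and \<tau> :: nat
  assumes N: "1 \<le> N" and T: "1 \<le> T" and \<tau>: "\<tau> \<in> {1..T}"
    and pos: "0 < M" "0 < \<kappa>" "0 < c" "0 < r" "r \<le> 1"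
    and F_lower: "\<And>v. \<kappa> * (norm v)\<^sup>2 \<le> avg {1..T} (\<lambda>t. (F t \<bullet> v)\<^sup>2)"
    and F_upper: "\<And>v. avg {1..T} (\<lambda>t. (F t \<bullet> v)\<^sup>2) \<le> M * (norm v)\<^sup>2"
    and \<Lambda>_lower: "\<And>v. \<kappa> * (norm v)\<^sup>2 \<le> avg {1..N} (\<lambda>j. (\<Lambda> j \<bullet> v)\<^sup>2)"
    and design: "\<And>G :: nat \<Rightarrow> real ^ 'k. normalized T G \<Longrightarrow> posdef (design_matrix N T X \<Lambda> G - c *\<^sub>R mat 1)"
    and \<Lambda>_le: "rms {1..N} \<Lambda> \<le> M"
    and X_le: "rms {1..T} (\<lambda>t. rms {1..N} (\<lambda>j. X j t)) \<le> M"
    and uu_le: "rms {1..T} (\<lambda>t. rms {1..T} (\<lambda>s. avg {1..N} (\<lambda>j. u j t * u j s))) \<le> M * r"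
    and u\<Lambda>_le: "rms {1..T} (\<lambda>t. avg {1..N} (\<lambda>j. u j t *\<^sub>R \<Lambda> j)) \<le> M * r"
    and uF_le: "rms {1..N} (\<lambda>j. avg {1..T} (\<lambda>t. u j t *\<^sub>R F t)) \<le> M * r"
    and uX_le: "norm (avg {1..N} (\<lambda>j. avg {1..T} (\<lambda>t. u j t *\<^sub>R X j t))) \<le> M * r"
    and unit: "rms {1..T} (\<lambda>t. u 1 t) \<le> M" "norm (avg {1..T} (\<lambda>t. u 1 t *\<^sub>R F t)) \<le> M * r"
      "rms {1..T} (\<lambda>t. X 1 t) \<le> M" "norm (\<Lambda> 1) \<le> M"
    and at: "norm (F \<tau>) \<le> M" "rms {1..N} (\<lambda>j. u j \<tau>) \<le> M" "rms {1..N} (\<lambda>j. X j \<tau>) \<le> M"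
      "norm (X 1 \<tau>) \<le> M" "norm (avg {1..N} (\<lambda>j. u j \<tau> *\<^sub>R \<Lambda> j)) \<le> M * r"
      "rms {1..T} (\<lambda>s. avg {1..N} (\<lambda>j. u j \<tau> * u j s)) \<le> M * r"

text \<open>Reduces a sample with arbitrary true factors to \<open>factor_fit\<close>: the factors
  are whitened, the loadings transformed dually, and the fitted loadings are \<open>coef\<close>
  values because they are optimal given the fitted factors and slope.\<close>

lemma estimation_error_bounds:
  fixes M \<kappa> c :: real
  assumes "0 < M" "0 < \<kappa>" "0 < c"
  shows "\<exists>C r0. 0 < r0 \<and> (\<forall>N T (F :: nat \<Rightarrow> real ^ 'k) \<Lambda> (X :: nat \<Rightarrow> nat \<Rightarrow> real ^ 'p) u Y \<beta> (Fh :: nat \<Rightarrow> real ^ 'k) Lh bh r \<tau>.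
    r < r0 \<longrightarrow> sample_bounds N T F \<Lambda> X u M \<kappa> c r \<tau> \<longrightarrow>
    (\<forall>j\<in>{1..N}. \<forall>t\<in>{1..T}. Y j t = ife_mean (\<Lambda> j) (F t) (X j t) \<beta> + u j t) \<longrightarrow>
    is_least_squares N T Y X Fh Lh bh \<longrightarrow>
    rms {1..T} (\<lambda>t. ife_mean (Lh 1) (Fh t) (X 1 t) bh - ife_mean (\<Lambda> 1) (F t) (X 1 t) \<beta>) \<le> C * r \<and>
    \<bar>ife_mean (Lh 1) (Fh \<tau>) (X 1 \<tau>) bh - ife_mean (\<Lambda> 1) (F \<tau>) (X 1 \<tau>) \<beta>\<bar> \<le> C * r)"
proof -
  \<comment> \<open>\<open>M / sqrt \<kappa>\<close> is the price of applying \<open>B\<close> and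
    \<open>sqrt M * M\<close> that of \<open>B'\<close>; the other summands ensure
    \<open>1 \<le> K\<close>, \<open>M \<le> K\<close> and the bound on the root of the number of
    factors.\<close>
  define K where "K = 1 + sqrt DIM(real ^ 'k) + M * (1 + 1 / sqrt \<kappa> + sqrt M)"
  have K1: "1 \<le> K" using assms by (simp add: K_def)
  have MK: "M \<le> K" "M / sqrt \<kappa> \<le> K" "sqrt M * M \<le> K" and dimK: "sqrt DIM(real ^ 'k) \<le> K"
    using assms by (simp_all add: K_def algebra_simps add_nonneg_nonneg)
  \<comment> \<open>One factor \<open>\<kappa>\<close> is the lower bound for the original loadings,
    the other is lost in transforming them by \<open>B'\<close>.\<close>
  have "0 < \<kappa>\<^sup>2" using assms by simp
  obtain C r0 where r0: "0 < r0" and bounds: "\<And>(I :: nat set) (J :: nat set) (G :: nat \<Rightarrow> real ^ 'k) H L U Q r x j \<tau>.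
    r < r0 \<Longrightarrow> factor_fit I J G H L U Q K (\<kappa>\<^sup>2) c r x \<Longrightarrow>
    rms I (\<lambda>t. U t j) \<le> K \<Longrightarrow> norm (coef I G (\<lambda>t. U t j)) \<le> K * r \<Longrightarrow>
    rms I (\<lambda>t. Q t j) \<le> K * x \<Longrightarrow> norm (L j) \<le> K \<Longrightarrow>
    rms I (\<lambda>t. coef I H (\<lambda>t. L j \<bullet> G t + U t j - Q t j) \<bullet> H t - L j \<bullet> G t + Q t j) \<le> C * r \<and>
    (norm (G \<tau>) \<le> K \<longrightarrow> rms J (U \<tau>) \<le> K \<longrightarrow> rms J (Q \<tau>) \<le> K * x \<longrightarrow> \<bar>Q \<tau> j\<bar> \<le> K * x \<longrightarrow>
     norm (avg J (\<lambda>j. U \<tau> j *\<^sub>R L j)) \<le> K * r \<longrightarrow>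
     rms I (\<lambda>s. avg J (\<lambda>j. U \<tau> j * U s j)) \<le> K * r \<longrightarrow>
     avg J (\<lambda>j. (L j \<bullet> G \<tau> + U \<tau> j - Q \<tau> j
          - coef I H (\<lambda>t. L j \<bullet> G t + U t j - Q t j) \<bullet> H \<tau>) *\<^sub>R
          coef I H (\<lambda>t. L j \<bullet> G t + U t j - Q t j)) = 0 \<longrightarrow>
     \<bar>coef I H (\<lambda>t. L j \<bullet> G t + U t j - Q t j) \<bullet> H \<tau> - L j \<bullet> G \<tau> + Q \<tau> j\<bar> \<le> C * r)"
    using factor_fit_error_bounds[OF K1 \<open>0 < \<kappa>\<^sup>2\<close> \<open>0 < c\<close>, where 'i = nat and 'j = nat and 'b = "real ^ 'k"]
    by blast
  have "rms {1..T} (\<lambda>t. ife_mean (Lh 1) (Fh t) (X 1 t) bh - ife_mean (\<Lambda> 1) (F t) (X 1 t) \<beta>) \<le> C * r \<and>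
    \<bar>ife_mean (Lh 1) (Fh \<tau>) (X 1 \<tau>) bh - ife_mean (\<Lambda> 1) (F \<tau>) (X 1 \<tau>) \<beta>\<bar> \<le> C * r"
    if less: "r < r0" and sample: "sample_bounds N T F \<Lambda> X u M \<kappa> c r \<tau>"
      and model: "\<forall>j\<in>{1..N}. \<forall>t\<in>{1..T}. Y j t = ife_mean (\<Lambda> j) (F t) (X j t) \<beta> + u j t"
      and opt: "is_least_squares N T Y X Fh Lh bh"
    for N T and F \<Lambda> Fh Lh :: "nat \<Rightarrow> real ^ 'k" and X :: "nat \<Rightarrow> nat \<Rightarrow> real ^ 'p" and u Y \<beta> bh r \<tau>
  proof -
    interpret sample_bounds N T F \<Lambda> X u M \<kappa> c r \<tau> by (rule sample)
    define S where "S = (1 / real T) *\<^sub>R tmul T F F"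
    have S: "v \<bullet> (S *v v) = avg {1..T} (\<lambda>t. (F t \<bullet> v)\<^sup>2)" for v by (simp only: S_def tmul_quadratic)
    have S_sym: "transpose S = S" by (simp add: S_def transpose_scaleR transpose_tmul)
    have S_pos: "0 < v \<bullet> (S *v v)" if "v \<noteq> 0" for v
      using F_lower[of v] pos that unfolding S by (meson less_le_trans mult_pos_pos zero_less_norm_iff zero_less_power)
    obtain B B' Bt Bt' :: "real ^ 'k \<Rightarrow> real ^ 'k" where lin: "linear B" "linear B'"
      and adj: "\<And>v w. B v \<bullet> w = v \<bullet> Bt w" "\<And>v w. B' v \<bullet> w = v \<bullet> Bt' w"
      and dual: "\<And>v w. B' v \<bullet> B w = v \<bullet> w" and inv: "\<And>v. B (S *v Bt v) = v"
      and B_le: "\<And>v. norm (B v) \<le> norm v / sqrt \<kappa>"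
      and Bt'_ge: "\<And>v. sqrt \<kappa> * norm v \<le> norm (Bt' v)"
      and B'_le: "\<And>v. norm (B' v) \<le> sqrt M * norm v"
      apply (rule whitening[OF S_sym S_pos])
       apply assumption
      subgoal premises p for B B' Bt Bt'
        by (rule that[OF p(2-7) p(8)[OF pos(2)] p(9)[OF pos(2)] p(10)[OF pos(1)]])
          (simp_all only: S F_lower F_upper)
      done
    define G where "G = (\<lambda>t. B (F t))"
    define L where "L = (\<lambda>j. B' (\<Lambda> j))"
    define U where "U = (\<lambda>t j. u j t)"
    define \<delta> where "\<delta> = bh - \<beta>"
    define Q where "Q = (\<lambda>t j. X j t \<bullet> \<delta>)"
    define x where "x = norm \<delta>"
    have x0: "0 \<le> x" by (simp add: x_def)
    have LG: "L j \<bullet> G t = \<Lambda> j \<bullet> F t" for j t by (simp add: L_def G_def dual)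
    have B_avg: "avg A (\<lambda>i. a i *\<^sub>R B (f i)) = B (avg A (\<lambda>i. a i *\<^sub>R f i))" for A :: "nat set" and a f
      by (simp add: avg_def linear_sum[OF lin(1)] linear_scale[OF lin(1)])
    have B'_avg: "avg A (\<lambda>i. a i *\<^sub>R B' (f i)) = B' (avg A (\<lambda>i. a i *\<^sub>R f i))" for A :: "nat set" and a f
      by (simp add: avg_def linear_sum[OF lin(2)] linear_scale[OF lin(2)])
    have G: "orthonormal {1..T} G"
      unfolding orthonormal_def G_def adj B_avg by (simp only: tmul_mult[symmetric] S_def[symmetric] inv simp_thms)
    have H: "orthonormal {1..T} Fh" by (rule orthonormal_Fh[OF opt N T])
    have net: "Y j t - X j t \<bullet> bh = L j \<bullet> G t + U t j - Q t j" "Y j t - X j t \<bullet> \<beta> = L j \<bullet> G t + U t j"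
      if "j \<in> {1..N}" "t \<in> {1..T}" for j t
      using model that by (simp_all add: LG ife_mean_def U_def Q_def \<delta>_def inner_diff_right)
    have coef_net: "coef {1..T} R (\<lambda>t. Y j t - X j t \<bullet> bh) = coef {1..T} R (\<lambda>t. L j \<bullet> G t + U t j - Q t j)"
      "coef {1..T} R (\<lambda>t. Y j t - X j t \<bullet> \<beta>) = coef {1..T} R (\<lambda>t. L j \<bullet> G t + U t j)"
      if "j \<in> {1..N}" for j and R :: "nat \<Rightarrow> real ^ 'k"
      using net that by (simp_all only: coef_def cong: avg_cong)
    have sq_net: "avg {1..T} (\<lambda>t. (Y j t - X j t \<bullet> bh)\<^sup>2) = avg {1..T} (\<lambda>t. (L j \<bullet> G t + U t j - Q t j)\<^sup>2)"
      "avg {1..T} (\<lambda>t. (Y j t - X j t \<bullet> \<beta>)\<^sup>2) = avg {1..T} (\<lambda>t. (L j \<bullet> G t + U t j)\<^sup>2)"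
      if "j \<in> {1..N}" for j
      using net that by (simp_all only: cong: avg_cong)
    have M_le: "M * b \<le> K * b" if "0 \<le> b" for b using MK(1) that by (rule mult_right_mono)
    have r0': "0 \<le> r" using pos by simp
    have B_bound: "norm (B v) \<le> K * b" if "norm v \<le> M * b" "0 \<le> b" for v b
    proof -
      have "norm (B v) \<le> M * b / sqrt \<kappa>" using B_le[of v] that pos by (meson divide_right_mono order_trans real_sqrt_ge_zero less_imp_le)
      also have "\<dots> \<le> K * b" using mult_right_mono[OF MK(2) that(2)] by simp
      finally show ?thesis .
    qed
    have B'_bound: "norm (B' v) \<le> K * b" if "norm v \<le> M * b" "0 \<le> b" for v b
    proof -
      have "norm (B' v) \<le> sqrt M * (M * b)" using B'_le[of v] that pos
        by (meson mult_left_mono order_trans real_sqrt_ge_zero less_imp_le)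
      also have "\<dots> \<le> K * b" using mult_right_mono[OF MK(3) that(2)] by (simp add: mult.assoc)
      finally show ?thesis .
    qed
    have rms_B: "rms A (\<lambda>i. B (f i)) \<le> K * b" if "rms A f \<le> M * b" "0 \<le> b" for A :: "nat set" and f b
    proof -
      have "rms A (\<lambda>i. B (f i)) \<le> rms A (\<lambda>i. (1 / sqrt \<kappa>) * norm (f i))"
        using B_le pos by (intro rms_mono) simp
      also have "\<dots> = rms A f / sqrt \<kappa>" 
        using pos rms_mult_left[of A "1 / sqrt \<kappa>" "\<lambda>i. norm (f i)"] by simp
      also have "\<dots> \<le> M * b / sqrt \<kappa>" using that pos by (intro divide_right_mono) auto
      also have "\<dots> \<le> K * b" using mult_right_mono[OF MK(2) that(2)] by simp
      finally show ?thesis .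
    qed
    have rms_B': "rms A (\<lambda>i. B' (f i)) \<le> K * b" if "rms A f \<le> M * b" "0 \<le> b" for A :: "nat set" and f b
    proof -
      have "rms A (\<lambda>i. B' (f i)) \<le> rms A (\<lambda>i. sqrt M * norm (f i))"
        using B'_le pos by (intro rms_mono) simp
      also have "\<dots> = sqrt M * rms A f" using pos by (simp add: rms_mult_left)
      also have "\<dots> \<le> sqrt M * (M * b)" using that pos by (intro mult_left_mono) auto
      also have "\<dots> \<le> K * b" using mult_right_mono[OF MK(3) that(2)] by (simp add: mult.assoc)
      finally show ?thesis .
    qed
    have Q_row: "rms A (\<lambda>i. f i \<bullet> \<delta>) \<le> K * x" if "rms A f \<le> M" for A :: "nat set" and f :: "nat \<Rightarrow> real ^ 'p"
      using rms_inner_le[of A f \<delta>] mult_right_mono[OF that x0] M_le[OF x0] by (simp add: x_def)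
    have profile: "avg {1..N} (\<lambda>j. avg {1..T} (\<lambda>t. (Y j t - X j t \<bullet> bh)\<^sup>2) - (norm (coef {1..T} Fh (\<lambda>t. Y j t - X j t \<bullet> bh)))\<^sup>2)
       \<le> avg {1..N} (\<lambda>j. avg {1..T} (\<lambda>t. (Y j t - X j t \<bullet> b)\<^sup>2) - (norm (coef {1..T} G (\<lambda>t. Y j t - X j t \<bullet> b)))\<^sup>2)" for b
      by (rule profile_le[OF opt N T G])
    have fit: "factor_fit {1..T} {1..N} G Fh L U Q K (\<kappa>\<^sup>2) c r x"
    proof
      show "\<kappa>\<^sup>2 * (norm v)\<^sup>2 \<le> avg {1..N} (\<lambda>j. (L j \<bullet> v)\<^sup>2)" for v
      proof -
        have "\<kappa> * (sqrt \<kappa> * norm v)\<^sup>2 \<le> \<kappa> * (norm (Bt' v))\<^sup>2"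
          using Bt'_ge pos by (intro mult_left_mono power_mono) auto
        also have "\<dots> \<le> avg {1..N} (\<lambda>j. (L j \<bullet> v)\<^sup>2)"
          unfolding L_def adj by (rule \<Lambda>_lower)
        finally show ?thesis using pos
          by (simp add: power_mult_distrib power2_eq_square[of \<kappa>] mult.assoc)
      qed
      show "rms {1..N} L \<le> K" using rms_B'[of "{1..N}" \<Lambda> 1] \<Lambda>_le by (simp add: L_def)
      show "rms {1..T} (\<lambda>t. rms {1..T} (\<lambda>s. avg {1..N} (\<lambda>j. U t j * U s j))) \<le> K * r"
        using uu_le M_le[OF r0'] unfolding U_def by linarith
      show "rms {1..T} (\<lambda>t. avg {1..N} (\<lambda>j. U t j *\<^sub>R L j)) \<le> K * r"
        unfolding U_def L_def B'_avg by (rule rms_B'[OF u\<Lambda>_le r0'])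
      show "rms {1..N} (\<lambda>j. coef {1..T} G (\<lambda>t. U t j)) \<le> K * r"
        unfolding U_def G_def coef_def B_avg by (rule rms_B[OF uF_le r0'])
      have "rms {1..T} (\<lambda>t. rms {1..N} (Q t)) \<le> rms {1..T} (\<lambda>t. rms {1..N} (\<lambda>j. X j t) * x)"
        unfolding Q_def x_def by (intro rms_mono) (simp add: rms_inner_le)
      also have "\<dots> = rms {1..T} (\<lambda>t. rms {1..N} (\<lambda>j. X j t)) * x"
        using x0 by (simp add: rms_mult_right)
      also have "\<dots> \<le> K * x" using mult_right_mono[OF X_le x0] M_le[OF x0] by linarith
      finally show "rms {1..T} (\<lambda>t. rms {1..N} (Q t)) \<le> K * x" .
      have "avg {1..N} (\<lambda>j. avg {1..T} (\<lambda>t. Q t j * U t j))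
          = avg {1..N} (\<lambda>j. avg {1..T} (\<lambda>t. u j t *\<^sub>R X j t)) \<bullet> \<delta>"
        by (simp add: avg_inner_left[symmetric] Q_def U_def mult.commute)
      then have "\<bar>avg {1..N} (\<lambda>j. avg {1..T} (\<lambda>t. Q t j * U t j))\<bar> \<le> (M * r) * x"
        using Cauchy_Schwarz_ineq2 uX_le x0 unfolding x_def
        by (metis (no_types, lifting) mult_right_mono norm_ge_zero order_trans)
      then show "\<bar>avg {1..N} (\<lambda>j. avg {1..T} (\<lambda>t. Q t j * U t j))\<bar> \<le> K * x * r"
        using M_le[of "r * x"] x0 r0' by (simp add: mult_ac)
      \<comment> \<open>The design condition ranges over all normalized \<open>G\<close>; it is used
        at the estimated factors.\<close>
      have "c * x\<^sup>2 \<le> \<delta> \<bullet> (design_matrix N T X \<Lambda> Fh *v \<delta>)"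
      proof (cases "\<delta> = 0")
        case False
        have "posdef (design_matrix N T X \<Lambda> Fh - c *\<^sub>R mat 1)"
          using H by (intro design) (simp add: normalized_iff)
        then have "0 < \<delta> \<bullet> ((design_matrix N T X \<Lambda> Fh - c *\<^sub>R mat 1) *v \<delta>)"
          using False by (simp add: posdef_def)
        then show ?thesis
          by (simp add: matrix_vector_mult_diff_rdistrib scaleR_matrix_vector_assoc[symmetric]
              inner_diff_right x_def power2_norm_eq_inner)
      qed (simp add: x_def)
      also have "\<dots> \<le> avg {1..N} (\<lambda>j. avg {1..T} (\<lambda>t. (\<Lambda> j \<bullet> F t - X j t \<bullet> \<delta>)\<^sup>2)
          - (norm (coef {1..T} Fh (\<lambda>t. \<Lambda> j \<bullet> F t - X j t \<bullet> \<delta>)))\<^sup>2)"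
      proof (rule design_matrix_quadratic_le)
        show "normalized T Fh" using H by (simp add: normalized_iff)
        show "0 < avg {1..N} (\<lambda>j. (\<Lambda> j \<bullet> v)\<^sup>2)" if "v \<noteq> 0" for v
          using \<Lambda>_lower[of v] pos that by (meson less_le_trans mult_pos_pos zero_less_norm_iff zero_less_power)
      qed (rule N T)+
      finally show "c * x\<^sup>2 \<le> avg {1..N} (\<lambda>j. avg {1..T} (\<lambda>t. (L j \<bullet> G t - Q t j)\<^sup>2)
          - (norm (coef {1..T} Fh (\<lambda>t. L j \<bullet> G t - Q t j)))\<^sup>2)"
        by (simp only: LG Q_def)
      show "avg {1..N} (\<lambda>j. (norm (coef {1..T} G (\<lambda>t. L j \<bullet> G t + U t j - Q t j)))\<^sup>2)
          \<le> avg {1..N} (\<lambda>j. (norm (coef {1..T} Fh (\<lambda>t. L j \<bullet> G t + U t j - Q t j)))\<^sup>2)"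
      proof -
        \<comment> \<open>Both sides use the estimated slope, so the sums of squares will cancel and
          only the projections remain.\<close>
        have "avg {1..N} (\<lambda>j. avg {1..T} (\<lambda>t. (L j \<bullet> G t + U t j - Q t j)\<^sup>2)
            - (norm (coef {1..T} Fh (\<lambda>t. L j \<bullet> G t + U t j - Q t j)))\<^sup>2)
          \<le> avg {1..N} (\<lambda>j. avg {1..T} (\<lambda>t. (L j \<bullet> G t + U t j - Q t j)\<^sup>2)
            - (norm (coef {1..T} G (\<lambda>t. L j \<bullet> G t + U t j - Q t j)))\<^sup>2)"
          using profile[of bh] by (simp only: coef_net sq_net cong: avg_cong)
        then show ?thesis by (simp add: avg_diff)
      qed
      have "avg {1..N} (\<lambda>j. avg {1..T} (\<lambda>t. (L j \<bullet> G t + U t j - Q t j)\<^sup>2)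
          - (norm (coef {1..T} Fh (\<lambda>t. L j \<bullet> G t + U t j - Q t j)))\<^sup>2)
          \<le> avg {1..N} (\<lambda>j. avg {1..T} (\<lambda>t. (L j \<bullet> G t + U t j)\<^sup>2)
          - (norm (coef {1..T} G (\<lambda>t. L j \<bullet> G t + U t j)))\<^sup>2)"
        using profile[of \<beta>] by (simp only: coef_net sq_net cong: avg_cong)
      \<comment> \<open>A residual sum of squares off \<open>G\<close> does not see the component
        \<open>L j \<bullet> G t\<close>, so at the true slope only the errors are left.\<close>
      then show "avg {1..N} (\<lambda>j. avg {1..T} (\<lambda>t. (L j \<bullet> G t + U t j - Q t j)\<^sup>2)
          - (norm (coef {1..T} Fh (\<lambda>t. L j \<bullet> G t + U t j - Q t j)))\<^sup>2)
          \<le> avg {1..N} (\<lambda>j. avg {1..T} (\<lambda>t. (U t j)\<^sup>2) - (norm (coef {1..T} G (\<lambda>t. U t j)))\<^sup>2)"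
        by (simp only: avg_square_sum[OF G])
    qed (use G H K1 pos x0 dimK in auto)
    have one: "1 \<in> {1..N}" using N by simp
    have Lh: "Lh j = coef {1..T} Fh (\<lambda>t. L j \<bullet> G t + U t j - Q t j)" if "j \<in> {1..N}" for j
      using Lh_eq_coef[OF opt N T that] coef_net(1)[OF that] by simp
    have err: "ife_mean (Lh 1) (Fh t) (X 1 t) bh - ife_mean (\<Lambda> 1) (F t) (X 1 t) \<beta>
        = coef {1..T} Fh (\<lambda>t. L 1 \<bullet> G t + U t 1 - Q t 1) \<bullet> Fh t - L 1 \<bullet> G t + Q t 1" for t
      unfolding ife_mean_def Lh[OF one] LG[of 1 t] by (simp add: Q_def \<delta>_def inner_diff_right)
    have "avg {1..N} (\<lambda>j. (L j \<bullet> G \<tau> + U \<tau> j - Q \<tau> j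
          - coef {1..T} Fh (\<lambda>t. L j \<bullet> G t + U t j - Q t j) \<bullet> Fh \<tau>) *\<^sub>R
          coef {1..T} Fh (\<lambda>t. L j \<bullet> G t + U t j - Q t j))
        = avg {1..N} (\<lambda>j. (Y j \<tau> - X j \<tau> \<bullet> bh - Lh j \<bullet> Fh \<tau>) *\<^sub>R Lh j)"
      by (rule avg_cong) (simp only: Lh[symmetric] net(1)[OF _ \<tau>])
    then have foc: "avg {1..N} (\<lambda>j. (L j \<bullet> G \<tau> + U \<tau> j - Q \<tau> j
          - coef {1..T} Fh (\<lambda>t. L j \<bullet> G t + U t j - Q t j) \<bullet> Fh \<tau>) *\<^sub>R
          coef {1..T} Fh (\<lambda>t. L j \<bullet> G t + U t j - Q t j)) = 0"
      using first_order_condition[OF opt N T \<tau>] by simp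
    have unit': "rms {1..T} (\<lambda>t. U t 1) \<le> K" "norm (coef {1..T} G (\<lambda>t. U t 1)) \<le> K * r"
      "rms {1..T} (\<lambda>t. Q t 1) \<le> K * x" "norm (L 1) \<le> K"
      using unit(1) MK(1) B_bound[OF unit(2) r0'] Q_row[OF unit(3)] B'_bound[of "\<Lambda> 1" 1] unit(4)
      by (simp_all add: U_def Q_def L_def G_def coef_def B_avg)
    have at': "norm (G \<tau>) \<le> K" "rms {1..N} (U \<tau>) \<le> K" "rms {1..N} (Q \<tau>) \<le> K * x" "\<bar>Q \<tau> 1\<bar> \<le> K * x"
      "norm (avg {1..N} (\<lambda>j. U \<tau> j *\<^sub>R L j)) \<le> K * r"
      "rms {1..T} (\<lambda>s. avg {1..N} (\<lambda>j. U \<tau> j * U s j)) \<le> K * r"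
    proof -
      show "norm (G \<tau>) \<le> K" using B_bound[of "F \<tau>" 1] at(1) by (simp add: G_def)
      show "rms {1..N} (U \<tau>) \<le> K" using at(2) MK(1) by (simp add: U_def)
      show "rms {1..N} (Q \<tau>) \<le> K * x" unfolding Q_def by (rule Q_row[OF at(3)])
      show "\<bar>Q \<tau> 1\<bar> \<le> K * x"
        using Cauchy_Schwarz_ineq2[of "X 1 \<tau>" \<delta>] mult_right_mono[OF at(4) x0] M_le[OF x0]
        by (simp add: Q_def x_def)
      show "norm (avg {1..N} (\<lambda>j. U \<tau> j *\<^sub>R L j)) \<le> K * r"
        unfolding U_def L_def B'_avg by (rule B'_bound[OF at(5) r0'])
      show "rms {1..T} (\<lambda>s. avg {1..N} (\<lambda>j. U \<tau> j * U s j)) \<le> K * r"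
        using at(6) M_le[OF r0'] unfolding U_def by linarith
    qed
    show ?thesis
      unfolding err using bounds[OF less fit unit', of \<tau>] at' foc by blast
  qed
  with r0 show ?thesis by blast
qed

section \<open>Convergence rates\<close>

lemma norm_measurable: "f \<in> borel_measurable M \<Longrightarrow> (\<lambda>\<omega>. norm (f \<omega>)) \<in> borel_measurable M"
  for f :: "'w \<Rightarrow> 'b::euclidean_space"
  by measurable

context prob_space
begin

lemma chebyshev:
  fixes f :: "'a \<Rightarrow> real"
  assumes f: "f \<in> borel_measurable M" and le: "(\<integral>\<^sup>+\<omega>. ennreal ((f \<omega>)\<^sup>2) \<partial>M) \<le> ennreal B"
    and B: "0 \<le> B" and a: "0 < a"
  shows "prob {\<omega> \<in> space M. a < \<bar>f \<omega>\<bar>} \<le> B / a\<^sup>2"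
proof -
  have int: "integrable M (\<lambda>\<omega>. (f \<omega>)\<^sup>2)" and E: "(\<integral>\<omega>. (f \<omega>)\<^sup>2 \<partial>M) \<le> B"
    using square_integrableI[of f B] f le B by simp_all
  have "prob {\<omega> \<in> space M. a < \<bar>f \<omega>\<bar>} \<le> prob {\<omega> \<in> space M. a\<^sup>2 \<le> (f \<omega>)\<^sup>2}"
    using f a by (intro finite_measure_mono) (auto simp: abs_le_square_iff[symmetric])
  also have "\<dots> \<le> (\<integral>\<omega>. (f \<omega>)\<^sup>2 \<partial>M) / a\<^sup>2"
    using a by (intro integral_Markov_inequality_measure[OF int, where A = "{}"]) auto
  also have "\<dots> \<le> B / a\<^sup>2" using E a by (intro divide_right_mono) auto
  finally show ?thesis .
qed

end

context ife_sample
begin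

text \<open>The quantities bounded by the constant in \<open>sample_bounds\<close>;
  \<open>rate_stats\<close> has those bounded by the constant times the rate. Finite sets allow one
  Chebyshev argument and one union bound for each kind.\<close>

definition level_stats :: "nat \<Rightarrow> ('w \<Rightarrow> real) set" where
  "level_stats \<tau> = {\<lambda>\<omega>. rms {1..N} (\<lambda>j. \<Lambda> j \<omega>),
    \<lambda>\<omega>. rms {1..T} (\<lambda>t. rms {1..N} (\<lambda>j. X j t \<omega>)),
    \<lambda>\<omega>. rms {1..T} (\<lambda>t. u 1 t \<omega>), \<lambda>\<omega>. rms {1..T} (\<lambda>t. X 1 t \<omega>), \<lambda>\<omega>. norm (\<Lambda> 1 \<omega>), \<lambda>\<omega>. norm (F \<tau> \<omega>),
    \<lambda>\<omega>. rms {1..N} (\<lambda>j. u j \<tau> \<omega>), \<lambda>\<omega>. rms {1..N} (\<lambda>j. X j \<tau> \<omega>), \<lambda>\<omega>. norm (X 1 \<tau> \<omega>)}"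

definition rate_stats :: "nat \<Rightarrow> ('w \<Rightarrow> real) set" where
  "rate_stats \<tau> = {\<lambda>\<omega>. rms {1..T} (\<lambda>t. rms {1..T} (\<lambda>s. avg {1..N} (\<lambda>j. u j t \<omega> * u j s \<omega>))),
    \<lambda>\<omega>. rms {1..T} (\<lambda>t. avg {1..N} (\<lambda>j. u j t \<omega> *\<^sub>R \<Lambda> j \<omega>)),
    \<lambda>\<omega>. rms {1..N} (\<lambda>j. avg {1..T} (\<lambda>t. u j t \<omega> *\<^sub>R F t \<omega>)),
    \<lambda>\<omega>. norm (avg {1..N} (\<lambda>j. avg {1..T} (\<lambda>t. u j t \<omega> *\<^sub>R X j t \<omega>))),
    \<lambda>\<omega>. norm (avg {1..T} (\<lambda>t. u 1 t \<omega> *\<^sub>R F t \<omega>)),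
    \<lambda>\<omega>. norm (avg {1..N} (\<lambda>j. u j \<tau> \<omega> *\<^sub>R \<Lambda> j \<omega>)),
    \<lambda>\<omega>. rms {1..T} (\<lambda>s. avg {1..N} (\<lambda>j. u j \<tau> \<omega> * u j s \<omega>))}"

lemma one_in: "1 \<in> {1..N}" "1 \<in> {1..T}"
  using N T by auto

lemma meas_prods:
  "t \<in> {1..T} \<Longrightarrow> s \<in> {1..T} \<Longrightarrow> (\<lambda>\<omega>. avg {1..N} (\<lambda>j. u j t \<omega> * u j s \<omega>)) \<in> borel_measurable M"
  "t \<in> {1..T} \<Longrightarrow> (\<lambda>\<omega>. avg {1..N} (\<lambda>j. u j t \<omega> *\<^sub>R \<Lambda> j \<omega>)) \<in> borel_measurable M"
  "j \<in> {1..N} \<Longrightarrow> (\<lambda>\<omega>. avg {1..T} (\<lambda>t. u j t \<omega> *\<^sub>R F t \<omega>)) \<in> borel_measurable M"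
  "j \<in> {1..N} \<Longrightarrow> (\<lambda>\<omega>. avg {1..T} (\<lambda>t. u j t \<omega> *\<^sub>R X j t \<omega>)) \<in> borel_measurable M"
  by (intro avg_measurable borel_measurable_times borel_measurable_scaleR rv_u rv_\<Lambda> rv_F rv_X; assumption)+

lemma nn_rms_const:
  fixes f :: "'i \<Rightarrow> 'w \<Rightarrow> 'b::euclidean_space"
  assumes "finite I" "I \<noteq> {}" "0 \<le> b" "\<And>i. i \<in> I \<Longrightarrow> f i \<in> borel_measurable M"
    and "\<And>i. i \<in> I \<Longrightarrow> (\<integral>\<^sup>+\<omega>. ennreal ((norm (f i \<omega>))\<^sup>2) \<partial>M) \<le> ennreal b"
  shows "(\<integral>\<^sup>+\<omega>. ennreal ((rms I (\<lambda>i. f i \<omega>))\<^sup>2) \<partial>M) \<le> ennreal b"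
  using nn_integral_rms_le[of I f M "\<lambda>i. b"] assms by (simp add: avg_const)

lemma level_stats:
  assumes \<tau>: "\<tau> \<in> {1..T}" and f: "f \<in> level_stats \<tau>"
  shows "f \<in> borel_measurable M" "(\<integral>\<^sup>+\<omega>. ennreal ((f \<omega>)\<^sup>2) \<partial>M) \<le> ennreal D"
proof -
  have rmsX: "(\<lambda>\<omega>. rms {1..N} (\<lambda>j. X j t \<omega>)) \<in> borel_measurable M" if "t \<in> {1..T}" for t
    using that by (intro rms_measurable rv_X)
  show "f \<in> borel_measurable M"
    using f \<tau> one_in unfolding level_stats_def
    by (auto intro!: rms_measurable norm_measurable rv_X rv_u rv_\<Lambda> rv_F)
  have X: "(\<integral>\<^sup>+\<omega>. ennreal ((rms {1..N} (\<lambda>j. X j t \<omega>))\<^sup>2) \<partial>M) \<le> ennreal D" if "t \<in> {1..T}" for t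
    using N D that by (intro nn_rms_const rv_X second_moment_X) auto
  have XX: "(\<integral>\<^sup>+\<omega>. ennreal ((rms {1..T} (\<lambda>t. rms {1..N} (\<lambda>j. X j t \<omega>)))\<^sup>2) \<partial>M) \<le> ennreal D"
    using T D X rmsX by (intro nn_rms_const) auto
  have L: "(\<integral>\<^sup>+\<omega>. ennreal ((rms {1..N} (\<lambda>j. \<Lambda> j \<omega>))\<^sup>2) \<partial>M) \<le> ennreal D"
    using N D by (intro nn_rms_const rv_\<Lambda> second_moment_\<Lambda>) auto
  have u1: "(\<integral>\<^sup>+\<omega>. ennreal ((rms {1..T} (\<lambda>t. u 1 t \<omega>))\<^sup>2) \<partial>M) \<le> ennreal D"
    using T D one_in by (intro nn_rms_const rv_u second_moment_u) auto
  have X1: "(\<integral>\<^sup>+\<omega>. ennreal ((rms {1..T} (\<lambda>t. X 1 t \<omega>))\<^sup>2) \<partial>M) \<le> ennreal D"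
    using T D one_in by (intro nn_rms_const rv_X second_moment_X) auto
  have u\<tau>: "(\<integral>\<^sup>+\<omega>. ennreal ((rms {1..N} (\<lambda>j. u j \<tau> \<omega>))\<^sup>2) \<partial>M) \<le> ennreal D"
    using N D \<tau> by (intro nn_rms_const rv_u second_moment_u) auto
  show "(\<integral>\<^sup>+\<omega>. ennreal ((f \<omega>)\<^sup>2) \<partial>M) \<le> ennreal D"
    using f unfolding level_stats_def insert_iff empty_iff
    by (elim disjE FalseE; hypsubst) (rule L XX u1 X1 u\<tau> X[OF \<tau>] second_moment_\<Lambda>[OF one_in(1)] second_moment_F[OF \<tau>] second_moment_X[OF one_in(1) \<tau>])+
qed

lemma rate_stats:
  assumes \<tau>: "\<tau> \<in> {1..T}" and f: "f \<in> rate_stats \<tau>"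
  shows "f \<in> borel_measurable M" "(\<integral>\<^sup>+\<omega>. ennreal ((f \<omega>)\<^sup>2) \<partial>M) \<le> ennreal (2 * D\<^sup>2 * (1 / N + 1 / T))"
proof -
  show "f \<in> borel_measurable M"
    using f \<tau> one_in unfolding rate_stats_def
    by (auto intro!: rms_measurable norm_measurable avg_measurable borel_measurable_times
        borel_measurable_scaleR rv_X rv_u rv_\<Lambda> rv_F)
  have pos: "0 \<le> D\<^sup>2 / N" "0 \<le> D\<^sup>2 / T" by simp_all
  have DN: "D / N \<le> D\<^sup>2 / N" using D(4) by (rule divide_right_mono) simp
  have T': "(\<integral>\<^sup>+\<omega>. ennreal ((g \<omega>)\<^sup>2) \<partial>M) \<le> ennreal (2 * D\<^sup>2 * (1 / N + 1 / T))"
    if "(\<integral>\<^sup>+\<omega>. ennreal ((g \<omega>)\<^sup>2) \<partial>M) \<le> ennreal b" "b \<le> 2 * (D\<^sup>2 / N) + 2 * (D\<^sup>2 / T)" for g and b :: real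
    by (rule order_trans[OF that(1) ennreal_leI]) (use that(2) in \<open>simp add: algebra_simps\<close>)
  \<comment> \<open>The bound for one row serves for the statistic at \<open>\<tau>\<close> and,
    averaged over \<open>t\<close>, for the whole Gram matrix.\<close>
  have row: "(\<integral>\<^sup>+\<omega>. ennreal ((rms {1..T} (\<lambda>s. avg {1..N} (\<lambda>j. u j t \<omega> * u j s \<omega>)))\<^sup>2) \<partial>M)
      \<le> ennreal (2 * D / N + 2 * avg {1..T} (\<lambda>s. (\<gamma>avg t s)\<^sup>2))" if t: "t \<in> {1..T}" for t
  proof -
    have "(\<integral>\<^sup>+\<omega>. ennreal ((rms {1..T} (\<lambda>s. avg {1..N} (\<lambda>j. u j t \<omega> * u j s \<omega>)))\<^sup>2) \<partial>M)
        \<le> ennreal (avg {1..T} (\<lambda>s. 2 * D / N + 2 * (\<gamma>avg t s)\<^sup>2))"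
      using t D(1) by (intro nn_integral_rms_le meas_prods second_moment_gram) auto
    also have "avg {1..T} (\<lambda>s. 2 * D / N + 2 * (\<gamma>avg t s)\<^sup>2) = 2 * D / N + 2 * avg {1..T} (\<lambda>s. (\<gamma>avg t s)\<^sup>2)"
      unfolding avg_add avg_mult_left using T by (subst avg_const) auto
    finally show ?thesis .
  qed
  have integrable_uu: "(\<integral>\<^sup>+\<omega>. ennreal ((rms {1..T} (\<lambda>t. rms {1..T} (\<lambda>s. avg {1..N} (\<lambda>j. u j t \<omega> * u j s \<omega>))))\<^sup>2) \<partial>M)
      \<le> ennreal (2 * D\<^sup>2 * (1 / N + 1 / T))"
  proof (rule T')
    have "(\<integral>\<^sup>+\<omega>. ennreal ((rms {1..T} (\<lambda>t. rms {1..T} (\<lambda>s. avg {1..N} (\<lambda>j. u j t \<omega> * u j s \<omega>))))\<^sup>2) \<partial>M)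
        \<le> ennreal (avg {1..T} (\<lambda>t. 2 * D / N + 2 * avg {1..T} (\<lambda>s. (\<gamma>avg t s)\<^sup>2)))"
    proof (rule nn_integral_rms_le)
      fix t assume t: "t \<in> {1..T}"
      show "(\<lambda>\<omega>. rms {1..T} (\<lambda>s. avg {1..N} (\<lambda>j. u j t \<omega> * u j s \<omega>))) \<in> borel_measurable M"
        using t by (intro rms_measurable meas_prods)
      show "(\<integral>\<^sup>+\<omega>. ennreal ((norm (rms {1..T} (\<lambda>s. avg {1..N} (\<lambda>j. u j t \<omega> * u j s \<omega>))))\<^sup>2) \<partial>M)
          \<le> ennreal (2 * D / N + 2 * avg {1..T} (\<lambda>s. (\<gamma>avg t s)\<^sup>2))" using row[OF t] by simp
      show "0 \<le> 2 * D / N + 2 * avg {1..T} (\<lambda>s. (\<gamma>avg t s)\<^sup>2)" using D(1) by (simp add: avg_nonneg)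
    qed
    also have "avg {1..T} (\<lambda>t. 2 * D / N + 2 * avg {1..T} (\<lambda>s. (\<gamma>avg t s)\<^sup>2))
        = 2 * D / N + 2 * avg {1..T} (\<lambda>t. avg {1..T} (\<lambda>s. (\<gamma>avg t s)\<^sup>2))"
      unfolding avg_add avg_mult_left using T by (subst avg_const) auto
    finally show "(\<integral>\<^sup>+\<omega>. ennreal ((rms {1..T} (\<lambda>t. rms {1..T} (\<lambda>s. avg {1..N} (\<lambda>j. u j t \<omega> * u j s \<omega>))))\<^sup>2) \<partial>M)
        \<le> ennreal (2 * D / N + 2 * avg {1..T} (\<lambda>t. avg {1..T} (\<lambda>s. (\<gamma>avg t s)\<^sup>2)))" .
    show "2 * D / N + 2 * avg {1..T} (\<lambda>t. avg {1..T} (\<lambda>s. (\<gamma>avg t s)\<^sup>2)) \<le> 2 * (D\<^sup>2 / N) + 2 * (D\<^sup>2 / T)"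
      using avg_\<gamma>avg_le DN by linarith
  qed
  have u\<tau>: "(\<integral>\<^sup>+\<omega>. ennreal ((rms {1..T} (\<lambda>s. avg {1..N} (\<lambda>j. u j \<tau> \<omega> * u j s \<omega>)))\<^sup>2) \<partial>M)
      \<le> ennreal (2 * D\<^sup>2 * (1 / N + 1 / T))"
    by (rule T'[OF row[OF \<tau>]]) (use avg_\<gamma>avg_at_le[OF \<tau>] DN in linarith)
  have u\<Lambda>: "(\<integral>\<^sup>+\<omega>. ennreal ((rms {1..T} (\<lambda>t. avg {1..N} (\<lambda>j. u j t \<omega> *\<^sub>R \<Lambda> j \<omega>)))\<^sup>2) \<partial>M)
      \<le> ennreal (2 * D\<^sup>2 * (1 / N + 1 / T))"
  proof (rule T')
    show "(\<integral>\<^sup>+\<omega>. ennreal ((rms {1..T} (\<lambda>t. avg {1..N} (\<lambda>j. u j t \<omega> *\<^sub>R \<Lambda> j \<omega>)))\<^sup>2) \<partial>M) \<le> ennreal (D\<^sup>2 / N)"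
      using T pos by (intro nn_rms_const second_moment_u\<Lambda> meas_prods) auto
  qed (use pos in linarith)
  have uF: "(\<integral>\<^sup>+\<omega>. ennreal ((rms {1..N} (\<lambda>j. avg {1..T} (\<lambda>t. u j t \<omega> *\<^sub>R F t \<omega>)))\<^sup>2) \<partial>M)
      \<le> ennreal (2 * D\<^sup>2 * (1 / N + 1 / T))"
  proof (rule T')
    show "(\<integral>\<^sup>+\<omega>. ennreal ((rms {1..N} (\<lambda>j. avg {1..T} (\<lambda>t. u j t \<omega> *\<^sub>R F t \<omega>)))\<^sup>2) \<partial>M) \<le> ennreal (D\<^sup>2 / T)"
      using N pos by (intro nn_rms_const second_moment_uF meas_prods) auto
  qed (use pos in linarith)
  have uX: "(\<integral>\<^sup>+\<omega>. ennreal ((norm (avg {1..N} (\<lambda>j. avg {1..T} (\<lambda>t. u j t \<omega> *\<^sub>R X j t \<omega>))))\<^sup>2) \<partial>M)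
      \<le> ennreal (2 * D\<^sup>2 * (1 / N + 1 / T))"
  proof (rule T'[OF second_moment_uX])
    have "D\<^sup>2 / real (N * T) \<le> D\<^sup>2 / N" using N T by (intro divide_left_mono) auto
    then show "D\<^sup>2 / real (N * T) \<le> 2 * (D\<^sup>2 / N) + 2 * (D\<^sup>2 / T)" using pos by linarith
  qed
  have uF1: "(\<integral>\<^sup>+\<omega>. ennreal ((norm (avg {1..T} (\<lambda>t. u 1 t \<omega> *\<^sub>R F t \<omega>)))\<^sup>2) \<partial>M)
      \<le> ennreal (2 * D\<^sup>2 * (1 / N + 1 / T))"
    by (rule T'[OF second_moment_uF[OF one_in(1)]]) (use pos in linarith)
  have u\<Lambda>1: "(\<integral>\<^sup>+\<omega>. ennreal ((norm (avg {1..N} (\<lambda>j. u j \<tau> \<omega> *\<^sub>R \<Lambda> j \<omega>)))\<^sup>2) \<partial>M)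
      \<le> ennreal (2 * D\<^sup>2 * (1 / N + 1 / T))"
    by (rule T'[OF second_moment_u\<Lambda>[OF \<tau>]]) (use pos in linarith)
  show "(\<integral>\<^sup>+\<omega>. ennreal ((f \<omega>)\<^sup>2) \<partial>M) \<le> ennreal (2 * D\<^sup>2 * (1 / N + 1 / T))"
    using f unfolding rate_stats_def insert_iff empty_iff
    by (elim disjE FalseE; hypsubst) (rule integrable_uu u\<tau> u\<Lambda> uF uX uF1 u\<Lambda>1)+
qed

definition exceed :: "nat \<Rightarrow> real \<Rightarrow> real \<Rightarrow> 'w set" where
  "exceed \<tau> m r = (\<Union>f\<in>level_stats \<tau>. {\<omega> \<in> space M. m < \<bar>f \<omega>\<bar>}) \<union> (\<Union>f\<in>rate_stats \<tau>. {\<omega> \<in> space M. m * r < \<bar>f \<omega>\<bar>})"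

text \<open>At most 9 statistics have second moment at most \<open>D \<le> D\<^sup>2\<close> and at
  most 7 have the constant \<open>2 * D\<^sup>2\<close>, whence \<open>9 + 14 = 23\<close>. The
  cardinalities are only bounded, since the listed functions may coincide.\<close>

lemma exceed:
  assumes \<tau>: "\<tau> \<in> {1..T}" and m: "0 < m" and r: "0 < r" "1 / N + 1 / T \<le> r\<^sup>2"
  shows "exceed \<tau> m r \<in> sets M" "prob (exceed \<tau> m r) \<le> 23 * D\<^sup>2 / m\<^sup>2"
proof -
  have fin: "finite (level_stats \<tau>)" "finite (rate_stats \<tau>)" by (simp_all add: level_stats_def rate_stats_def)
  have card: "card (level_stats \<tau>) \<le> 9" "card (rate_stats \<tau>) \<le> 7"
  proof -
    have step: "card (insert x A) \<le> Suc n" if "card A \<le> n" for x :: "'w \<Rightarrow> real" and A n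
      using that by (intro card_insert_le_m1) auto
    have "card (level_stats \<tau>) \<le> Suc (Suc (Suc (Suc (Suc (Suc (Suc (Suc (Suc 0))))))))"
      unfolding level_stats_def by (intro step) simp
    then show "card (level_stats \<tau>) \<le> 9" by simp
    have "card (rate_stats \<tau>) \<le> Suc (Suc (Suc (Suc (Suc (Suc (Suc 0))))))"
      unfolding rate_stats_def by (intro step) simp
    then show "card (rate_stats \<tau>) \<le> 7" by simp
  qed
  have sets: "{\<omega> \<in> space M. m < \<bar>f \<omega>\<bar>} \<in> sets M" if "f \<in> level_stats \<tau>" for f
    using level_stats(1)[OF \<tau> that] by measurable
  have sets': "{\<omega> \<in> space M. m * r < \<bar>f \<omega>\<bar>} \<in> sets M" if "f \<in> rate_stats \<tau>" for f
    using rate_stats(1)[OF \<tau> that] by measurable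
  have A: "(\<Union>f\<in>level_stats \<tau>. {\<omega> \<in> space M. m < \<bar>f \<omega>\<bar>}) \<in> sets M"
    and B: "(\<Union>f\<in>rate_stats \<tau>. {\<omega> \<in> space M. m * r < \<bar>f \<omega>\<bar>}) \<in> sets M"
    using fin sets sets' by (auto intro!: sets.finite_UN)
  then show "exceed \<tau> m r \<in> sets M" by (simp add: exceed_def)
  have "prob (\<Union>f\<in>level_stats \<tau>. {\<omega> \<in> space M. m < \<bar>f \<omega>\<bar>}) \<le> (\<Sum>f\<in>level_stats \<tau>. prob {\<omega> \<in> space M. m < \<bar>f \<omega>\<bar>})"
    using fin sets by (intro finite_measure_subadditive_finite) auto
  also have "\<dots> \<le> (\<Sum>f\<in>level_stats \<tau>. D\<^sup>2 / m\<^sup>2)"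
  proof (rule sum_mono)
    fix f assume "f \<in> level_stats \<tau>"
    then have "prob {\<omega> \<in> space M. m < \<bar>f \<omega>\<bar>} \<le> D / m\<^sup>2"
      using level_stats[OF \<tau>] D(1) m by (intro chebyshev) auto
    also have "\<dots> \<le> D\<^sup>2 / m\<^sup>2" using D(4) by (intro divide_right_mono) auto
    finally show "prob {\<omega> \<in> space M. m < \<bar>f \<omega>\<bar>} \<le> D\<^sup>2 / m\<^sup>2" .
  qed
  also have "\<dots> = real (card (level_stats \<tau>)) * (D\<^sup>2 / m\<^sup>2)" by simp
  also have "\<dots> \<le> 9 * (D\<^sup>2 / m\<^sup>2)" using card(1) by (intro mult_right_mono) auto
  finally have 1: "prob (\<Union>f\<in>level_stats \<tau>. {\<omega> \<in> space M. m < \<bar>f \<omega>\<bar>}) \<le> 9 * (D\<^sup>2 / m\<^sup>2)" .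
  have "prob (\<Union>f\<in>rate_stats \<tau>. {\<omega> \<in> space M. m * r < \<bar>f \<omega>\<bar>}) \<le> (\<Sum>f\<in>rate_stats \<tau>. prob {\<omega> \<in> space M. m * r < \<bar>f \<omega>\<bar>})"
    using fin sets' by (intro finite_measure_subadditive_finite) auto
  also have "\<dots> \<le> (\<Sum>f\<in>rate_stats \<tau>. 2 * D\<^sup>2 / m\<^sup>2)"
  proof (rule sum_mono)
    fix f assume "f \<in> rate_stats \<tau>"
    then have "prob {\<omega> \<in> space M. m * r < \<bar>f \<omega>\<bar>} \<le> 2 * D\<^sup>2 * (1 / N + 1 / T) / (m * r)\<^sup>2"
      using rate_stats[OF \<tau>] m r by (intro chebyshev) auto
    also have "\<dots> \<le> 2 * D\<^sup>2 * r\<^sup>2 / (m * r)\<^sup>2"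
      using r by (intro divide_right_mono mult_left_mono) auto
    also have "\<dots> = 2 * D\<^sup>2 / m\<^sup>2" using r by (simp add: power_mult_distrib)
    finally show "prob {\<omega> \<in> space M. m * r < \<bar>f \<omega>\<bar>} \<le> 2 * D\<^sup>2 / m\<^sup>2" .
  qed
  also have "\<dots> = real (card (rate_stats \<tau>)) * (2 * D\<^sup>2 / m\<^sup>2)" by simp
  also have "\<dots> \<le> 7 * (2 * D\<^sup>2 / m\<^sup>2)" using card(2) by (intro mult_right_mono) auto
  finally have 2: "prob (\<Union>f\<in>rate_stats \<tau>. {\<omega> \<in> space M. m * r < \<bar>f \<omega>\<bar>}) \<le> 7 * (2 * D\<^sup>2 / m\<^sup>2)" .
  show "prob (exceed \<tau> m r) \<le> 23 * D\<^sup>2 / m\<^sup>2"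
    unfolding exceed_def using measure_Un_le[OF A B] 1 2 by simp
qed

lemma stats_le:
  assumes \<omega>: "\<omega> \<in> space M" "\<omega> \<notin> exceed \<tau> m r"
  shows "f \<in> level_stats \<tau> \<Longrightarrow> f \<omega> \<le> m" "f \<in> rate_stats \<tau> \<Longrightarrow> f \<omega> \<le> m * r"
  using \<omega> unfolding exceed_def by (fastforce simp: not_less abs_le_iff)+

lemma sample_boundsI:
  assumes \<omega>: "\<omega> \<in> space M" "\<omega> \<notin> exceed \<tau> m r" and \<tau>: "\<tau> \<in> {1..T}"
    and pos: "0 < m" "0 < \<kappa>" "0 < c" "0 < r" "r \<le> 1"
    and "\<And>v. \<kappa> * (norm v)\<^sup>2 \<le> avg {1..T} (\<lambda>t. (F t \<omega> \<bullet> v)\<^sup>2)"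
    and "\<And>v. avg {1..T} (\<lambda>t. (F t \<omega> \<bullet> v)\<^sup>2) \<le> m * (norm v)\<^sup>2"
    and "\<And>v. \<kappa> * (norm v)\<^sup>2 \<le> avg {1..N} (\<lambda>j. (\<Lambda> j \<omega> \<bullet> v)\<^sup>2)"
    and "\<And>G :: nat \<Rightarrow> real ^ 'k. normalized T G \<Longrightarrow>
      posdef (design_matrix N T (\<lambda>i t. X i t \<omega>) (\<lambda>i. \<Lambda> i \<omega>) G - c *\<^sub>R mat 1)"
  shows "sample_bounds N T (\<lambda>t. F t \<omega>) (\<lambda>j. \<Lambda> j \<omega>) (\<lambda>j t. X j t \<omega>) (\<lambda>j t. u j t \<omega>) m \<kappa> c r \<tau>"
  by unfold_locales
    (fact N T \<tau> pos assms(9-12) | rule stats_le[OF \<omega>, unfolded level_stats_def rate_stats_def], simp)+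

end

section \<open>Limit matrices and the passage to probability\<close>

lemma norm_mult_vec_le: "norm (A *v v) \<le> norm A * norm v" for A :: "real ^ 'n ^ 'm"
proof (rule power2_le_imp_le)
  have "(norm (A *v v))\<^sup>2 = (\<Sum>a\<in>UNIV. (A $ a \<bullet> v)\<^sup>2)"
    by (simp add: norm_vec_power2 matrix_vector_mul_component)
  also have "\<dots> \<le> (\<Sum>a\<in>UNIV. (norm (A $ a) * norm v)\<^sup>2)"
    by (intro sum_mono) (metis Cauchy_Schwarz_ineq2 abs_ge_zero power2_abs power_mono)
  also have "\<dots> = (\<Sum>a\<in>UNIV. (norm (A $ a))\<^sup>2) * (norm v)\<^sup>2"
    by (simp add: power_mult_distrib sum_distrib_right)
  also have "(\<Sum>a\<in>UNIV. (norm (A $ a))\<^sup>2) = (norm A)\<^sup>2"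
    by (simp add: norm_vec_def[of A] L2_set_def sum_nonneg)
  finally show "(norm (A *v v))\<^sup>2 \<le> (norm A * norm v)\<^sup>2" by (simp add: power_mult_distrib)
qed simp

lemma abs_quadratic_le: "\<bar>v \<bullet> (A *v v)\<bar> \<le> norm A * (norm v)\<^sup>2" for A :: "real ^ 'n ^ 'n"
  using Cauchy_Schwarz_ineq2[of v "A *v v"] mult_left_mono[OF norm_mult_vec_le[of A v] norm_ge_zero[of v]]
  by (simp add: power2_eq_square mult_ac)

text \<open>The minimum of the quadratic form over the unit sphere is attained by compactness, and
  homogeneity extends the bound to all \<open>v\<close>.\<close>

lemma posdef_lower_bound:
  fixes A :: "real ^ 'n ^ 'n"
  assumes "posdef A"
  obtains \<kappa> where "0 < \<kappa>" "\<And>v. \<kappa> * (norm v)\<^sup>2 \<le> v \<bullet> (A *v v)"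
proof -
  let ?S = "sphere (0 :: real ^ 'n) 1"
  have "continuous_on ?S (\<lambda>v. v \<bullet> (A *v v))"
    unfolding matrix_vector_mult_def inner_vec_def by (simp, intro continuous_intros)
  moreover have "?S \<noteq> {}" by simp
  ultimately obtain w where w: "w \<in> ?S" "\<And>v. v \<in> ?S \<Longrightarrow> w \<bullet> (A *v w) \<le> v \<bullet> (A *v v)"
    using continuous_attains_inf[OF compact_sphere] by blast
  show ?thesis
  proof
    have "w \<noteq> 0" using w(1) by auto
    then show "0 < w \<bullet> (A *v w)" using assms by (simp add: posdef_def)
    show "w \<bullet> (A *v w) * (norm v)\<^sup>2 \<le> v \<bullet> (A *v v)" for v
    proof (cases "v = 0")
      case False
      then have "w \<bullet> (A *v w) \<le> ((1 / norm v) *\<^sub>R v) \<bullet> (A *v ((1 / norm v) *\<^sub>R v))"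
        by (intro w(2)) simp
      also have "\<dots> = v \<bullet> (A *v v) / (norm v)\<^sup>2"
        by (simp add: matrix_vector_mult_scaleR power2_eq_square)
      finally show ?thesis using False by (simp add: le_divide_eq)
    qed simp
  qed
qed

lemma tmul_measurable:
  fixes A :: "nat \<Rightarrow> 'w \<Rightarrow> real ^ 'k"
  assumes "\<And>i. i \<in> {1..m} \<Longrightarrow> A i \<in> borel_measurable M"
  shows "(\<lambda>\<omega>. (1 / real m) *\<^sub>R tmul m (\<lambda>i. A i \<omega>) (\<lambda>i. A i \<omega>)) \<in> borel_measurable M"
proof (subst borel_measurable_euclidean_space, rule ballI)
  fix b :: "real ^ 'k ^ 'k" assume "b \<in> Basis"
  then obtain i j where b: "b = axis i (axis j 1)" by (auto simp: Basis_vec_def)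
  have eq: "((1 / real m) *\<^sub>R tmul m (\<lambda>i. A i \<omega>) (\<lambda>i. A i \<omega>)) \<bullet> b
      = (1 / real m) * (\<Sum>l=1..m. (A l \<omega> \<bullet> axis i 1) * (A l \<omega> \<bullet> axis j 1))" for \<omega>
    by (simp add: b inner_axis tmul_component)
  show "(\<lambda>\<omega>. ((1 / real m) *\<^sub>R tmul m (\<lambda>i. A i \<omega>) (\<lambda>i. A i \<omega>)) \<bullet> b) \<in> borel_measurable M"
    unfolding eq using assms by (intro borel_measurable_times borel_measurable_sum borel_measurable_inner) auto
qed

theorem lemma3:
  fixes M :: "nat \<Rightarrow> 'w measure"
    and N T :: "nat \<Rightarrow> nat"
    and F :: "nat \<Rightarrow> nat \<Rightarrow> 'w \<Rightarrow> real ^ 'k"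
    and \<Lambda> :: "nat \<Rightarrow> nat \<Rightarrow> 'w \<Rightarrow> real ^ 'k"
    and X :: "nat \<Rightarrow> nat \<Rightarrow> nat \<Rightarrow> 'w \<Rightarrow> real ^ 'p"
    and u Y :: "nat \<Rightarrow> nat \<Rightarrow> nat \<Rightarrow> 'w \<Rightarrow> real"
    and \<beta> :: "real ^ 'p"
    and Fh :: "nat \<Rightarrow> nat \<Rightarrow> 'w \<Rightarrow> real ^ 'k"
    and Lh :: "nat \<Rightarrow> nat \<Rightarrow> 'w \<Rightarrow> real ^ 'k"
    and bh :: "nat \<Rightarrow> 'w \<Rightarrow> real ^ 'p"
    and D1 :: real
    and \<Sigma>F \<Sigma>L :: "real ^ 'k ^ 'k"
  assumes prob: "\<And>n. prob_space (M n)"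
    and sizes: "\<And>n. 1 \<le> N n" "\<And>n. 1 \<le> T n"
      "filterlim N at_top sequentially" "filterlim T at_top sequentially"
    and rv_F: "\<And>n t. t \<in> {1..T n} \<Longrightarrow> F n t \<in> borel_measurable (M n)"
    and rv_\<Lambda>: "\<And>n j. j \<in> {1..N n} \<Longrightarrow> \<Lambda> n j \<in> borel_measurable (M n)"
    and rv_X: "\<And>n j t. j \<in> {1..N n} \<Longrightarrow> t \<in> {1..T n} \<Longrightarrow> X n j t \<in> borel_measurable (M n)"
    and rv_u: "\<And>n j t. j \<in> {1..N n} \<Longrightarrow> t \<in> {1..T n} \<Longrightarrow> u n j t \<in> borel_measurable (M n)"
    and model: "\<And>n j t \<omega>. j \<in> {1..N n} \<Longrightarrow> t \<in> {1..T n} \<Longrightarrow> \<omega> \<in> space (M n) \<Longrightarrow>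
      Y n j t \<omega> = ife_mean (\<Lambda> n j \<omega>) (F n t \<omega>) (X n j t \<omega>) \<beta> + u n j t \<omega>"
    and mean_zero: "\<And>n j t. j \<in> {1..N n} \<Longrightarrow> t \<in> {1..T n} \<Longrightarrow> (\<integral>\<omega>. u n j t \<omega> \<partial>M n) = 0"
    and D1_pos: "0 < D1"
    and moment_X: "\<And>n i t. i \<in> {1..N n} \<Longrightarrow> t \<in> {1..T n} \<Longrightarrow>
      (\<integral>\<^sup>+\<omega>. ennreal (norm (X n i t \<omega>) ^ 4) \<partial>M n) \<le> ennreal D1"
    and moment_F: "\<And>n t. t \<in> {1..T n} \<Longrightarrow>
      (\<integral>\<^sup>+\<omega>. ennreal (norm (F n t \<omega>) ^ 4) \<partial>M n) \<le> ennreal D1"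
    and moment_\<Lambda>: "\<And>n i. i \<in> {1..N n} \<Longrightarrow>
      (\<integral>\<^sup>+\<omega>. ennreal (norm (\<Lambda> n i \<omega>) ^ 4) \<partial>M n) \<le> ennreal D1"
    and moment_u: "\<And>n i t. i \<in> {1..N n} \<Longrightarrow> t \<in> {1..T n} \<Longrightarrow>
      (\<integral>\<^sup>+\<omega>. ennreal (\<bar>u n i t \<omega>\<bar> ^ 8) \<partial>M n) \<le> ennreal D1"
    and dep_units: "\<And>n. (1 / real (N n)) * (\<Sum>i=1..N n. \<Sum>j=1..N n.
      (MAX t\<in>{1..T n}. MAX s\<in>{1..T n}. \<bar>\<integral>\<omega>. u n i t \<omega> * u n j s \<omega> \<partial>M n\<bar>)) \<le> D1"
    and dep_times: "\<And>n. (1 / real (T n)) * (\<Sum>s=1..T n. \<Sum>t=1..T n.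
      (MAX i\<in>{1..N n}. MAX j\<in>{1..N n}. \<bar>\<integral>\<omega>. u n i t \<omega> * u n j s \<omega> \<partial>M n\<bar>)) \<le> D1"
    and dep_all: "\<And>n. (1 / (real (N n) * real (T n))) *
      (\<Sum>i=1..N n. \<Sum>j=1..N n. \<Sum>s=1..T n. \<Sum>t=1..T n.
        \<bar>\<integral>\<omega>. u n i t \<omega> * u n j s \<omega> \<partial>M n\<bar>) \<le> D1"
    and fourth_moment: "\<And>n t s. t \<in> {1..T n} \<Longrightarrow> s \<in> {1..T n} \<Longrightarrow>
      (\<integral>\<^sup>+\<omega>. ennreal (\<bar>(1 / sqrt (real (N n))) * (\<Sum>i=1..N n.
          u n i s \<omega> * u n i t \<omega> - (\<integral>\<omega>'. u n i s \<omega>' * u n i t \<omega>' \<partial>M n))\<bar> ^ 4) \<partial>M n) \<le> ennreal D1"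
    and cov_times: "\<And>n. (1 / ((real (T n))\<^sup>2 * real (N n))) *
      (\<Sum>t=1..T n. \<Sum>s=1..T n. \<Sum>q=1..T n. \<Sum>v=1..T n. \<Sum>i=1..N n. \<Sum>j=1..N n.
        \<bar>cov (M n) (\<lambda>\<omega>. u n i t \<omega> * u n i s \<omega>) (\<lambda>\<omega>. u n j q \<omega> * u n j v \<omega>)\<bar>) \<le> D1"
    and cov_units: "\<And>n. (1 / (real (T n) * (real (N n))\<^sup>2)) *
      (\<Sum>t=1..T n. \<Sum>s=1..T n. \<Sum>i=1..N n. \<Sum>j=1..N n. \<Sum>l=1..N n. \<Sum>q=1..N n.
        \<bar>cov (M n) (\<lambda>\<omega>. u n i t \<omega> * u n j t \<omega>) (\<lambda>\<omega>. u n l s \<omega> * u n q s \<omega>)\<bar>) \<le> D1"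
    and largest_eigenvalue: "\<And>n i e. i \<in> {1..N n} \<Longrightarrow>
      eigenvalue (Matrix.mat (T n) (T n)
        (\<lambda>(t, s). \<integral>\<omega>. u n i (Suc t) \<omega> * u n i (Suc s) \<omega> \<partial>M n)) e \<Longrightarrow> e \<le> D1"
    and indep: "\<And>n. indep_rv (M n)
      (Pi\<^sub>M ({1..N n} \<times> {1..T n}) (\<lambda>_. borel))
      (\<lambda>\<omega>. \<lambda>(j, t)\<in>{1..N n} \<times> {1..T n}. u n j t \<omega>)
      (Pi\<^sub>M ({1..N n} \<times> {1..T n}) (\<lambda>_. borel) \<Otimes>\<^sub>M
        (Pi\<^sub>M {1..T n} (\<lambda>_. borel) \<Otimes>\<^sub>M Pi\<^sub>M {1..N n} (\<lambda>_. borel)))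
      (\<lambda>\<omega>. (\<lambda>(j, t)\<in>{1..N n} \<times> {1..T n}. X n j t \<omega>,
        \<lambda>t\<in>{1..T n}. F n t \<omega>, \<lambda>j\<in>{1..N n}. \<Lambda> n j \<omega>))"
    and \<Sigma>_pos: "posdef \<Sigma>F" "posdef \<Sigma>L"
    and lim_F: "conv_in_prob M
      (\<lambda>n \<omega>. (1 / real (T n)) *\<^sub>R tmul (T n) (\<lambda>t. F n t \<omega>) (\<lambda>t. F n t \<omega>)) \<Sigma>F"
    and lim_\<Lambda>: "conv_in_prob M
      (\<lambda>n \<omega>. (1 / real (N n)) *\<^sub>R tmul (N n) (\<lambda>j. \<Lambda> n j \<omega>) (\<lambda>j. \<Lambda> n j \<omega>)) \<Sigma>L"
    and ratio: "\<exists>c>0. \<exists>C. \<forall>n. c \<le> real (N n) / real (T n) \<and> real (N n) / real (T n) \<le> C"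
    and design: "inf_design_positive M N T X \<Lambda>"
    and rv_Fh: "\<And>n t. t \<in> {1..T n} \<Longrightarrow> Fh n t \<in> borel_measurable (M n)"
    and rv_Lh: "\<And>n j. j \<in> {1..N n} \<Longrightarrow> Lh n j \<in> borel_measurable (M n)"
    and rv_bh: "\<And>n. bh n \<in> borel_measurable (M n)"
    and estimator: "\<forall>\<^sub>F n in sequentially. AE \<omega> in M n.
      is_least_squares (N n) (T n) (\<lambda>j t. Y n j t \<omega>) (\<lambda>j t. X n j t \<omega>)
        (\<lambda>t. Fh n t \<omega>) (\<lambda>j. Lh n j \<omega>) (bh n \<omega>)"
  shows "(\<forall>\<tau>. (\<forall>n. \<tau> n \<in> {1..T n}) \<longrightarrow>
      big_OP M (\<lambda>n \<omega>.
          ife_mean (Lh n 1 \<omega>) (Fh n (\<tau> n) \<omega>) (X n 1 (\<tau> n) \<omega>) (bh n \<omega>)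
          - ife_mean (\<Lambda> n 1 \<omega>) (F n (\<tau> n) \<omega>) (X n 1 (\<tau> n) \<omega>) \<beta>)
        (\<lambda>n. 1 / sqrt (real (T n)) + 1 / sqrt (real (N n))))
    \<and> big_OP M (\<lambda>n \<omega>. (1 / real (T n)) * (\<Sum>t=1..T n.
          (ife_mean (Lh n 1 \<omega>) (Fh n t \<omega>) (X n 1 t \<omega>) (bh n \<omega>)
           - ife_mean (\<Lambda> n 1 \<omega>) (F n t \<omega>) (X n 1 t \<omega>) \<beta>)\<^sup>2))
        (\<lambda>n. 1 / real (T n) + 1 / real (N n))"
proof -
  define r where "r = (\<lambda>n. 1 / sqrt (real (T n)) + 1 / sqrt (real (N n)))"
  have N0: "0 < real (N n)" and T0: "0 < real (T n)" for n
    using sizes(1,2)[of n] by auto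
  have r_pos: "0 < r n" for n using N0 T0 by (simp add: r_def add_pos_pos)
  \<comment> \<open>The square of \<open>r n\<close> and \<open>1/N + 1/T\<close> agree up to a
    factor 2. The first inequality feeds Chebyshev, the second the squared \<open>rms\<close> error
    at the end.\<close>
  have r_sq: "1 / real (N n) + 1 / real (T n) \<le> (r n)\<^sup>2" "(r n)\<^sup>2 \<le> 2 * (1 / real (T n) + 1 / real (N n))" for n
  proof -
    define a b where "a = 1 / sqrt (real (T n))" and "b = 1 / sqrt (real (N n))"
    have ab: "1 / real (T n) = a\<^sup>2" "1 / real (N n) = b\<^sup>2" "0 \<le> a" "0 \<le> b"
      by (simp_all add: a_def b_def power_divide)
    have r: "(r n)\<^sup>2 = a\<^sup>2 + b\<^sup>2 + 2 * a * b" by (simp add: r_def a_def b_def power2_sum)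
    have "0 \<le> 2 * a * b" using ab by simp
    then show "1 / real (N n) + 1 / real (T n) \<le> (r n)\<^sup>2" unfolding ab r by simp
    show "(r n)\<^sup>2 \<le> 2 * (1 / real (T n) + 1 / real (N n))"
      unfolding ab r using sum_squares_bound[of a b] by simp
  qed
  have r_lim: "r \<longlonglongrightarrow> 0"
  proof -
    have "((\<lambda>n. inverse (sqrt (real (f n)))) \<longlongrightarrow> 0) sequentially" if "filterlim f at_top sequentially" for f :: "nat \<Rightarrow> nat"
      by (intro tendsto_inverse_0_at_top filterlim_compose[OF sqrt_at_top]
          filterlim_compose[OF filterlim_real_sequentially that])
    from tendsto_add[OF this[OF sizes(4)] this[OF sizes(3)]] show ?thesis
      by (simp add: r_def[abs_def] inverse_eq_divide)
  qed
  define err where "err = (\<lambda>n \<omega> t. ife_mean (Lh n 1 \<omega>) (Fh n t \<omega>) (X n 1 t \<omega>) (bh n \<omega>)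
      - ife_mean (\<Lambda> n 1 \<omega>) (F n t \<omega>) (X n 1 t \<omega>) \<beta>)"
  have sample: "ife_sample (M n) (N n) (T n) (F n) (\<Lambda> n) (X n) (u n) D1" for n
    by (intro ife_sample.intro ife_sample_axioms.intro)
      (fact prob sizes(1,2) D1_pos rv_F rv_\<Lambda> rv_X rv_u moment_X moment_F moment_\<Lambda> moment_u
        dep_units dep_times dep_all fourth_moment largest_eigenvalue indep)+
  \<comment> \<open>Both error bounds hold off one measurable exceptional set, from which either
    conclusion follows by monotonicity of the measure.\<close>
  have main: "\<exists>C. \<forall>\<^sub>F n in sequentially. \<exists>B\<in>sets (M n). measure (M n) B \<le> \<epsilon> \<and>
      (\<forall>\<omega>\<in>space (M n) - B. rms {1..T n} (err n \<omega>) \<le> C * r n \<and> \<bar>err n \<omega> (\<tau> n)\<bar> \<le> C * r n)"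
    if \<tau>: "\<And>n. \<tau> n \<in> {1..T n}" and \<epsilon>: "0 < \<epsilon>" for \<tau> \<epsilon>
  proof -
    \<comment> \<open>The cap 1/2 keeps the probability of the design event positive, which later
      yields its measurability.\<close>
    define \<delta> where "\<delta> = min (\<epsilon> / 4) (1 / 2)"
    have \<delta>: "0 < \<delta>" "\<delta> < 1" "\<delta> \<le> \<epsilon> / 4" using \<epsilon> by (auto simp: \<delta>_def)
    define good where "good = (\<lambda>c n. {\<omega> \<in> space (M n). \<forall>G :: nat \<Rightarrow> real ^ 'k. normalized (T n) G \<longrightarrow>
         posdef (design_matrix (N n) (T n) (\<lambda>i t. X n i t \<omega>) (\<lambda>i. \<Lambda> n i \<omega>) G - c *\<^sub>R mat 1)})"
    obtain c where c: "0 < c" and ev_design: "\<forall>\<^sub>F n in sequentially. 1 - \<delta> \<le> measure (M n) (good c n)"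
      using design \<delta>(1) unfolding inf_design_positive_def good_def by blast
    obtain \<kappa>F where \<kappa>F: "0 < \<kappa>F" "\<And>v. \<kappa>F * (norm v)\<^sup>2 \<le> v \<bullet> (\<Sigma>F *v v)"
      using posdef_lower_bound[OF \<Sigma>_pos(1)] by blast
    obtain \<kappa>L where \<kappa>L: "0 < \<kappa>L" "\<And>v. \<kappa>L * (norm v)\<^sup>2 \<le> v \<bullet> (\<Sigma>L *v v)"
      using posdef_lower_bound[OF \<Sigma>_pos(2)] by blast
    \<comment> \<open>Half of the smaller lower bound: a sample matrix within
      \<open>\<kappa>\<close> of its limit then still has a quadratic form of at least
      \<open>\<kappa> * (norm v)\<^sup>2\<close>.\<close>
    define \<kappa> where "\<kappa> = min \<kappa>F \<kappa>L / 2"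
    have \<kappa>: "0 < \<kappa>" "2 * \<kappa> \<le> \<kappa>F" "2 * \<kappa> \<le> \<kappa>L" using \<kappa>F(1) \<kappa>L(1) by (auto simp: \<kappa>_def)
    define \<Delta> where "\<Delta> = 1 + D1"
    \<comment> \<open>The first entry bounds the second moments of the factors from above; the
      second makes \<open>23 * \<Delta>\<^sup>2 / m\<^sup>2\<close> at most
      \<open>\<epsilon> / 4\<close>, with \<open>92 = 4 * 23\<close>.\<close>
    define m where "m = max (norm \<Sigma>F + \<kappa>) (sqrt (92 * \<Delta>\<^sup>2 / \<epsilon>))"
    have m: "0 < m" "norm \<Sigma>F + \<kappa> \<le> m" using \<kappa>(1) by (auto simp: m_def less_max_iff_disj add_nonneg_pos)
    have m\<epsilon>: "23 * \<Delta>\<^sup>2 / m\<^sup>2 \<le> \<epsilon> / 4"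
    proof -
      have "92 * \<Delta>\<^sup>2 / \<epsilon> = (sqrt (92 * \<Delta>\<^sup>2 / \<epsilon>))\<^sup>2" using \<epsilon> by simp
      also have "\<dots> \<le> m\<^sup>2" using \<epsilon> by (intro power_mono) (auto simp: m_def)
      finally have "92 * \<Delta>\<^sup>2 \<le> m\<^sup>2 * \<epsilon>" using \<epsilon> by (simp add: divide_le_eq)
      then show ?thesis using m(1) by (simp add: divide_le_eq mult.commute)
    qed
    define SF where "SF = (\<lambda>n \<omega>. (1 / real (T n)) *\<^sub>R tmul (T n) (\<lambda>t. F n t \<omega>) (\<lambda>t. F n t \<omega>))"
    define SL where "SL = (\<lambda>n \<omega>. (1 / real (N n)) *\<^sub>R tmul (N n) (\<lambda>j. \<Lambda> n j \<omega>) (\<lambda>j. \<Lambda> n j \<omega>))"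
    define BF where "BF = (\<lambda>n. {\<omega> \<in> space (M n). norm (SF n \<omega> - \<Sigma>F) > \<kappa>})"
    define BL where "BL = (\<lambda>n. {\<omega> \<in> space (M n). norm (SL n \<omega> - \<Sigma>L) > \<kappa>})"
    have "(\<lambda>n. measure (M n) (BF n)) \<longlonglongrightarrow> 0" "(\<lambda>n. measure (M n) (BL n)) \<longlonglongrightarrow> 0"
      using lim_F lim_\<Lambda> \<kappa>(1) unfolding conv_in_prob_def BF_def BL_def SF_def SL_def by blast+
    then have ev_lim: "\<forall>\<^sub>F n in sequentially. measure (M n) (BF n) < \<epsilon> / 4" "\<forall>\<^sub>F n in sequentially. measure (M n) (BL n) < \<epsilon> / 4"
      using \<epsilon> by (auto intro!: order_tendstoD(2)[where a = "\<epsilon> / 4"] simp del: less_divide_eq_numeral1)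
    have BF_sets: "BF n \<in> sets (M n)" for n
    proof -
      have [measurable]: "SF n \<in> borel_measurable (M n)" unfolding SF_def[abs_def] by (intro tmul_measurable rv_F)
      show ?thesis unfolding BF_def by measurable
    qed
    have BL_sets: "BL n \<in> sets (M n)" for n
    proof -
      have [measurable]: "SL n \<in> borel_measurable (M n)" unfolding SL_def[abs_def] by (intro tmul_measurable rv_\<Lambda>)
      show ?thesis unfolding BL_def by measurable
    qed
    obtain C r0 where r0: "0 < r0" and bounds: "\<And>N T (F :: nat \<Rightarrow> real ^ 'k) \<Lambda> (X :: nat \<Rightarrow> nat \<Rightarrow> real ^ 'p) u Y \<beta> (Fh :: nat \<Rightarrow> real ^ 'k) Lh bh r \<tau>.
      r < r0 \<Longrightarrow> sample_bounds N T F \<Lambda> X u m \<kappa> c r \<tau> \<Longrightarrow>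
      \<forall>j\<in>{1..N}. \<forall>t\<in>{1..T}. Y j t = ife_mean (\<Lambda> j) (F t) (X j t) \<beta> + u j t \<Longrightarrow>
      is_least_squares N T Y X Fh Lh bh \<Longrightarrow>
      rms {1..T} (\<lambda>t. ife_mean (Lh 1) (Fh t) (X 1 t) bh - ife_mean (\<Lambda> 1) (F t) (X 1 t) \<beta>) \<le> C * r \<and>
      \<bar>ife_mean (Lh 1) (Fh \<tau>) (X 1 \<tau>) bh - ife_mean (\<Lambda> 1) (F \<tau>) (X 1 \<tau>) \<beta>\<bar> \<le> C * r"
      using estimation_error_bounds[OF m(1) \<kappa>(1) c, where 'k = 'k and 'p = 'p] by blast
    have ev_r: "\<forall>\<^sub>F n in sequentially. r n < min r0 1"
      using r_lim r0 by (intro order_tendstoD) auto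
    show ?thesis
    proof (intro exI eventually_mono[OF eventually_conj[OF eventually_conj[OF ev_design estimator] eventually_conj[OF eventually_conj[OF ev_lim] ev_r]]])
      fix n
      assume "(1 - \<delta> \<le> measure (M n) (good c n) \<and> (AE \<omega> in M n. is_least_squares (N n) (T n) (\<lambda>j t. Y n j t \<omega>) (\<lambda>j t. X n j t \<omega>)
          (\<lambda>t. Fh n t \<omega>) (\<lambda>j. Lh n j \<omega>) (bh n \<omega>))) \<and>
          (measure (M n) (BF n) < \<epsilon> / 4 \<and> measure (M n) (BL n) < \<epsilon> / 4) \<and> r n < min r0 1"
      then have design_n: "1 - \<delta> \<le> measure (M n) (good c n)"
        and est: "AE \<omega> in M n. is_least_squares (N n) (T n) (\<lambda>j t. Y n j t \<omega>) (\<lambda>j t. X n j t \<omega>)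
          (\<lambda>t. Fh n t \<omega>) (\<lambda>j. Lh n j \<omega>) (bh n \<omega>)"
        and BF: "measure (M n) (BF n) < \<epsilon> / 4" and BL: "measure (M n) (BL n) < \<epsilon> / 4"
        and rn: "r n < r0" "r n < 1" by auto
      interpret ife_sample "M n" "N n" "T n" "F n" "\<Lambda> n" "X n" "u n" D1 by (rule sample)
      obtain Z where Z: "Z \<in> null_sets (M n)"
        and Z_sub: "{\<omega> \<in> space (M n). \<not> is_least_squares (N n) (T n) (\<lambda>j t. Y n j t \<omega>) (\<lambda>j t. X n j t \<omega>)
          (\<lambda>t. Fh n t \<omega>) (\<lambda>j. Lh n j \<omega>) (bh n \<omega>)} \<subseteq> Z"
        using est by (auto simp: eventually_ae_filter)
      \<comment> \<open>The design event quantifies over uncountably many \<open>G\<close>. It is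
        measurable because \<open>measure\<close> is 0 outside the sigma-algebra and is positive
        here.\<close>
      have "measure (M n) (good c n) \<noteq> 0" using design_n \<delta>(2) by linarith
      then have good_sets: "good c n \<in> sets (M n)" using measure_notin_sets by blast
      let ?E = "exceed (\<tau> n) m (r n)"
      have E: "?E \<in> sets (M n)" "measure (M n) ?E \<le> \<epsilon> / 4"
        using exceed[OF \<tau> m(1) r_pos r_sq(1)] m\<epsilon> unfolding D_def \<Delta>_def by auto
      \<comment> \<open>A null set and four sets of probability at most
        \<open>\<epsilon> / 4\<close> each.\<close>
      define B where "B = ((Z \<union> (space (M n) - good c n)) \<union> (BF n \<union> BL n)) \<union> ?E"
      show "\<exists>B\<in>sets (M n). measure (M n) B \<le> \<epsilon> \<and>
        (\<forall>\<omega>\<in>space (M n) - B. rms {1..T n} (err n \<omega>) \<le> C * r n \<and> \<bar>err n \<omega> (\<tau> n)\<bar> \<le> C * r n)"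
      proof (intro bexI[of _ B] conjI ballI)
        show B_sets: "B \<in> sets (M n)"
          unfolding B_def by (intro sets.Un sets.Diff sets.top good_sets BF_sets BL_sets E(1)) (use Z in auto)
        have 1: "measure (M n) (space (M n) - good c n) \<le> \<epsilon> / 4"
          using prob_compl[OF good_sets] design_n \<delta>(3) by simp
        have 2: "measure (M n) Z = 0" using Z by (rule measure_eq_0_null_sets)
        have Zs: "Z \<in> sets (M n)" using Z by auto
        have Gs: "space (M n) - good c n \<in> sets (M n)" using good_sets by auto
        have 3: "measure (M n) (Z \<union> (space (M n) - good c n)) \<le> \<epsilon> / 4"
          using measure_Un_le[OF Zs Gs] 1 2 by linarith
        have 4: "measure (M n) (BF n \<union> BL n) \<le> \<epsilon> / 4 + \<epsilon> / 4"
          using measure_Un_le[OF BF_sets[of n] BL_sets[of n]] BF BL by linarith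
        have 5: "measure (M n) ((Z \<union> (space (M n) - good c n)) \<union> (BF n \<union> BL n)) \<le> \<epsilon> / 4 + (\<epsilon> / 4 + \<epsilon> / 4)"
          using measure_Un_le[OF sets.Un[OF Zs Gs] sets.Un[OF BF_sets[of n] BL_sets[of n]]] 3 4 by linarith
        show "measure (M n) B \<le> \<epsilon>"
          unfolding B_def
          using measure_Un_le[OF sets.Un[OF sets.Un[OF Zs Gs] sets.Un[OF BF_sets[of n] BL_sets[of n]]] E(1)] 5 E(2)
          by linarith
        fix \<omega> assume "\<omega> \<in> space (M n) - B"
        then have \<omega>: "\<omega> \<in> space (M n)" "\<omega> \<notin> ?E" "\<omega> \<notin> Z" "\<omega> \<in> good c n" "\<omega> \<notin> BF n" "\<omega> \<notin> BL n"
          unfolding B_def by auto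
        have dev: "\<bar>v \<bullet> (A *v v) - v \<bullet> (\<Sigma> *v v)\<bar> \<le> \<kappa> * (norm v)\<^sup>2" if "norm (A - \<Sigma>) \<le> \<kappa>"
          for A \<Sigma> :: "real ^ 'k ^ 'k" and v
          using abs_quadratic_le[of v "A - \<Sigma>"] mult_right_mono[OF that, of "(norm v)\<^sup>2"]
          by (simp add: matrix_vector_mult_diff_rdistrib inner_diff_right)
        have F_dev: "\<bar>avg {1..T n} (\<lambda>t. (F n t \<omega> \<bullet> v)\<^sup>2) - v \<bullet> (\<Sigma>F *v v)\<bar> \<le> \<kappa> * (norm v)\<^sup>2" for v
          using dev[of "SF n \<omega>" \<Sigma>F v] \<omega>(1,5) unfolding SF_def tmul_quadratic BF_def by (simp add: not_less)
        have L_dev: "\<bar>avg {1..N n} (\<lambda>j. (\<Lambda> n j \<omega> \<bullet> v)\<^sup>2) - v \<bullet> (\<Sigma>L *v v)\<bar> \<le> \<kappa> * (norm v)\<^sup>2" for v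
          using dev[of "SL n \<omega>" \<Sigma>L v] \<omega>(1,6) unfolding SL_def tmul_quadratic BL_def by (simp add: not_less)
        have "sample_bounds (N n) (T n) (\<lambda>t. F n t \<omega>) (\<lambda>j. \<Lambda> n j \<omega>) (\<lambda>j t. X n j t \<omega>) (\<lambda>j t. u n j t \<omega>) m \<kappa> c (r n) (\<tau> n)"
        proof (rule sample_boundsI[OF \<omega>(1,2) \<tau> m(1) \<kappa>(1) c r_pos])
          show "r n \<le> 1" using rn by simp
          show "\<kappa> * (norm v)\<^sup>2 \<le> avg {1..T n} (\<lambda>t. (F n t \<omega> \<bullet> v)\<^sup>2)" for v
            using F_dev[of v] \<kappa>F(2)[of v] mult_right_mono[OF \<kappa>(2), of "(norm v)\<^sup>2"] by (simp add: abs_le_iff)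
          show "avg {1..T n} (\<lambda>t. (F n t \<omega> \<bullet> v)\<^sup>2) \<le> m * (norm v)\<^sup>2" for v
            using F_dev[of v] abs_quadratic_le[of v \<Sigma>F] mult_right_mono[OF m(2), of "(norm v)\<^sup>2"]
            by (simp add: abs_le_iff distrib_right)
          show "\<kappa> * (norm v)\<^sup>2 \<le> avg {1..N n} (\<lambda>j. (\<Lambda> n j \<omega> \<bullet> v)\<^sup>2)" for v
            using L_dev[of v] \<kappa>L(2)[of v] mult_right_mono[OF \<kappa>(3), of "(norm v)\<^sup>2"] by (simp add: abs_le_iff)
          show "posdef (design_matrix (N n) (T n) (\<lambda>i t. X n i t \<omega>) (\<lambda>i. \<Lambda> n i \<omega>) G - c *\<^sub>R mat 1)"
            if "normalized (T n) G" for G :: "nat \<Rightarrow> real ^ 'k"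
            using \<omega>(4) that unfolding good_def by blast
        qed
        moreover have "\<forall>j\<in>{1..N n}. \<forall>t\<in>{1..T n}.
            Y n j t \<omega> = ife_mean (\<Lambda> n j \<omega>) (F n t \<omega>) (X n j t \<omega>) \<beta> + u n j t \<omega>"
          by (intro ballI model \<omega>(1))
        moreover have "is_least_squares (N n) (T n) (\<lambda>j t. Y n j t \<omega>) (\<lambda>j t. X n j t \<omega>)
            (\<lambda>t. Fh n t \<omega>) (\<lambda>j. Lh n j \<omega>) (bh n \<omega>)"
          using Z_sub \<omega>(1,3) by blast
        ultimately have "rms {1..T n} (err n \<omega>) \<le> C * r n \<and> \<bar>err n \<omega> (\<tau> n)\<bar> \<le> C * r n"
          unfolding err_def by (rule bounds[OF rn(1)])
        then show "rms {1..T n} (err n \<omega>) \<le> C * r n" "\<bar>err n \<omega> (\<tau> n)\<bar> \<le> C * r n" by auto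
      qed
    qed
  qed
  \<comment> \<open>The constant \<open>C'\<close> may depend on \<open>C\<close>, but not on
    \<open>n\<close> or \<open>\<omega>\<close>.\<close>
  have bounded: "big_OP M S (\<lambda>n. R n)"
    if \<tau>: "\<And>n. \<tau> n \<in> {1..T n}"
      and le: "\<And>C. \<exists>C'. \<forall>n \<omega>. rms {1..T n} (err n \<omega>) \<le> C * r n \<longrightarrow> \<bar>err n \<omega> (\<tau> n)\<bar> \<le> C * r n \<longrightarrow> \<bar>S n \<omega>\<bar> \<le> C' * R n"
    for S R \<tau>
    unfolding big_OP_def
  proof (intro allI impI)
    fix \<epsilon> :: real assume \<epsilon>: "0 < \<epsilon>"
    obtain C where C: "\<forall>\<^sub>F n in sequentially. \<exists>B\<in>sets (M n). measure (M n) B \<le> \<epsilon> \<and>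
        (\<forall>\<omega>\<in>space (M n) - B. rms {1..T n} (err n \<omega>) \<le> C * r n \<and> \<bar>err n \<omega> (\<tau> n)\<bar> \<le> C * r n)"
      using main[OF \<tau> \<epsilon>] by (rule exE)
    obtain C' where C': "\<And>n \<omega>. rms {1..T n} (err n \<omega>) \<le> C * r n \<Longrightarrow> \<bar>err n \<omega> (\<tau> n)\<bar> \<le> C * r n \<Longrightarrow> \<bar>S n \<omega>\<bar> \<le> C' * R n"
      using le[of C] by blast
    show "\<exists>C. \<forall>\<^sub>F n in sequentially. measure (M n) {\<omega> \<in> space (M n). \<bar>S n \<omega>\<bar> > C * R n} \<le> \<epsilon>"
    proof (intro exI eventually_mono[OF C])
      fix n assume "\<exists>B\<in>sets (M n). measure (M n) B \<le> \<epsilon> \<and>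
        (\<forall>\<omega>\<in>space (M n) - B. rms {1..T n} (err n \<omega>) \<le> C * r n \<and> \<bar>err n \<omega> (\<tau> n)\<bar> \<le> C * r n)"
      then obtain B where B: "B \<in> sets (M n)" "measure (M n) B \<le> \<epsilon>"
        and good: "\<And>\<omega>. \<omega> \<in> space (M n) - B \<Longrightarrow> \<bar>S n \<omega>\<bar> \<le> C' * R n"
        using C' by blast
      interpret prob_space "M n" by (rule prob)
      have "{\<omega> \<in> space (M n). \<bar>S n \<omega>\<bar> > C' * R n} \<subseteq> B"
      proof
        fix \<omega> assume "\<omega> \<in> {\<omega> \<in> space (M n). \<bar>S n \<omega>\<bar> > C' * R n}"
        then show "\<omega> \<in> B" using good[of \<omega>] by (cases "\<omega> \<in> B") auto
      qed
      from finite_measure_mono[OF this B(1)] B(2)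
      show "measure (M n) {\<omega> \<in> space (M n). \<bar>S n \<omega>\<bar> > C' * R n} \<le> \<epsilon>"
        by (rule order_trans)
    qed
  qed
  show ?thesis
  proof (intro conjI allI impI)
    fix \<tau> assume "\<forall>n. \<tau> n \<in> {1..T n}"
    then have "\<And>n. \<tau> n \<in> {1..T n}" by blast
    then have "big_OP M (\<lambda>n \<omega>. err n \<omega> (\<tau> n)) r" 
    proof (rule bounded)
      show "\<exists>C'. \<forall>n \<omega>. rms {1..T n} (err n \<omega>) \<le> C * r n \<longrightarrow> \<bar>err n \<omega> (\<tau> n)\<bar> \<le> C * r n \<longrightarrow>
          \<bar>err n \<omega> (\<tau> n)\<bar> \<le> C' * r n" for C
        by (rule exI[of _ C]) simp
    qed
    then show "big_OP M (\<lambda>n \<omega>.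
          ife_mean (Lh n 1 \<omega>) (Fh n (\<tau> n) \<omega>) (X n 1 (\<tau> n) \<omega>) (bh n \<omega>)
          - ife_mean (\<Lambda> n 1 \<omega>) (F n (\<tau> n) \<omega>) (X n 1 (\<tau> n) \<omega>) \<beta>)
        (\<lambda>n. 1 / sqrt (real (T n)) + 1 / sqrt (real (N n)))"
      by (simp only: err_def r_def)
  next
    have eq: "1 / real (T n) * (\<Sum>t=1..T n. (err n \<omega> t)\<^sup>2) = (rms {1..T n} (err n \<omega>))\<^sup>2" for n \<omega>
      by (simp add: rms_power2 avg_def)
    have "big_OP M (\<lambda>n \<omega>. (rms {1..T n} (err n \<omega>))\<^sup>2) (\<lambda>n. 1 / real (T n) + 1 / real (N n))"
    \<comment> \<open>Any admissible sequence of periods serves here; period 1 lies in every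
      sample.\<close>
    proof (rule bounded[of "\<lambda>n. 1"])
      show "1 \<in> {1..T n}" for n using sizes(2)[of n] by simp
      fix C
      have "\<bar>(rms {1..T n} (err n \<omega>))\<^sup>2\<bar> \<le> (C\<^sup>2 * 2) * (1 / real (T n) + 1 / real (N n))"
        if "rms {1..T n} (err n \<omega>) \<le> C * r n" for n \<omega>
      proof -
        have "(rms {1..T n} (err n \<omega>))\<^sup>2 \<le> (C * r n)\<^sup>2" using that by (intro power_mono) auto
        also have "\<dots> \<le> C\<^sup>2 * (2 * (1 / real (T n) + 1 / real (N n)))"
          unfolding power_mult_distrib by (intro mult_left_mono r_sq) simp
        finally show ?thesis by (simp only: abs_power2 mult.assoc)
      qed
      then show "\<exists>C'. \<forall>n \<omega>. rms {1..T n} (err n \<omega>) \<le> C * r n \<longrightarrow> \<bar>err n \<omega> 1\<bar> \<le> C * r n \<longrightarrow>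
          \<bar>(rms {1..T n} (err n \<omega>))\<^sup>2\<bar> \<le> C' * (1 / real (T n) + 1 / real (N n))"
        by blast
    qed
    then show "big_OP M (\<lambda>n \<omega>. (1 / real (T n)) * (\<Sum>t=1..T n.
          (ife_mean (Lh n 1 \<omega>) (Fh n t \<omega>) (X n 1 t \<omega>) (bh n \<omega>)
           - ife_mean (\<Lambda> n 1 \<omega>) (F n t \<omega>) (X n 1 t \<omega>) \<beta>)\<^sup>2))
        (\<lambda>n. 1 / real (T n) + 1 / real (N n))"
      unfolding eq[symmetric] unfolding err_def .
  qed
qed

end
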